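(* Let $(\mathcal{X},d)$ be a complete, separable, non-compact, locally compact, non-branching length space and let $p>1$. Let $(\mu_t)_{t\ge0}$ and $(\nu_t)_{t\ge0}$ be two unit-speed rays in $P_p(\mathcal{X})$. Then $(\nu_t)_{t\ge0}$ is a co-ray from $\nu_0$ to $(\mu_t)_{t\ge0}$ if and only if $b_\mu(\nu_t)-b_\mu(\nu_s)=s-t$ for all $s,t\ge0$.
   Context: $P_p(\mathcal{X})$ is the set of Borel probability measures on $\mathcal{X}$ with finite $p$-th moment, with Wasserstein distance $W_p(\mu,\nu)=\big(\min_{\pi}\int d(x,y)^p\,d\pi(x,y)\big)^{1/p}$ (minimum over couplings $\pi$ of $\mu,\nu$). In a metric space $(\mathcal{Y},d)$, a ray is a continuous $\gamma:[0,\infty)\to\mathcal{Y}$ with $d(\gamma_s,\gamma_t)=|s-t|\,d(\gamma_0,\gamma_1)$ for all $s,t\ge0$; unit-speed means $d(\gamma_0,\gamma_1)=1$. A geodesic $\zeta:[a,b]\to\mathcal{Y}$ satisfies $d(\zeta_s,\zeta_t)=\frac{|t-s|}{b-a}d(\zeta_a,\zeta_b)$. For $\mu,\nu\in P_p(\mathcal{X})$ with $L=W_p(\mu,\nu)$, $T(\mu,\nu)$ is the set of curves $(\mu_t)_{0\le t\le L}$ in $P_p(\mathcal{X})$ with $\mu_0=\mu$, $\mu_L=\nu$, $W_p(\mu_s,\mu_t)=|s-t|$. Co-ray: given a unit-speed ray $(\mu_t)_{t\ge0}$ in $P_p(\mathcal{X})$, a ray $(\nu_t)_{t\ge0}$ is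 a co-ray from $\nu_0$ to $(\mu_t)_{t\ge0}$ if there exist $t_n\to+\infty$, $\nu_0^n\in P_p(\mathcal{X})$ with $W_p(\nu_0^n,\nu_0)\to0$, and $(\nu^n_t)_{0\le t\le L_n}\in T(\nu_0^n,\mu_{t_n})$, $L_n=W_p(\nu_0^n,\mu_{t_n})$, such that $W_p(\nu_t^n,\nu_t)\to0$ for every $t\ge0$. The Busemann function of a unit-speed ray $(\mu_t)_{t\ge0}$ in $P_p(\mathcal{X})$ is $b_\mu(\nu)=\lim_{t\to+\infty}[W_p(\nu,\mu_t)-t]$ for $\nu\in P_p(\mathcal{X})$ (the limit exists and is finite). $\mathcal{X}$ is non-branching if every geodesic $\zeta:[a,b]\to\mathcal{X}$ is uniquely determined by its restriction to any nontrivial subinterval. *)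

theory Defs
  imports "HOL-Analysis.Analysis" "HOL-Probability.Probability"
begin

definition curve_length :: "(real \<Rightarrow> 'a::metric_space) \<Rightarrow> real \<Rightarrow> real \<Rightarrow> ereal" where
  "curve_length \<gamma> a b =
     Sup {ereal (\<Sum>i<n. dist (\<gamma> (t i)) (\<gamma> (t (Suc i)))) | n t.
            t 0 = a \<and> t n = b \<and> (\<forall>i<n. t i \<le> t (Suc i))}"

definition length_space :: "'a::metric_space itself \<Rightarrow> bool" where
  "length_space _ \<longleftrightarrow> (\<forall>x y::'a. ereal (dist x y) =
      Inf {curve_length \<gamma> 0 1 | \<gamma>. continuous_on {0..1} \<gamma> \<and> \<gamma> 0 = x \<and> \<gamma> 1 = y})"

definition geodesic_on :: "(real \<Rightarrow> 'a::metric_space) \<Rightarrow> real \<Rightarrow> real \<Rightarrow> bool" where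
  "geodesic_on \<zeta> a b \<longleftrightarrow> a < b \<and>
     (\<forall>s\<in>{a..b}. \<forall>t\<in>{a..b}. dist (\<zeta> s) (\<zeta> t) = \<bar>t - s\<bar> / (b - a) * dist (\<zeta> a) (\<zeta> b))"

definition non_branching :: "'a::metric_space itself \<Rightarrow> bool" where
  "non_branching _ \<longleftrightarrow> (\<forall>(\<zeta>::real \<Rightarrow> 'a) \<zeta>' a b c d.
      geodesic_on \<zeta> a b \<and> geodesic_on \<zeta>' a b \<and> a \<le> c \<and> c < d \<and> d \<le> b \<and>
      (\<forall>t\<in>{c..d}. \<zeta> t = \<zeta>' t) \<longrightarrow> (\<forall>t\<in>{a..b}. \<zeta> t = \<zeta>' t))"

definition Pp :: "real \<Rightarrow> 'a::metric_space measure set" where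
  "Pp p = {\<mu>. sets \<mu> = sets borel \<and> prob_space \<mu> \<and>
              (\<exists>x0. (\<integral>\<^sup>+ x. ennreal (dist x0 x powr p) \<partial>\<mu>) < \<infinity>)}"

definition couplings :: "'a::metric_space measure \<Rightarrow> 'a measure \<Rightarrow> ('a \<times> 'a) measure set" where
  "couplings \<mu> \<nu> = {\<pi>. sets \<pi> = sets (borel \<Otimes>\<^sub>M borel) \<and> prob_space \<pi> \<and>
       distr \<pi> borel fst = \<mu> \<and> distr \<pi> borel snd = \<nu>}"

text \<open>Wasserstein distance (the infimum is attained, so this is the minimum of the paper).\<close>
definition Wp :: "real \<Rightarrow> 'a::metric_space measure \<Rightarrow> 'a measure \<Rightarrow> real" where
  "Wp p \<mu> \<nu> = (INF \<pi>\<in>couplings \<mu> \<nu>.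
       enn2real (\<integral>\<^sup>+ z. ennreal (dist (fst z) (snd z) powr p) \<partial>\<pi>)) powr (1 / p)"

definition unit_ray :: "real \<Rightarrow> (real \<Rightarrow> 'a::metric_space measure) \<Rightarrow> bool" where
  "unit_ray p \<mu> \<longleftrightarrow> (\<forall>t\<ge>0. \<mu> t \<in> Pp p) \<and> Wp p (\<mu> 0) (\<mu> 1) = 1 \<and>
     (\<forall>s\<ge>0. \<forall>t\<ge>0. Wp p (\<mu> s) (\<mu> t) = \<bar>s - t\<bar> * Wp p (\<mu> 0) (\<mu> 1))"

definition Tgeod :: "real \<Rightarrow> 'a::metric_space measure \<Rightarrow> 'a measure \<Rightarrow> (real \<Rightarrow> 'a measure) set" where
  "Tgeod p \<mu> \<nu> = {c. (\<forall>t\<in>{0..Wp p \<mu> \<nu>}. c t \<in> Pp p) \<and> c 0 = \<mu> \<and> c (Wp p \<mu> \<nu>) = \<nu> \<and>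
      (\<forall>s\<in>{0..Wp p \<mu> \<nu>}. \<forall>t\<in>{0..Wp p \<mu> \<nu>}. Wp p (c s) (c t) = \<bar>s - t\<bar>)}"

definition co_ray :: "real \<Rightarrow> (real \<Rightarrow> 'a::metric_space measure) \<Rightarrow> (real \<Rightarrow> 'a measure) \<Rightarrow> bool" where
  "co_ray p \<mu> \<nu> \<longleftrightarrow> unit_ray p \<nu> \<and>
     (\<exists>(tn::nat \<Rightarrow> real) (\<nu>0n::nat \<Rightarrow> 'a measure) (c::nat \<Rightarrow> real \<Rightarrow> 'a measure).
        filterlim tn at_top sequentially \<and>
        (\<forall>n. \<nu>0n n \<in> Pp p) \<and>
        (\<lambda>n. Wp p (\<nu>0n n) (\<nu> 0)) \<longlonglongrightarrow> 0 \<and>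
        (\<forall>n. c n \<in> Tgeod p (\<nu>0n n) (\<mu> (tn n))) \<and>
        (\<forall>t\<ge>0. (\<lambda>n. Wp p (c n t) (\<nu> t)) \<longlonglongrightarrow> 0))"

definition busemann :: "real \<Rightarrow> (real \<Rightarrow> 'a::metric_space measure) \<Rightarrow> 'a measure \<Rightarrow> real" where
  "busemann p \<mu> \<nu> = Lim at_top (\<lambda>t. Wp p \<nu> (\<mu> t) - t)"

end

theory Submission
  imports Defs
begin

text \<open>A co-ray is a limit of geodesics towards \<open>\<mu>\<close>, along which the distance to \<open>\<mu>\<close> drops at unit
  speed, so one direction is the triangle inequality. For the other one, let \<open>\<nu>\<close> be a ray along which the
  Busemann function drops at unit speed, and fix \<open>\<epsilon> > 0\<close>. Following \<open>\<nu>\<close> from \<open>\<nu> 0\<close> to \<open>\<nu> \<epsilon>\<close> and then a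
  geodesic \<open>c\<close> to \<open>\<mu> t\<close> is almost shortest for large \<open>t\<close>, hence \<open>c s\<close> almost extends the geodesic from
  \<open>\<nu> 0\<close> to \<open>\<nu> \<epsilon>\<close>. So does \<open>\<nu> (\<epsilon> + s)\<close>, exactly. As the base space is proper and non-branching, this forces
  \<open>c s\<close> and \<open>\<nu> (\<epsilon> + s)\<close> to be close. A diagonal choice with \<open>\<epsilon>\<close> tending to 0 gives the co-ray.

  Gluing is done without disintegration: it is an instance of the existence of optimal couplings for the
  cost \<open>dist (f x) (g y)\<close>. Compactness of the set of couplings comes from coding Polish spaces into
  the Cantor set, where Helly's theorem on the real line applies.\<close>

section \<open>Cantor coding of Polish spaces\<close>

text \<open>The hypothesis \<open>p > 1\<close> enters through strict convexity of the p-th power: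
  near-equality in Minkowski's inequality then tells not only that three points almost lie on a
  geodesic, but also in which ratio the middle one divides it. The first two points thus prescribe
  the distance to the third, and non-branching prescribes the third point itself. The obstacle is
  that balls of the Wasserstein space need not be compact even when those of the base space are. The
  geodesics towards \<mu> therefore cannot simply be replaced by a convergent subsequence; their
  closeness to \<nu> has to come from a stability estimate that is uniform over all competing
  measures (\<open>Wp_extension_stable\<close>). There compactness is used only pointwise in the
  base space, and one fixed plan through the measures on \<nu> absorbs the exceptional sets. A given
  curve of measures is never lifted to a measure on curves: only plans between the times 0,
  \<epsilon> and \<epsilon> + s enter.\<close>

definition cantor :: "(nat \<Rightarrow> real) \<Rightarrow> real" where
  "cantor e = (\<Sum>k. e k * (2 / 3 ^ Suc k))"

text \<open>The first ternary digit, halved, is 0 on the left third and 1 on the right third of the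
  unit interval. This is its piecewise linear extension to the line. Base 3 leaves a gap between the
  two thirds, so that reading off a bit becomes continuous.\<close>

definition first_digit :: "real \<Rightarrow> real" where
  "first_digit r = max 0 (min 1 (3 * r - 1))"

definition digit :: "nat \<Rightarrow> real \<Rightarrow> real" where
  "digit k r = first_digit (((\<lambda>r. 3 * r - 2 * first_digit r) ^^ k) r)"

lemma cantor_weights_sums: "(\<lambda>k. 2 / 3 ^ Suc k :: real) sums 1"
  using sums_mult[OF geometric_sums[of "1/3::real"], of "2/3"]
  by (simp add: power_divide)

lemma cantor_summable:
  assumes "\<And>k. e k \<in> {0..1::real}"
  shows "summable (\<lambda>k. e k * (2 / 3 ^ Suc k))"
  by (rule summable_comparison_test'[OF sums_summable[OF cantor_weights_sums], of 0])
     (use assms in \<open>auto simp: abs_mult intro!: mult_left_le_one_le divide_right_mono\<close>)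

lemma cantor_bounds:
  assumes "\<And>k. e k \<in> {0..1::real}"
  shows "cantor e \<in> {0..1}"
proof -
  have "cantor e \<le> (\<Sum>k. 2 / 3 ^ Suc k)" unfolding cantor_def
    by (intro suminf_le cantor_summable assms sums_summable[OF cantor_weights_sums])
       (use assms in \<open>auto intro!: divide_right_mono\<close>)
  moreover have "0 \<le> cantor e" unfolding cantor_def
    by (intro suminf_nonneg cantor_summable assms) (use assms in \<open>auto\<close>)
  ultimately show ?thesis using sums_unique[OF cantor_weights_sums] by simp
qed

lemma cantor_split:
  assumes "\<And>k. e k \<in> {0..1::real}"
  shows "cantor e = 2 / 3 * e 0 + cantor (\<lambda>k. e (Suc k)) / 3"
  using suminf_split_head[OF cantor_summable[of e, OF assms]]
    suminf_mult[OF cantor_summable[of "\<lambda>k. e (Suc k)"], of "1/3"] assms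
  by (simp add: cantor_def field_simps)

text \<open>Bits, as opposed to arbitrary weights in the unit interval, place
  \<open>cantor e\<close> in the left or the right third, where \<open>first_digit\<close> is exact.
  The map iterated in \<open>digit\<close> then shifts the sequence by one place.\<close>

lemma digit_cantor:
  assumes "\<And>k. e k \<in> {0, 1}"
  shows "digit k (cantor e) = e k"
proof -
  have first: "first_digit (cantor e) = e 0" if "\<And>k. e k \<in> {0, 1}" for e
  proof -
    have "e k \<in> {0..1}" for k using that[of k] by auto
    then show ?thesis using cantor_split[of e] cantor_bounds[of "\<lambda>k. e (Suc k)"] that[of 0]
      by (auto simp: first_digit_def)
  qed
  have "((\<lambda>r. 3 * r - 2 * first_digit r) ^^ k) (cantor e) = cantor (\<lambda>i. e (k + i))"
  proof (induction k)
    case (Suc k)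
    have "e i \<in> {0..1}" for i using assms[of i] by auto
    then show ?case using Suc first[of "\<lambda>i. e (k + i)"] assms cantor_split[of "\<lambda>i. e (k + i)"] by simp
  qed simp
  then show ?thesis using first[of "\<lambda>i. e (k + i)"] assms by (simp add: digit_def)
qed

lemma digit_bounds: "digit k r \<in> {0..1}"
  by (auto simp: digit_def first_digit_def)

lemma continuous_digit: "continuous_on UNIV (digit k)"
proof -
  have c: "continuous_on UNIV first_digit"
    unfolding first_digit_def by (intro continuous_intros)
  have "continuous_on UNIV ((\<lambda>r. 3 * r - 2 * first_digit r) ^^ k)"
  proof (induction k)
    case (Suc k)
    then show ?case unfolding funpow.simps comp_def
      by (intro continuous_intros continuous_on_compose2[OF c]) auto
  qed (simp add: id_def continuous_on_id)
  then show ?thesis unfolding digit_def by (intro continuous_on_compose2[OF c]) auto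
qed

text \<open>With \<open>g\<close> running through the even or the odd numbers this recovers one
  coordinate from an interleaved pair of codes. Continuity on the whole line lets weak limits pass
  through it.\<close>

lemma continuous_cantor_digits: "continuous_on UNIV (\<lambda>r. cantor (\<lambda>k. digit (g k) r))"
proof -
  have "uniform_limit UNIV (\<lambda>n r. \<Sum>k<n. digit (g k) r * (2 / 3 ^ Suc k))
      (\<lambda>r. \<Sum>k. digit (g k) r * (2 / 3 ^ Suc k)) sequentially"
    using digit_bounds
    by (intro Weierstrass_m_test[where M = "\<lambda>k. 2 / 3 ^ Suc k"] sums_summable[OF cantor_weights_sums])
       (auto simp: abs_mult intro!: mult_left_le_one_le divide_right_mono)
  then show ?thesis unfolding cantor_def
    by (rule uniform_limit_theorem[rotated])
       (auto intro!: always_eventually continuous_intros continuous_on_subset[OF continuous_digit])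
qed

lemma dense_sequence:
  obtains q :: "nat \<Rightarrow> 'a::{metric_space, second_countable_topology}"
  where "\<And>y r. r > 0 \<Longrightarrow> \<exists>j. dist y (q j) < r"
proof -
  obtain D :: "'a set" where D: "countable D" "\<And>Y. open Y \<Longrightarrow> Y \<noteq> {} \<Longrightarrow> \<exists>d\<in>D. d \<in> Y"
    using countable_dense_setE by blast
  define q where "q = from_nat_into D"
  have q: "\<exists>j. dist y (q j) < r" if "r > 0" for y r
  proof -
    obtain d where "d \<in> D" "dist y d < r" using D(2)[of "ball y r"] \<open>r > 0\<close> by auto
    then show ?thesis using from_nat_into_surj[OF D(1), of d] by (auto simp: q_def)
  qed
  then show thesis using that[of q] by blast
qed

text \<open>The bits record membership in all balls of radius 1/(m+1) about dense points. The
  decoder takes, for each m, the first centre whose ball contains the point, and passes to the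
  limit. Both directions are Borel; neither is claimed to be continuous.\<close>

lemma cantor_code:
  obtains A :: "nat \<Rightarrow> 'b::{complete_space, second_countable_topology} set" and dec :: "real \<Rightarrow> 'b"
  where "\<And>k. A k \<in> sets borel" "dec \<in> borel_measurable borel"
    "\<And>y. dec (cantor (\<lambda>k. indicator (A k) y)) = y"
proof -
  obtain q :: "nat \<Rightarrow> 'b" where q: "\<And>y r. r > 0 \<Longrightarrow> \<exists>j. dist y (q j) < r"
    using dense_sequence by blast
  define A where "A k = ball (q (snd (prod_decode k))) (1 / Suc (fst (prod_decode k)))" for k
  define f where "f m r = q (LEAST j. digit (prod_encode (m, j)) r = 1)" for m r
  \<comment> \<open>Away from the codes the centres \<open>f m r\<close> need not converge. The
    default \<open>q 0\<close> makes the sequence converge for every \<open>r\<close>, as needed for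
    the measurability of a pointwise limit.\<close>
  define dec where "dec r = lim (\<lambda>m. if Cauchy (\<lambda>m. f m r) then f m r else q 0)" for r
  have [measurable]: "digit k \<in> borel_measurable borel" for k
    by (intro borel_measurable_continuous_onI continuous_digit)
  have f[measurable]: "f m \<in> borel_measurable borel" for m
  proof -
    have "(\<lambda>r. LEAST j. digit (prod_encode (m, j)) r = 1) \<in> measurable borel (count_space UNIV)"
      by measurable
    then show ?thesis unfolding f_def by (rule measurable_compose) simp
  qed
  have C[measurable]: "Measurable.pred borel (\<lambda>r. Cauchy (\<lambda>m. f m r))"
    using sets_Collect_Cauchy[of f borel, OF f] by (simp add: pred_def)
  have "dec \<in> borel_measurable borel"
  proof (rule borel_measurable_LIMSEQ_metric)
    show "(\<lambda>r. if Cauchy (\<lambda>m. f m r) then f m r else q 0) \<in> borel_measurable borel" for m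
      by measurable
    show "(\<lambda>m. if Cauchy (\<lambda>m. f m r) then f m r else q 0) \<longlonglongrightarrow> dec r" for r
      unfolding dec_def convergent_LIMSEQ_iff[symmetric]
      by (cases "Cauchy (\<lambda>m. f m r)") (auto simp: Cauchy_convergent convergent_const)
  qed
  moreover have "dec (cantor (\<lambda>k. indicator (A k) y)) = y" for y
  proof -
    let ?r = "cantor (\<lambda>k. indicator (A k) y)"
    have dg: "digit k ?r = indicator (A k) y" for k
      by (rule digit_cantor) (auto simp: indicator_def)
    have d: "dist (f m ?r) y < 1 / Suc m" for m
    proof -
      obtain j where "dist y (q j) < 1 / Suc m" using q[of "1 / Suc m" y] by auto
      then have "digit (prod_encode (m, j)) ?r = 1" unfolding dg by (simp add: A_def dist_commute)
      from LeastI[of "\<lambda>j. digit (prod_encode (m, j)) ?r = 1", OF this]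
      have "y \<in> A (prod_encode (m, LEAST j. digit (prod_encode (m, j)) ?r = 1))"
        unfolding dg by (simp add: indicator_eq_1_iff)
      then show ?thesis by (simp add: f_def A_def del: of_nat_Suc)
    qed
    have lim: "(\<lambda>m. f m ?r) \<longlonglongrightarrow> y"
      by (rule metric_tendsto_imp_tendsto[OF LIMSEQ_inverse_real_of_nat])
         (use d less_imp_le in \<open>auto simp: inverse_eq_divide intro!: always_eventually\<close>)
    then show ?thesis using LIMSEQ_imp_Cauchy[OF lim] by (simp add: dec_def limI)
  qed
  moreover have "A k \<in> sets borel" for k unfolding A_def by simp
  ultimately show thesis using that by blast
qed

section \<open>Couplings and their sequential compactness\<close>

text \<open>Unlike \<open>couplings\<close>, the two marginals may live on different spaces: gluing
  couples plans with plans.\<close>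

definition coupled :: "('b::topological_space \<times> 'c::topological_space) measure \<Rightarrow> 'b measure \<Rightarrow> 'c measure \<Rightarrow> bool" where
  "coupled \<pi> M N \<longleftrightarrow> sets \<pi> = sets (borel \<Otimes>\<^sub>M borel) \<and> prob_space \<pi> \<and>
     distr \<pi> borel fst = M \<and> distr \<pi> borel snd = N"

lemma coupled_measurable:
  assumes "coupled \<pi> M N"
  shows "fst \<in> borel_measurable \<pi>" "snd \<in> borel_measurable \<pi>"
proof -
  have s: "sets \<pi> = sets (borel \<Otimes>\<^sub>M borel)" using assms by (simp add: coupled_def)
  show "fst \<in> borel_measurable \<pi>" "snd \<in> borel_measurable \<pi>"
    unfolding measurable_cong_sets[OF s refl] by measurable
qed

lemma coupled_prob_space:
  assumes "coupled \<pi> M N"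
  shows "prob_space M" "prob_space N" "sets M = sets borel" "sets N = sets borel"
proof -
  have M: "M = distr \<pi> borel fst" and N: "N = distr \<pi> borel snd" and P: "prob_space \<pi>"
    using assms by (simp_all add: coupled_def)
  show "prob_space M" "prob_space N"
    unfolding M N by (intro prob_space.prob_space_distr P coupled_measurable[OF assms])+
  show "sets M = sets borel" "sets N = sets borel" unfolding M N by simp_all
qed

text \<open>Outer regularity is applied to \<open>A\<close> and to its complement, giving open
  \<open>U\<close> and \<open>V\<close>. A Urysohn function that is 1 off \<open>V\<close> and 0 off
  \<open>U\<close> can differ from the indicator only on the overlap of \<open>U\<close> and
  \<open>V\<close>, whose mass is less than \<epsilon>.\<close>

lemma indicator_approx_continuous:
  fixes N :: "real measure"
  assumes "sets N = sets borel" "prob_space N" "A \<in> sets borel" "\<epsilon> > 0"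
  obtains F where "continuous_on UNIV F" "\<And>x. F x \<in> {0..1::real}"
    "(\<integral>x. \<bar>indicator A x - F x\<bar> \<partial>N) < \<epsilon>"
proof -
  interpret prob_space N by fact
  have sp[simp]: "space N = UNIV" using assms(1) sets_eq_imp_space_eq by fastforce
  have outer: "\<exists>U. B \<subseteq> U \<and> open U \<and> prob U < prob B + \<epsilon> / 2" if "B \<in> sets borel" for B
  proof -
    have "(INF U \<in> {U. B \<subseteq> U \<and> open U}. emeasure N U) < ennreal (prob B + \<epsilon> / 2)"
      using outer_regular[OF assms(1) _ that, symmetric] assms(4)
      by (simp only: emeasure_eq_measure) (simp add: ennreal_less_iff)
    then obtain U where "B \<subseteq> U" "open U" "emeasure N U < ennreal (prob B + \<epsilon> / 2)"
      by (auto simp: INF_less_iff)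
    then show ?thesis by (auto simp: emeasure_eq_measure ennreal_less_iff)
  qed
  have "- A \<in> sets borel" using assms(3) by auto
  with outer[OF assms(3)] outer[of "- A"] obtain U V where
    U: "A \<subseteq> U" "open U" "prob U < prob A + \<epsilon> / 2" and
    V: "- A \<subseteq> V" "open V" "prob V < prob (- A) + \<epsilon> / 2" by blast
  have UV: "U \<in> events" "V \<in> events" "A \<in> events" using U V assms by auto
  obtain F :: "real \<Rightarrow> real" where F: "continuous_on UNIV F" "\<And>x. F x \<in> closed_segment 1 0"
    "\<And>x. x \<in> - V \<Longrightarrow> F x = 1" "\<And>x. x \<in> - U \<Longrightarrow> F x = 0"
    using Urysohn[of "- V" "- U" "1::real" "0::real"] U V by blast
  have F01: "F x \<in> {0..1}" for x using F(2)[of x] by (simp add: closed_segment_eq_real_ivl)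
  have [measurable]: "F \<in> borel_measurable N"
    using borel_measurable_continuous_onI[OF F(1)] by (simp add: measurable_cong_sets[OF assms(1) refl])
  have "(\<integral>x. \<bar>indicator A x - F x\<bar> \<partial>N) \<le> (\<integral>x. indicator (U \<inter> V) x \<partial>N)"
  proof (rule integral_mono)
    show "integrable N (\<lambda>x. \<bar>indicator A x - F x\<bar>)"
      by (rule integrable_const_bound[where B = 1])
         (use F01 UV in \<open>auto simp: indicator_def abs_le_iff intro!: AE_I2 add_increasing2 intro: order_trans[of _ 0] order_trans[of _ 1]\<close>)
    show "\<bar>indicator A x - F x\<bar> \<le> indicator (U \<inter> V) x" for x
      using F01[of x] F(3)[of x] F(4)[of x] U(1) V(1) by (auto simp: indicator_def abs_le_iff)
  qed (use UV in \<open>auto intro!: integrable_real_indicator simp: less_top[symmetric]\<close>)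
  also have "\<dots> = prob (U \<inter> V)" using UV by simp
  also have "\<dots> = prob U + prob V - prob (U \<union> V)"
    using finite_measure_Union'[of U V] finite_measure_Diff'[of V U] UV by (simp add: Int_commute)
  also have "U \<union> V = space N" using U V by auto
  also have "prob U + prob V - prob (space N) < \<epsilon>"
    using U V prob_compl[OF UV(3)] by (simp add: Compl_eq_Diff_UNIV prob_space[simplified])
  finally show thesis using that F(1) F01 by blast
qed

text \<open>The bound sees \<open>Q\<close> only through its marginals, so one choice of
  \<open>F\<close> and \<open>G\<close> serves a whole sequence of couplings together with its
  limit.\<close>

lemma coupled_rectangle_approx:
  fixes M :: "'b::second_countable_topology measure" and N :: "'c::second_countable_topology measure"
  assumes "coupled Q M N" and [measurable]: "A \<in> sets borel" "B \<in> sets borel"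
    and [measurable]: "F \<in> borel_measurable borel" "G \<in> borel_measurable borel"
    and F: "\<And>x. F x \<in> {0..1::real}" and G: "\<And>x. G x \<in> {0..1::real}"
  shows "\<bar>measure Q (A \<times> B) - (\<integral>z. F (fst z) * G (snd z) \<partial>Q)\<bar>
    \<le> (\<integral>x. \<bar>indicator A x - F x\<bar> \<partial>M) + (\<integral>x. \<bar>indicator B x - G x\<bar> \<partial>N)"
proof -
  interpret prob_space Q using assms(1) by (simp add: coupled_def)
  note [measurable] = coupled_measurable[OF assms(1)]
  have s[measurable_cong]: "sets Q = sets (borel \<Otimes>\<^sub>M borel)" using assms(1) by (simp add: coupled_def)
  have sp: "space Q = UNIV" using sets_eq_imp_space_eq[OF s] by (simp add: space_pair_measure)
  have ind: "\<bar>indicator S x - t\<bar> \<le> 1" if "t \<in> {0..1}" for S :: "'z set" and x and t :: real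
    using that by (auto simp: indicator_def)
  have m1: "(\<integral>x. \<bar>indicator A x - F x\<bar> \<partial>M) = (\<integral>z. \<bar>indicator A (fst z) - F (fst z)\<bar> \<partial>Q)"
    using assms(1) unfolding coupled_def by (auto simp: integral_distr)
  have m2: "(\<integral>x. \<bar>indicator B x - G x\<bar> \<partial>N) = (\<integral>z. \<bar>indicator B (snd z) - G (snd z)\<bar> \<partial>Q)"
    using assms(1) unfolding coupled_def by (auto simp: integral_distr)
  have i1: "integrable Q (\<lambda>z. \<bar>indicator A (fst z) - F (fst z)\<bar>)"
    by (rule integrable_const_bound[where B = 1]) (use ind[OF F] in \<open>auto intro!: AE_I2\<close>)
  have i2: "integrable Q (\<lambda>z. \<bar>indicator B (snd z) - G (snd z)\<bar>)"
    by (rule integrable_const_bound[where B = 1]) (use ind[OF G] in \<open>auto intro!: AE_I2\<close>)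
  have i3: "integrable Q (\<lambda>z. F (fst z) * G (snd z))"
    by (rule integrable_const_bound[where B = 1])
       (use F G in \<open>auto simp: abs_mult intro!: AE_I2 mult_le_one\<close>)
  have [measurable]: "A \<times> B \<in> sets Q" using assms(2,3) by (simp add: s pair_measureI)
  have "measure Q (A \<times> B) - (\<integral>z. F (fst z) * G (snd z) \<partial>Q)
    = (\<integral>z. indicator (A \<times> B) z - F (fst z) * G (snd z) \<partial>Q)"
    using i3 sp integrable_real_indicator[of "A \<times> B" Q]
    by (subst Bochner_Integration.integral_diff) (auto simp: less_top[symmetric])
  also have "\<bar>\<dots>\<bar> \<le> (\<integral>z. \<bar>indicator (A \<times> B) z - F (fst z) * G (snd z)\<bar> \<partial>Q)"
    by (rule integral_abs_bound)
  also have "\<dots> \<le> (\<integral>z. \<bar>indicator A (fst z) - F (fst z)\<bar> + \<bar>indicator B (snd z) - G (snd z)\<bar> \<partial>Q)"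
  proof (rule integral_mono)
    show "integrable Q (\<lambda>z. \<bar>indicator (A \<times> B) z - F (fst z) * G (snd z)\<bar>)"
      using i3 integrable_real_indicator[of "A \<times> B" Q]
      by (intro integrable_abs Bochner_Integration.integrable_diff) (auto simp: less_top[symmetric])
    show "integrable Q (\<lambda>z. \<bar>indicator A (fst z) - F (fst z)\<bar> + \<bar>indicator B (snd z) - G (snd z)\<bar>)"
      using i1 i2 by auto
    fix z
    have "\<bar>a * b - f * g\<bar> \<le> \<bar>a - f\<bar> + \<bar>b - g\<bar>" if "a \<in> {0..1}" "b \<in> {0..1}" "f \<in> {0..1}" "g \<in> {0..1}"
      for a b f g :: real
    proof -
      have "a * b - f * g = a * (b - g) + (a - f) * g" by (simp add: algebra_simps)
      then have "\<bar>a * b - f * g\<bar> \<le> \<bar>a\<bar> * \<bar>b - g\<bar> + \<bar>a - f\<bar> * \<bar>g\<bar>" by (metis abs_mult abs_triangle_ineq)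
      also have "\<dots> \<le> 1 * \<bar>b - g\<bar> + \<bar>a - f\<bar> * 1"
        using that by (intro add_mono mult_mono) auto
      finally show ?thesis by simp
    qed
    from this[of "indicator A (fst z)" "indicator B (snd z)" "F (fst z)" "G (snd z)"]
    show "\<bar>indicator (A \<times> B) z - F (fst z) * G (snd z)\<bar>
      \<le> \<bar>indicator A (fst z) - F (fst z)\<bar> + \<bar>indicator B (snd z) - G (snd z)\<bar>"
      using F[of "fst z"] G[of "snd z"] by (auto simp: indicator_times)
  qed
  also have "\<dots> = (\<integral>x. \<bar>indicator A x - F x\<bar> \<partial>M) + (\<integral>x. \<bar>indicator B x - G x\<bar> \<partial>N)"
    using i1 i2 by (simp add: m1 m2)
  finally show ?thesis .
qed

text \<open>Weak convergence alone controls only continuity sets; fixed marginals upgrade it to all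
  Borel rectangles. The tolerance is cut into fifths: two for \<open>F\<close> and \<open>G\<close>
  against \<open>Q n\<close>, two against \<open>Q'\<close>, one for the convergence of the
  integrals.\<close>

lemma coupled_rectangle_limit:
  fixes M N :: "real measure"
  assumes Q: "\<And>n. coupled (Q n) M N" and Q': "coupled Q' M N"
    and lim: "\<And>F G. continuous_on UNIV F \<Longrightarrow> continuous_on UNIV G \<Longrightarrow>
        (\<And>x. F x \<in> {0..1::real}) \<Longrightarrow> (\<And>x. G x \<in> {0..1::real}) \<Longrightarrow>
        (\<lambda>n. \<integral>z. F (fst z) * G (snd z) \<partial>Q n) \<longlonglongrightarrow> (\<integral>z. F (fst z) * G (snd z) \<partial>Q')"
    and A: "A \<in> sets borel" and B: "B \<in> sets borel"
  shows "(\<lambda>n. measure (Q n) (A \<times> B)) \<longlonglongrightarrow> measure Q' (A \<times> B)"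
proof (rule metric_LIMSEQ_I)
  fix r :: real assume "r > 0"
  note P = coupled_prob_space[OF Q']
  obtain F where F: "continuous_on UNIV F" "\<And>x. F x \<in> {0..1::real}" "(\<integral>x. \<bar>indicator A x - F x\<bar> \<partial>M) < r / 5"
    using indicator_approx_continuous[OF P(3,1) A, of "r/5"] \<open>r > 0\<close> by auto
  obtain G where G: "continuous_on UNIV G" "\<And>x. G x \<in> {0..1::real}" "(\<integral>x. \<bar>indicator B x - G x\<bar> \<partial>N) < r / 5"
    using indicator_approx_continuous[OF P(4,2) B, of "r/5"] \<open>r > 0\<close> by auto
  note approx = coupled_rectangle_approx[OF _ A B borel_measurable_continuous_onI[OF F(1)]
      borel_measurable_continuous_onI[OF G(1)] F(2) G(2)]
  have "r / 5 > 0" using \<open>r > 0\<close> by simp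
  from metric_LIMSEQ_D[OF lim[OF F(1) G(1) F(2) G(2)] this]
  obtain K where K: "dist (\<integral>z. F (fst z) * G (snd z) \<partial>Q n) (\<integral>z. F (fst z) * G (snd z) \<partial>Q') < r / 5"
    if "n \<ge> K" for n by blast
  have "dist (measure (Q n) (A \<times> B)) (measure Q' (A \<times> B)) < r" if "n \<ge> K" for n
    using K[OF that] approx[OF Q[of n]] approx[OF Q'] F(3) G(3) unfolding dist_real_def by linarith
  then show "\<exists>K. \<forall>n\<ge>K. dist (measure (Q n) (A \<times> B)) (measure Q' (A \<times> B)) < r"
    by blast
qed

text \<open>The codes lie in a bounded interval, hence their laws are tight. Decoding is merely
  Borel and does not preserve weak convergence, but convergence on all Borel rectangles survives any
  Borel coding, and the fixed marginals provide it. This is why the conclusion is phrased with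
  rectangles.\<close>

lemma coupled_subseq:
  fixes M :: "'b::{complete_space, second_countable_topology} measure"
    and N :: "'c::{complete_space, second_countable_topology} measure"
  assumes \<pi>: "\<And>n. coupled (\<pi> n) M N"
  obtains r \<pi>' where "strict_mono (r :: nat \<Rightarrow> nat)" "coupled \<pi>' M N"
    "\<forall>A\<in>sets borel. \<forall>B\<in>sets borel.
      (\<lambda>n. measure (\<pi> (r n)) (A \<times> B)) \<longlonglongrightarrow> measure \<pi>' (A \<times> B)"
proof -
  obtain A1 :: "nat \<Rightarrow> 'b set" and dec1 where c1[measurable]: "\<And>k. A1 k \<in> sets borel" "dec1 \<in> borel_measurable borel"
    and d1: "\<And>y. dec1 (cantor (\<lambda>k. indicator (A1 k) y)) = y" using cantor_code by metis
  obtain A2 :: "nat \<Rightarrow> 'c set" and dec2 where c2[measurable]: "\<And>k. A2 k \<in> sets borel" "dec2 \<in> borel_measurable borel"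
    and d2: "\<And>y. dec2 (cantor (\<lambda>k. indicator (A2 k) y)) = y" using cantor_code by metis
  define enc1 where "enc1 y = cantor (\<lambda>k. indicator (A1 k) y)" for y
  define enc2 where "enc2 y = cantor (\<lambda>k. indicator (A2 k) y)" for y
  \<comment> \<open>The bits of the two coordinates are interleaved, so that a pair becomes a single
    real number and the two codes are continuous functions of it.\<close>
  define bits where "bits z k = (if even k then indicator (A1 (k div 2)) (fst z)
    else indicator (A2 (k div 2)) (snd z) :: real)" for z k
  define enc where "enc z = cantor (bits z)" for z
  define p1 where "p1 r = cantor (\<lambda>k. digit (2 * k) r)" for r
  define p2 where "p2 r = cantor (\<lambda>k. digit (2 * k + 1) r)" for r
  have p1: "p1 (enc z) = enc1 (fst z)" and p2: "p2 (enc z) = enc2 (snd z)" for z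
    unfolding p1_def p2_def enc_def enc1_def enc2_def
    by (subst digit_cantor; auto simp: bits_def indicator_def)+
  have cont: "continuous_on UNIV p1" "continuous_on UNIV p2"
    unfolding p1_def p2_def by (rule continuous_cantor_digits)+
  have [measurable]: "enc1 \<in> borel_measurable borel" "enc2 \<in> borel_measurable borel"
    unfolding enc1_def enc2_def cantor_def by measurable
  have [measurable]: "p1 \<in> borel_measurable borel" "p2 \<in> borel_measurable borel"
    using cont by (auto intro: borel_measurable_continuous_onI)
  have s[measurable_cong]: "sets (\<pi> n) = sets (borel \<Otimes>\<^sub>M borel)" for n using \<pi>[of n] by (simp add: coupled_def)
  have enc_meas[measurable]: "enc \<in> borel_measurable (\<pi> n)" for n
    unfolding enc_def bits_def cantor_def by measurable
  have P: "prob_space (\<pi> n)" for n using \<pi>[of n] by (simp add: coupled_def)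
  define \<rho> where "\<rho> n = distr (\<pi> n) borel enc" for n
  have \<rho>: "real_distribution (\<rho> n)" for n
    unfolding real_distribution_def real_distribution_axioms_def \<rho>_def
    using prob_space.prob_space_distr[OF P enc_meas] by simp
  have enc01: "enc z \<in> {-1<..1}" for z
  proof -
    have "bits z k \<in> {0..1}" for k by (auto simp: bits_def indicator_def)
    from cantor_bounds[of "bits z", OF this] show ?thesis unfolding enc_def by simp
  qed
  have tight: "tight \<rho>" unfolding tight_def
  proof (intro conjI allI impI \<rho>)
    fix e :: real assume "e > 0"
    have "measure (\<rho> n) {-1<..1} = 1" for n
      using enc01 prob_space.prob_space[OF P[of n]] by (simp add: \<rho>_def measure_distr vimage_def)
    then show "\<exists>a b. a < b \<and> (\<forall>n. 1 - e < measure (\<rho> n) {a<..b})"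
      using \<open>e > 0\<close> by (intro exI[of _ "-1"] exI[of _ 1]) auto
  qed
  obtain r \<rho>' where r: "strict_mono (r :: nat \<Rightarrow> nat)" and \<rho>': "real_distribution \<rho>'" and wc: "weak_conv_m (\<rho> \<circ> r) \<rho>'"
    using tight_imp_convergent_subsubsequence[OF tight strict_mono_id] by auto
  interpret \<rho>': real_distribution \<rho>' by fact
  have conv: "(\<lambda>n. \<integral>z. f (enc1 (fst z)) (enc2 (snd z)) \<partial>\<pi> (r n)) \<longlonglongrightarrow> (\<integral>x. f (p1 x) (p2 x) \<partial>\<rho>')"
    if c: "continuous_on UNIV (\<lambda>(x, y). f x y)" and b: "\<And>x y. norm (f x y) \<le> 1"
    for f :: "real \<Rightarrow> real \<Rightarrow> 'z::{banach, second_countable_topology}"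
  proof -
    have c': "continuous_on UNIV (\<lambda>x. f (p1 x) (p2 x))"
      using continuous_on_compose2[OF c continuous_on_Pair[OF cont]] by simp
    then have [measurable]: "(\<lambda>x. f (p1 x) (p2 x)) \<in> borel_measurable borel"
      by (rule borel_measurable_continuous_onI)
    have "(\<lambda>n. integral\<^sup>L ((\<rho> \<circ> r) n) (\<lambda>x. f (p1 x) (p2 x))) \<longlonglongrightarrow> (\<integral>x. f (p1 x) (p2 x) \<partial>\<rho>')"
      by (rule weak_conv_imp_integral_bdd_continuous_conv[OF _ \<rho>' wc, where B = 1])
         (use \<rho> b c' in \<open>auto simp: continuous_on_eq_continuous_at\<close>)
    then show ?thesis by (simp add: \<rho>_def integral_distr p1 p2)
  qed
  have dis: "real_distribution (distr K borel f)" if "prob_space K" "f \<in> borel_measurable K" for K :: "'z measure" and f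
    unfolding real_distribution_def real_distribution_axioms_def using prob_space.prob_space_distr[OF that] by simp
  \<comment> \<open>All the plans have first marginal \<open>M\<close>, so the characteristic
    function of the first code is constant along the sequence and is inherited by the weak
    limit.\<close>
  have m1: "distr \<rho>' borel p1 = distr M borel enc1"
  proof (rule Levy_uniqueness)
    have "prob_space M" "sets M = sets borel" using coupled_prob_space[OF \<pi>] by auto
    then show "real_distribution (distr M borel enc1)" by (intro dis) auto
    show "real_distribution (distr \<rho>' borel p1)" by (intro dis) (simp_all add: \<rho>'.prob_space_axioms)
    show "char (distr \<rho>' borel p1) = char (distr M borel enc1)"
    proof
      fix t
      have e: "char (distr M borel enc1) t = (\<integral>z. iexp (t * enc1 (fst z)) \<partial>\<pi> (r n))" for n
      proof -
        have "M = distr (\<pi> (r n)) borel fst" using \<pi>[of "r n"] by (simp add: coupled_def)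
        then show ?thesis by (simp add: char_def integral_distr)
      qed
      have "(\<lambda>n. \<integral>z. iexp (t * enc1 (fst z)) \<partial>\<pi> (r n)) \<longlonglongrightarrow> (\<integral>x. iexp (t * p1 x) \<partial>\<rho>')"
        by (rule conv[of "\<lambda>x y. iexp (t * x)"]) (auto simp: split_beta intro!: continuous_intros)
      then show "char (distr \<rho>' borel p1) t = char (distr M borel enc1) t"
        unfolding e[symmetric] by (simp add: char_def integral_distr LIMSEQ_const_iff)
    qed
  qed
  have m2: "distr \<rho>' borel p2 = distr N borel enc2"
  proof (rule Levy_uniqueness)
    have "prob_space N" "sets N = sets borel" using coupled_prob_space[OF \<pi>] by auto
    then show "real_distribution (distr N borel enc2)" by (intro dis) auto
    show "real_distribution (distr \<rho>' borel p2)" by (intro dis) (simp_all add: \<rho>'.prob_space_axioms)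
    show "char (distr \<rho>' borel p2) = char (distr N borel enc2)"
    proof
      fix t
      have e: "char (distr N borel enc2) t = (\<integral>z. iexp (t * enc2 (snd z)) \<partial>\<pi> (r n))" for n
      proof -
        have "N = distr (\<pi> (r n)) borel snd" using \<pi>[of "r n"] by (simp add: coupled_def)
        then show ?thesis by (simp add: char_def integral_distr)
      qed
      have "(\<lambda>n. \<integral>z. iexp (t * enc2 (snd z)) \<partial>\<pi> (r n)) \<longlonglongrightarrow> (\<integral>x. iexp (t * p2 x) \<partial>\<rho>')"
        by (rule conv[of "\<lambda>x y. iexp (t * y)"]) (auto simp: split_beta intro!: continuous_intros)
      then show "char (distr \<rho>' borel p2) t = char (distr N borel enc2) t"
        unfolding e[symmetric] by (simp add: char_def integral_distr LIMSEQ_const_iff)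
    qed
  qed
  define \<pi>' where "\<pi>' = distr \<rho>' (borel \<Otimes>\<^sub>M borel) (\<lambda>x. (dec1 (p1 x), dec2 (p2 x)))"
  have P': "prob_space \<pi>'" unfolding \<pi>'_def by (rule \<rho>'.prob_space_distr) measurable
  have f1: "distr \<pi>' borel fst = M"
  proof -
    have "distr \<pi>' borel fst = distr (distr \<rho>' borel p1) borel dec1"
      unfolding \<pi>'_def by (simp add: distr_distr comp_def)
    also have "\<dots> = distr M borel (\<lambda>x. x)" unfolding m1
      using coupled_prob_space[OF \<pi>] d1 by (subst distr_distr) (auto simp: comp_def enc1_def)
    also have "\<dots> = M" using coupled_prob_space[OF \<pi>] by (intro distr_id2) auto
    finally show ?thesis .
  qed
  have f2: "distr \<pi>' borel snd = N"
  proof -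
    have "distr \<pi>' borel snd = distr (distr \<rho>' borel p2) borel dec2"
      unfolding \<pi>'_def by (simp add: distr_distr comp_def)
    also have "\<dots> = distr N borel (\<lambda>x. x)" unfolding m2
      using coupled_prob_space[OF \<pi>] d2 by (subst distr_distr) (auto simp: comp_def enc2_def)
    also have "\<dots> = N" using coupled_prob_space[OF \<pi>] by (intro distr_id2) auto
    finally show ?thesis .
  qed
  have cp: "coupled \<pi>' M N" using f1 f2 P' by (simp add: coupled_def \<pi>'_def)
  define Q where "Q n = distr (\<pi> (r n)) (borel \<Otimes>\<^sub>M borel) (\<lambda>z. (enc1 (fst z), enc2 (snd z)))" for n
  define Q' where "Q' = distr \<rho>' (borel \<Otimes>\<^sub>M borel) (\<lambda>x. (p1 x, p2 x))"
  have Q: "coupled (Q n) (distr M borel enc1) (distr N borel enc2)" for n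
  proof -
    have MN: "M = distr (\<pi> (r n)) borel fst" "N = distr (\<pi> (r n)) borel snd"
      using \<pi>[of "r n"] by (simp_all add: coupled_def)
    show ?thesis unfolding coupled_def Q_def
      by (subst MN(1), subst MN(2)) (auto simp: distr_distr comp_def intro!: prob_space.prob_space_distr P)
  qed
  have Q': "coupled Q' (distr M borel enc1) (distr N borel enc2)"
    unfolding coupled_def Q'_def m1[symmetric] m2[symmetric]
    by (auto simp: distr_distr comp_def intro!: \<rho>'.prob_space_distr)
  have "(\<lambda>n. measure (\<pi> (r n)) (A \<times> B)) \<longlonglongrightarrow> measure \<pi>' (A \<times> B)"
    if [measurable]: "A \<in> sets borel" "B \<in> sets borel" for A B
  proof -
    define A' where "A' = dec1 -` A"
    define B' where "B' = dec2 -` B"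
    have AB': "A' \<in> sets borel" "B' \<in> sets borel"
      using measurable_sets[OF c1(2) that(1)] measurable_sets[OF c2(2) that(2)] by (simp_all add: A'_def B'_def)
    have AB'2: "A' \<times> B' \<in> sets (borel \<Otimes>\<^sub>M borel)" "A \<times> B \<in> sets (borel \<Otimes>\<^sub>M borel)"
      using AB' that by (auto intro!: pair_measureI)
    have "(\<lambda>n. measure (Q n) (A' \<times> B')) \<longlonglongrightarrow> measure Q' (A' \<times> B')"
    proof (rule coupled_rectangle_limit[OF Q Q' _ AB'])
      fix F G :: "real \<Rightarrow> real"
      assume F: "continuous_on UNIV F" "continuous_on UNIV G" "\<And>x. F x \<in> {0..1}" "\<And>x. G x \<in> {0..1}"
      have [measurable]: "F \<in> borel_measurable borel" "G \<in> borel_measurable borel"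
        using F by (auto intro: borel_measurable_continuous_onI)
      have "(\<lambda>n. \<integral>z. F (enc1 (fst z)) * G (enc2 (snd z)) \<partial>\<pi> (r n)) \<longlonglongrightarrow> (\<integral>x. F (p1 x) * G (p2 x) \<partial>\<rho>')"
      proof (rule conv)
        show "continuous_on UNIV (\<lambda>(x, y). F x * G y)" unfolding split_beta
          by (intro continuous_intros continuous_on_compose2[OF F(1)] continuous_on_compose2[OF F(2)]) auto
        show "norm (F x * G y) \<le> 1" for x y using F(3)[of x] F(4)[of y] by (auto simp: abs_mult intro!: mult_le_one)
      qed
      then show "(\<lambda>n. \<integral>z. F (fst z) * G (snd z) \<partial>Q n) \<longlonglongrightarrow> (\<integral>z. F (fst z) * G (snd z) \<partial>Q')"
        unfolding Q_def Q'_def by (simp add: integral_distr)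
    qed
    moreover have "measure (Q n) (A' \<times> B') = measure (\<pi> (r n)) (A \<times> B)" for n
    proof -
      have "(\<lambda>z. (enc1 (fst z), enc2 (snd z))) -` (A' \<times> B') \<inter> space (\<pi> (r n)) = A \<times> B"
        using sets_eq_imp_space_eq[OF s[of "r n"]] d1 d2
        by (auto simp: A'_def B'_def enc1_def enc2_def space_pair_measure)
      then show ?thesis unfolding Q_def using AB'2 by (subst measure_distr) auto
    qed
    moreover have "measure Q' (A' \<times> B') = measure \<pi>' (A \<times> B)"
      unfolding Q'_def \<pi>'_def using AB'2 by (subst (1 2) measure_distr) (auto simp: A'_def B'_def vimage_def)
    ultimately show ?thesis by simp
  qed
  with r cp that show thesis by blast
qed

section \<open>Optimal couplings and gluing\<close>

text \<open>The level sets of \<open>i m\<close> are a countable Borel partition into cells of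
  diameter at most 2/(m+1).\<close>

lemma fine_partition:
  obtains i :: "nat \<Rightarrow> 'a::{metric_space, second_countable_topology} \<Rightarrow> nat" and q :: "nat \<Rightarrow> 'a"
  where "\<And>m. i m \<in> measurable borel (count_space UNIV)" "\<And>m x. dist x (q (i m x)) < 1 / Suc m"
proof -
  obtain q :: "nat \<Rightarrow> 'a" where q: "\<And>y r. r > 0 \<Longrightarrow> \<exists>j. dist y (q j) < r"
    using dense_sequence by blast
  define i where "i m x = (LEAST j. dist x (q j) < 1 / Suc m)" for m x
  have "i m \<in> measurable borel (count_space UNIV)" for m
    unfolding i_def by measurable
  moreover have "dist x (q (i m x)) < 1 / Suc m" for m x
    unfolding i_def by (rule LeastI_ex[OF q]) simp
  ultimately show thesis using that by blast
qed

text \<open>Lower semicontinuity holds for merely Borel \<open>f\<close> and \<open>g\<close>, since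
  the cost is approximated from below by functions that are constant on countably many Borel
  rectangles, and the masses of these rectangles converge. Fatou's lemma is used twice, over the
  cells and over the mesh.\<close>

lemma coupled_cost_liminf:
  fixes f :: "'b::{complete_space, second_countable_topology} \<Rightarrow> 'a::{metric_space, second_countable_topology}"
    and g :: "'c::{complete_space, second_countable_topology} \<Rightarrow> 'a"
  assumes \<pi>: "\<And>n. coupled (\<pi> n) M N" and \<pi>': "coupled \<pi>' M N"
    and lim: "\<forall>A\<in>sets borel. \<forall>B\<in>sets borel.
      (\<lambda>n. measure (\<pi> n) (A \<times> B)) \<longlonglongrightarrow> measure \<pi>' (A \<times> B)"
    and [measurable]: "f \<in> borel_measurable borel" "g \<in> borel_measurable borel" and p: "p > 0"
  shows "(\<integral>\<^sup>+z. ennreal (dist (f (fst z)) (g (snd z)) powr p) \<partial>\<pi>')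
    \<le> liminf (\<lambda>n. \<integral>\<^sup>+z. ennreal (dist (f (fst z)) (g (snd z)) powr p) \<partial>\<pi> n)"
proof -
  obtain i :: "nat \<Rightarrow> 'a \<Rightarrow> nat" and q where i[measurable]: "\<And>m. i m \<in> measurable borel (count_space UNIV)"
    and q: "\<And>m x. dist x (q (i m x)) < 1 / Suc m" using fine_partition by metis
  have s: "sets (\<pi> n) = sets (borel \<Otimes>\<^sub>M borel)" "sets \<pi>' = sets (borel \<Otimes>\<^sub>M borel)" for n
    using \<pi>[of n] \<pi>' by (simp_all add: coupled_def)
  note [measurable_cong] = s
  define h where "h m z = prod_encode (i m (f (fst z)), i m (g (snd z)))" for m and z :: "'b \<times> 'c"
  have [measurable]: "h m \<in> measurable (borel \<Otimes>\<^sub>M borel) (count_space UNIV)" for m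
    unfolding h_def by measurable
  \<comment> \<open>Each of the two centres is off by less than 1/(m+1). Subtracting 2/(m+1) keeps
    the approximation below the true cost.\<close>
  define a where "a m k = max 0 (dist (q (fst (prod_decode k))) (q (snd (prod_decode k))) - 2 / Suc m) powr p" for m k
  have ah: "a m (h m z) = max 0 (dist (q (i m (f (fst z)))) (q (i m (g (snd z)))) - 2 / Suc m) powr p" for m z
    by (simp add: a_def h_def)
  have near: "\<bar>dist (q (i m x)) (q (i m y)) - dist x y\<bar> \<le> 2 / Suc m" for m x y
    using q[of x m] q[of y m] dist_triangle[of "q (i m x)" "q (i m y)" x] dist_triangle[of x "q (i m y)" y]
      dist_triangle[of x y "q (i m x)"] dist_triangle[of "q (i m x)" y "q (i m y)"]
    by (simp add: dist_commute abs_le_iff)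
  have ale: "a m (h m z) \<le> dist (f (fst z)) (g (snd z)) powr p" for m z
    unfolding ah by (intro powr_mono2) (use p near[of m "f (fst z)" "g (snd z)"] in auto)
  have alim: "(\<lambda>m. a m (h m z)) \<longlonglongrightarrow> dist (f (fst z)) (g (snd z)) powr p" for z
  proof -
    let ?d = "dist (f (fst z)) (g (snd z))"
    have "(\<lambda>m. max 0 (dist (q (i m (f (fst z)))) (q (i m (g (snd z)))) - 2 / Suc m)) \<longlonglongrightarrow> ?d"
    proof (rule tendsto_sandwich)
      show "\<forall>\<^sub>F m in sequentially. ?d - 4 * inverse (real (Suc m)) \<le> max 0 (dist (q (i m (f (fst z)))) (q (i m (g (snd z)))) - 2 / Suc m)"
      proof (intro always_eventually allI)
        fix m
        show "?d - 4 * inverse (real (Suc m)) \<le> max 0 (dist (q (i m (f (fst z)))) (q (i m (g (snd z)))) - 2 / Suc m)"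
          using near[of m "f (fst z)" "g (snd z)"] unfolding divide_inverse by linarith
      qed
      show "\<forall>\<^sub>F m in sequentially. max 0 (dist (q (i m (f (fst z)))) (q (i m (g (snd z)))) - 2 / Suc m) \<le> ?d"
      proof (intro always_eventually allI)
        fix m
        show "max 0 (dist (q (i m (f (fst z)))) (q (i m (g (snd z)))) - 2 / Suc m) \<le> ?d"
          using near[of m "f (fst z)" "g (snd z)"] zero_le_dist[of "f (fst z)" "g (snd z)"] by linarith
      qed
      show "(\<lambda>m. ?d - 4 * inverse (real (Suc m))) \<longlonglongrightarrow> ?d"
        by (rule tendsto_eq_intros LIMSEQ_inverse_real_of_nat refl | simp)+
    qed simp
    then show ?thesis unfolding ah using p by (intro tendsto_powr2) auto
  qed
  \<comment> \<open>The sum over cells is written as an integral over the counting measure, so that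
    Fatou's lemma applies to it.\<close>
  have sum: "(\<integral>\<^sup>+z. ennreal (a m (h m z)) \<partial>\<rho>) = (\<integral>\<^sup>+k. ennreal (a m k) * emeasure \<rho> (h m -` {k}) \<partial>count_space UNIV)"
    if r: "sets \<rho> = sets (borel \<Otimes>\<^sub>M borel)" for \<rho> m
  proof -
    note [measurable_cong] = r
    have sp: "space \<rho> = UNIV" using sets_eq_imp_space_eq[OF r] by (simp add: space_pair_measure)
    have H[measurable]: "h m -` {k} \<in> sets \<rho>" for k
      using measurable_sets[of "h m" "borel \<Otimes>\<^sub>M borel" "count_space UNIV" "{k}"] r by (simp add: space_pair_measure)
    have "ennreal (a m (h m z)) = (\<Sum>k. ennreal (a m k) * indicator (h m -` {k}) z)" for z
      by (subst suminf_finite[of "{h m z}"]) (auto simp: indicator_def)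
    then have "(\<integral>\<^sup>+z. ennreal (a m (h m z)) \<partial>\<rho>) = (\<Sum>k. \<integral>\<^sup>+z. ennreal (a m k) * indicator (h m -` {k}) z \<partial>\<rho>)"
      by (simp add: nn_integral_suminf)
    also have "\<dots> = (\<Sum>k. ennreal (a m k) * emeasure \<rho> (h m -` {k}))"
      by (intro suminf_cong nn_integral_cmult_indicator H)
    finally show ?thesis by (simp add: nn_integral_count_space_nat)
  qed
  have step: "(\<integral>\<^sup>+z. ennreal (a m (h m z)) \<partial>\<pi>') \<le> liminf (\<lambda>n. \<integral>\<^sup>+z. ennreal (a m (h m z)) \<partial>\<pi> n)" for m
  proof -
    have "(\<lambda>n. emeasure (\<pi> n) (h m -` {k})) \<longlonglongrightarrow> emeasure \<pi>' (h m -` {k})" for k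
    proof -
      obtain k1 k2 where k: "k = prod_encode (k1, k2)" by (metis prod_decode_inverse surj_pair)
      have "h m -` {k} = (f -` (i m -` {k1})) \<times> (g -` (i m -` {k2}))"
        by (auto simp: h_def k)
      moreover have "i m -` {j} \<in> sets borel" for j
        using measurable_sets[OF i, of "{j}" m] by simp
      then have "f -` (i m -` {k1}) \<in> sets borel" "g -` (i m -` {k2}) \<in> sets borel"
        using measurable_sets[of f borel borel "i m -` {k1}"] measurable_sets[of g borel borel "i m -` {k2}"] by simp_all
      ultimately have "(\<lambda>n. measure (\<pi> n) (h m -` {k})) \<longlonglongrightarrow> measure \<pi>' (h m -` {k})"
        using lim by simp
      moreover have "emeasure (\<pi> n) S = measure (\<pi> n) S" "emeasure \<pi>' S = measure \<pi>' S" for n S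
        using \<pi>[of n] \<pi>' finite_measure.emeasure_eq_measure prob_space.finite_measure
        unfolding coupled_def by blast+
      ultimately show ?thesis by simp
    qed
    then have "ennreal (a m k) * emeasure \<pi>' (h m -` {k}) = liminf (\<lambda>n. ennreal (a m k) * emeasure (\<pi> n) (h m -` {k}))" for k
      by (intro lim_imp_Liminf[symmetric] ennreal_tendsto_cmult) auto
    then show ?thesis unfolding sum[OF s(1)] sum[OF s(2)]
      by (simp only:) (rule nn_integral_liminf, simp)
  qed
  have "(\<integral>\<^sup>+z. ennreal (dist (f (fst z)) (g (snd z)) powr p) \<partial>\<pi>') = (\<integral>\<^sup>+z. liminf (\<lambda>m. ennreal (a m (h m z))) \<partial>\<pi>')"
    by (intro nn_integral_cong lim_imp_Liminf[symmetric] tendsto_ennrealI alim) simp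
  also have "\<dots> \<le> liminf (\<lambda>m. \<integral>\<^sup>+z. ennreal (a m (h m z)) \<partial>\<pi>')"
    by (rule nn_integral_liminf) measurable
  also have "\<dots> \<le> liminf (\<lambda>m::nat. liminf (\<lambda>n. \<integral>\<^sup>+z. ennreal (dist (f (fst z)) (g (snd z)) powr p) \<partial>\<pi> n))"
    by (intro Liminf_mono always_eventually allI order_trans[OF step])
       (auto intro!: Liminf_mono always_eventually nn_integral_mono ennreal_leI ale)
  finally show ?thesis by (simp add: Liminf_const)
qed

lemma coupled_pair_measure:
  assumes "prob_space M" "prob_space N" "sets M = sets borel" "sets N = sets borel"
  shows "coupled (M \<Otimes>\<^sub>M N) M N"
proof -
  interpret M: prob_space M by fact
  interpret N: prob_space N by fact
  interpret pair_prob_space M N ..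
  have s: "sets (M \<Otimes>\<^sub>M N) = sets (borel \<Otimes>\<^sub>M borel)" by (rule sets_pair_measure_cong[OF assms(3,4)])
  have "distr (M \<Otimes>\<^sub>M N) borel snd = N"
  proof (rule measure_eqI)
    fix A assume "A \<in> sets (distr (M \<Otimes>\<^sub>M N) borel snd)"
    then have A: "A \<in> sets N" "A \<in> sets borel" using assms by auto
    have "emeasure (distr (M \<Otimes>\<^sub>M N) borel snd) A = emeasure (M \<Otimes>\<^sub>M N) (space M \<times> A)"
      using A sets.sets_into_space[OF A(1)] measurable_cong_sets[OF s refl, of borel]
      by (subst emeasure_distr) (auto simp: space_pair_measure intro!: arg_cong2[where f = emeasure])
    also have "\<dots> = emeasure N A" using A by (simp add: N.emeasure_pair_measure_Times M.emeasure_space_1)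
    finally show "emeasure (distr (M \<Otimes>\<^sub>M N) borel snd) A = emeasure N A" .
  qed (use assms in simp)
  moreover have "distr (M \<Otimes>\<^sub>M N) borel fst = M"
  proof -
    have "distr (M \<Otimes>\<^sub>M N) borel fst = distr (M \<Otimes>\<^sub>M N) M fst"
      by (rule distr_cong) (use assms in auto)
    then show ?thesis using N.distr_pair_fst[of M] by simp
  qed
  ultimately show ?thesis using s prob_space_axioms by (simp add: coupled_def)
qed

lemma optimal_coupling_exists:
  fixes M :: "'b::{complete_space, second_countable_topology} measure"
    and N :: "'c::{complete_space, second_countable_topology} measure"
    and f :: "'b \<Rightarrow> 'a::{metric_space, second_countable_topology}"
  assumes "prob_space M" "prob_space N" "sets M = sets borel" "sets N = sets borel"
    and f: "f \<in> borel_measurable borel" and g: "g \<in> borel_measurable borel" and p: "p > 0"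
  obtains \<pi> where "coupled \<pi> M N"
    "\<And>\<pi>'. coupled \<pi>' M N \<Longrightarrow> (\<integral>\<^sup>+z. ennreal (dist (f (fst z)) (g (snd z)) powr p) \<partial>\<pi>)
      \<le> (\<integral>\<^sup>+z. ennreal (dist (f (fst z)) (g (snd z)) powr p) \<partial>\<pi>')"
proof -
  define C where "C \<pi> = (\<integral>\<^sup>+z. ennreal (dist (f (fst z)) (g (snd z)) powr p) \<partial>\<pi>)" for \<pi>
  have "C ` {\<pi>. coupled \<pi> M N} \<noteq> {}" using coupled_pair_measure[OF assms(1-4)] by auto
  from ennreal_Inf_countable_INF[OF this] obtain c :: "nat \<Rightarrow> ennreal"
    where c: "decseq c" "range c \<subseteq> C ` {\<pi>. coupled \<pi> M N}" "Inf (C ` {\<pi>. coupled \<pi> M N}) = (INF n. c n)" by blast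
  have "\<exists>\<pi>. coupled \<pi> M N \<and> c n = C \<pi>" for n using c(2) by auto
  then obtain \<pi> where \<pi>: "\<And>n. coupled (\<pi> n) M N" "\<And>n. c n = C (\<pi> n)" by metis
  obtain r \<pi>' where r: "strict_mono (r :: nat \<Rightarrow> nat)" "coupled \<pi>' M N"
    "\<forall>A\<in>sets borel. \<forall>B\<in>sets borel. (\<lambda>n. measure (\<pi> (r n)) (A \<times> B)) \<longlonglongrightarrow> measure \<pi>' (A \<times> B)"
    by (rule coupled_subseq[of \<pi>, OF \<pi>(1)])
  have "C \<pi>' \<le> liminf (\<lambda>n. C (\<pi> (r n)))"
    unfolding C_def by (rule coupled_cost_liminf[of "\<lambda>n. \<pi> (r n)", OF \<pi>(1) r(2,3) f g p])
  also have "(\<lambda>n. C (\<pi> (r n))) = c \<circ> r" using \<pi>(2) by auto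
  also have "liminf (c \<circ> r) = (INF n. c n)"
    by (intro lim_imp_Liminf LIMSEQ_subseq_LIMSEQ[OF LIMSEQ_INF[OF c(1)] r(1)]) simp
  finally have "C \<pi>' \<le> Inf (C ` {\<pi>. coupled \<pi> M N})" using c(3) by simp
  then show thesis using that[OF r(2)] by (auto simp: C_def le_Inf_iff)
qed

text \<open>With respect to a partition of small mesh of the common target space, conditioning
  the product measure on both images lying in the same cell changes neither marginal. Hence the
  infimum of the cost is $0$, and an optimal coupling glues exactly.\<close>

lemma gluing:
  fixes M :: "'b::{complete_space, second_countable_topology} measure"
    and N :: "'c::{complete_space, second_countable_topology} measure"
    and f :: "'b \<Rightarrow> 'a::{metric_space, second_countable_topology}"
  assumes M: "prob_space M" "sets M = sets borel" and N: "prob_space N" "sets N = sets borel"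
    and f[measurable]: "f \<in> borel_measurable borel" and g[measurable]: "g \<in> borel_measurable borel"
    and eq: "distr M borel f = distr N borel g"
  obtains \<pi> where "coupled \<pi> M N" "AE z in \<pi>. f (fst z) = g (snd z)"
proof -
  interpret M: prob_space M by fact
  interpret N: prob_space N by fact
  interpret MN: pair_prob_space M N ..
  note [measurable_cong] = M(2) N(2)
  have spM: "space M = UNIV" and spN: "space N = UNIV" using sets_eq_imp_space_eq[OF M(2)] sets_eq_imp_space_eq[OF N(2)] by auto
  obtain i :: "nat \<Rightarrow> 'a \<Rightarrow> nat" and q where i[measurable]: "\<And>m. i m \<in> measurable borel (count_space UNIV)"
    and q: "\<And>m x. dist x (q (i m x)) < 1 / Suc m" using fine_partition by metis
  define w where "w m j = emeasure M {x. i m (f x) = j}" for m j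
  have wN: "w m j = emeasure N {y. i m (g y) = j}" for m j
  proof -
    have *: "{x. i m x = j} \<in> sets borel" by measurable
    have "emeasure (distr M borel f) {x. i m x = j} = emeasure (distr N borel g) {x. i m x = j}" by (simp add: eq)
    then show ?thesis unfolding w_def using * by (simp add: emeasure_distr spM spN vimage_def)
  qed
  have w_pos_M: "AE x in M. w m (i m (f x)) \<noteq> 0" for m
  proof -
    have "AE x in M. \<forall>j. w m j = 0 \<longrightarrow> i m (f x) \<noteq> j"
    proof (subst AE_all_countable, intro allI)
      fix j show "AE x in M. w m j = 0 \<longrightarrow> i m (f x) \<noteq> j"
        by (cases "w m j = 0") (auto simp: w_def spM intro!: AE_I[where N = "{x. i m (f x) = j}"])
    qed
    then show ?thesis by eventually_elim auto
  qed
  have w_pos_N: "AE x in N. w m (i m (g x)) \<noteq> 0" for m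
  proof -
    have "AE x in N. \<forall>j. w m j = 0 \<longrightarrow> i m (g x) \<noteq> j"
    proof (subst AE_all_countable, intro allI)
      fix j show "AE x in N. w m j = 0 \<longrightarrow> i m (g x) \<noteq> j"
        by (cases "w m j = 0") (auto simp: wN spN intro!: AE_I[where N = "{x. i m (g x) = j}"])
    qed
    then show ?thesis by eventually_elim auto
  qed
  have w_top: "w m j \<noteq> top" for m j unfolding w_def by simp
  \<comment> \<open>Both coordinates are in one cell, and dividing by its mass restores the
    marginals. On a cell of mass 0 \<open>inverse\<close> is infinite, but such cells are null for
    both measures by \<open>w_pos_M\<close> and \<open>w_pos_N\<close>.\<close>
  define k where "k m z = (if i m (f (fst z)) = i m (g (snd z)) then inverse (w m (i m (f (fst z)))) else 0)" for m z
  have wm[measurable]: "(\<lambda>z. inverse (w m (i m (f (fst z))))) \<in> borel_measurable (M \<Otimes>\<^sub>M N)" for m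
    by (rule measurable_compose[of "\<lambda>z. i m (f (fst z))" _ "count_space UNIV"]) measurable
  have pm[measurable]: "Measurable.pred (M \<Otimes>\<^sub>M N) (\<lambda>z. i m (f (fst z)) = i m (g (snd z)))" for m
  proof -
    have "Measurable.pred (M \<Otimes>\<^sub>M N) (\<lambda>z. \<exists>j. i m (f (fst z)) = j \<and> i m (g (snd z)) = j)"
      by measurable
    then show ?thesis by (simp add: eq_commute)
  qed
  have k[measurable]: "k m \<in> borel_measurable (M \<Otimes>\<^sub>M N)" for m
    unfolding k_def by (rule measurable_If[OF wm]) (use pm in \<open>simp_all add: pred_def\<close>)
  define \<pi> where "\<pi> m = density (M \<Otimes>\<^sub>M N) (k m)" for m
  have s: "sets (\<pi> m) = sets (borel \<Otimes>\<^sub>M borel)" for m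
    unfolding \<pi>_def sets_density by (rule sets_pair_measure_cong[OF M(2) N(2)])
  have inv: "c * inverse c = 1" if "c \<noteq> 0" "c \<noteq> top" for c :: ennreal
    using that ennreal_divide_self[of c] by (simp add: divide_ennreal_def less_top)
  have fstM: "distr (\<pi> m) borel fst = M" for m
  proof (rule measure_eqI)
    fix A assume "A \<in> sets (distr (\<pi> m) borel fst)"
    then have A[measurable]: "A \<in> sets borel" by simp
    have "emeasure (distr (\<pi> m) borel fst) A = emeasure (\<pi> m) (A \<times> space N)"
      by (subst emeasure_distr) (auto simp: \<pi>_def spM spN space_pair_measure intro!: arg_cong2[where f = emeasure])
    also have "\<dots> = (\<integral>\<^sup>+z. k m z * indicator A (fst z) \<partial>(M \<Otimes>\<^sub>M N))"
      unfolding \<pi>_def by (subst emeasure_density) (auto intro!: nn_integral_cong simp: indicator_def spN)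
    also have "\<dots> = (\<integral>\<^sup>+x. \<integral>\<^sup>+y. k m (x, y) * indicator A x \<partial>N \<partial>M)"
      by (subst N.nn_integral_fst[symmetric]) auto
    also have "\<dots> = (\<integral>\<^sup>+x. indicator A x \<partial>M)"
    proof (rule nn_integral_cong_AE)
      show "AE x in M. (\<integral>\<^sup>+y. k m (x, y) * indicator A x \<partial>N) = indicator A x"
        using w_pos_M[of m]
      proof eventually_elim
        case (elim x)
        have "(\<integral>\<^sup>+y. k m (x, y) * indicator A x \<partial>N) = (\<integral>\<^sup>+y. inverse (w m (i m (f x))) * indicator A x * indicator {y. i m (g y) = i m (f x)} y \<partial>N)"
          by (intro nn_integral_cong) (auto simp: k_def indicator_def)
        also have "\<dots> = inverse (w m (i m (f x))) * indicator A x * w m (i m (f x))"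
          unfolding wN by (rule nn_integral_cmult_indicator) measurable
        also have "\<dots> = indicator A x * (w m (i m (f x)) * inverse (w m (i m (f x))))" by (simp add: mult_ac)
        finally show ?case using inv[OF elim w_top] by simp
      qed
    qed
    also have "\<dots> = emeasure M A" by simp
    finally show "emeasure (distr (\<pi> m) borel fst) A = emeasure M A" .
  qed (simp add: M)
  have sndN: "distr (\<pi> m) borel snd = N" for m
  proof (rule measure_eqI)
    fix A assume "A \<in> sets (distr (\<pi> m) borel snd)"
    then have A[measurable]: "A \<in> sets borel" by simp
    have "emeasure (distr (\<pi> m) borel snd) A = emeasure (\<pi> m) (space M \<times> A)"
      by (subst emeasure_distr) (auto simp: \<pi>_def spM spN space_pair_measure intro!: arg_cong2[where f = emeasure])
    also have "\<dots> = (\<integral>\<^sup>+z. k m z * indicator A (snd z) \<partial>(M \<Otimes>\<^sub>M N))"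
      unfolding \<pi>_def by (subst emeasure_density) (auto intro!: nn_integral_cong simp: indicator_def spM)
    also have "\<dots> = (\<integral>\<^sup>+y. \<integral>\<^sup>+x. k m (x, y) * indicator A y \<partial>M \<partial>N)"
      by (subst MN.nn_integral_snd[symmetric]) auto
    also have "\<dots> = (\<integral>\<^sup>+x. indicator A x \<partial>N)"
    proof (rule nn_integral_cong_AE)
      show "AE y in N. (\<integral>\<^sup>+x. k m (x, y) * indicator A y \<partial>M) = indicator A y"
        using w_pos_N[of m]
      proof eventually_elim
        case (elim y)
        have "(\<integral>\<^sup>+x. k m (x, y) * indicator A y \<partial>M) = (\<integral>\<^sup>+x. inverse (w m (i m (g y))) * indicator A y * indicator {x. i m (f x) = i m (g y)} x \<partial>M)"
          by (intro nn_integral_cong) (auto simp: k_def indicator_def)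
        also have "\<dots> = inverse (w m (i m (g y))) * indicator A y * w m (i m (g y))"
          unfolding w_def by (rule nn_integral_cmult_indicator) measurable
        also have "\<dots> = indicator A y * (w m (i m (g y)) * inverse (w m (i m (g y))))" by (simp add: mult_ac)
        finally show ?case using inv[OF elim w_top] by simp
      qed
    qed
    also have "\<dots> = emeasure N A" by simp
    finally show "emeasure (distr (\<pi> m) borel snd) A = emeasure N A" .
  qed (simp add: N)
  have cp: "coupled (\<pi> m) M N" for m
  proof -
    have "fst \<in> measurable (\<pi> m) borel" unfolding measurable_cong_sets[OF s refl] by measurable
    then have "prob_space (\<pi> m)"
      by (rule prob_space_distrD) (simp add: fstM M)
    then show ?thesis by (simp add: coupled_def s fstM sndN)
  qed
  have cost: "(\<integral>\<^sup>+z. ennreal (dist (f (fst z)) (g (snd z)) powr 1) \<partial>\<pi> m) \<le> ennreal (2 / Suc m)" for m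
  proof -
    interpret P: prob_space "\<pi> m" using cp by (simp add: coupled_def)
    have "AE z in \<pi> m. k m z \<noteq> 0" unfolding \<pi>_def by (subst AE_density) auto
    then have "(\<integral>\<^sup>+z. ennreal (dist (f (fst z)) (g (snd z)) powr 1) \<partial>\<pi> m) \<le> (\<integral>\<^sup>+z. ennreal (2 / Suc m) \<partial>\<pi> m)"
    proof (intro nn_integral_mono_AE, eventually_elim)
      case (elim z)
      then have "i m (f (fst z)) = i m (g (snd z))" by (auto simp: k_def split: if_splits)
      then have "dist (f (fst z)) (g (snd z)) \<le> 2 / Suc m"
        using q[of "f (fst z)" m] q[of "g (snd z)" m] dist_triangle2[of "f (fst z)" "g (snd z)" "q (i m (f (fst z)))"]
        by simp
      then show ?case by (simp add: ennreal_leI)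
    qed
    then show ?thesis by (simp add: P.emeasure_space_1)
  qed
  \<comment> \<open>The exponent 1 has nothing to do with the exponent of the Wasserstein distance:
    only the vanishing of the optimal cost matters, and with 1 the mesh bounds the cost
    directly.\<close>
  obtain \<pi>' where \<pi>': "coupled \<pi>' M N" and opt: "\<And>\<pi>''. coupled \<pi>'' M N \<Longrightarrow>
      (\<integral>\<^sup>+z. ennreal (dist (f (fst z)) (g (snd z)) powr 1) \<partial>\<pi>') \<le> (\<integral>\<^sup>+z. ennreal (dist (f (fst z)) (g (snd z)) powr 1) \<partial>\<pi>'')"
    by (rule optimal_coupling_exists[OF M(1) N(1) M(2) N(2) f g, of 1]) auto
  have [measurable_cong]: "sets \<pi>' = sets (borel \<Otimes>\<^sub>M borel)" using \<pi>' by (simp add: coupled_def)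
  have "(\<lambda>m. ennreal (2 * inverse (real (Suc m)))) \<longlonglongrightarrow> ennreal (2 * 0)"
    by (intro tendsto_ennrealI tendsto_mult_left LIMSEQ_inverse_real_of_nat)
  moreover have "(\<integral>\<^sup>+z. ennreal (dist (f (fst z)) (g (snd z)) powr 1) \<partial>\<pi>') \<le> ennreal (2 * inverse (real (Suc m)))" for m
    using order_trans[OF opt[OF cp[of m]] cost[of m]] by (simp add: divide_inverse)
  ultimately have "(\<integral>\<^sup>+z. ennreal (dist (f (fst z)) (g (snd z)) powr 1) \<partial>\<pi>') \<le> ennreal (2 * 0)"
    by (intro LIMSEQ_le_const) auto
  then have "(\<integral>\<^sup>+z. ennreal (dist (f (fst z)) (g (snd z)) powr 1) \<partial>\<pi>') = 0" by simp
  then have "AE z in \<pi>'. ennreal (dist (f (fst z)) (g (snd z)) powr 1) = 0"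
    by (subst (asm) nn_integral_0_iff_AE) auto
  then have "AE z in \<pi>'. f (fst z) = g (snd z)" by eventually_elim (simp add: ennreal_eq_0_iff)
  with \<pi>' that show thesis by blast
qed

section \<open>Near-equality in Minkowski's inequality\<close>

lemma powr_tangent_less:
  fixes p s t :: real
  assumes "p > 1" "s > 0" "t \<ge> 0" "t \<noteq> s"
  shows "s powr p + p * s powr (p - 1) * (t - s) < t powr p"
proof -
  have der: "((\<lambda>x. x powr p) has_real_derivative p * x powr (p - 1)) (at x)" if "x > 0" for x
    using has_real_derivative_powr[OF that, of p] by simp
  \<comment> \<open>The mean value theorem is applied on closed intervals of positive reals, where
    the derivative of \<open>powr\<close> is available; \<open>t = 0\<close> is computed by
    hand.\<close>
  consider "t = 0" | "0 < t" "t < s" | "s < t" using assms by linarith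
  then show ?thesis
  proof cases
    case 1
    have "s powr (p - 1) * s = s powr p" using assms(2) powr_mult_base[of s "p - 1"] by (simp add: mult.commute)
    then have "s powr p + p * s powr (p - 1) * (t - s) = (1 - p) * s powr p" using 1 by (simp add: algebra_simps)
    also have "\<dots> < 0" using assms by (simp add: mult_neg_pos)
    finally show ?thesis using 1 by simp
  next
    case 2
    obtain z where z: "t < z" "z < s" "s powr p - t powr p = (s - t) * (p * z powr (p - 1))"
      using MVT2[OF 2(2), of "\<lambda>x. x powr p" "\<lambda>x. p * x powr (p - 1)"] der 2 by force
    have "z powr (p - 1) < s powr (p - 1)" using z 2 assms by (intro powr_less_mono2) auto
    then have "(s - t) * (p * z powr (p - 1)) < (s - t) * (p * s powr (p - 1))"
      using 2 assms by simp
    then show ?thesis using z(3) by (simp add: algebra_simps)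
  next
    case 3
    obtain z where z: "s < z" "z < t" "t powr p - s powr p = (t - s) * (p * z powr (p - 1))"
      using MVT2[OF 3, of "\<lambda>x. x powr p" "\<lambda>x. p * x powr (p - 1)"] der assms(2) by force
    have "s powr (p - 1) < z powr (p - 1)" using z 3 assms by (intro powr_less_mono2) auto
    then have "(t - s) * (p * s powr (p - 1)) < (t - s) * (p * z powr (p - 1))"
      using 3 assms by simp
    then show ?thesis using z(3) by (simp add: algebra_simps)
  qed
qed

lemma powr_convex_less:
  fixes p l x y :: real
  assumes "p > 1" "0 < l" "l < 1" "x \<ge> 0" "y \<ge> 0" "x \<noteq> y"
  shows "(l * x + (1 - l) * y) powr p < l * x powr p + (1 - l) * y powr p"
proof -
  define m where "m = l * x + (1 - l) * y"
  have m: "m > 0"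
  proof (cases "x > 0")
    case True
    then show ?thesis unfolding m_def using assms by (intro add_pos_nonneg) auto
  next
    case False
    then show ?thesis unfolding m_def using assms by (intro add_nonneg_pos) auto
  qed
  have "x - m = (1 - l) * (x - y)" "y - m = l * (y - x)" by (auto simp: m_def algebra_simps)
  then have "x \<noteq> m" "y \<noteq> m" using assms by auto
  then have "l * (m powr p + p * m powr (p - 1) * (x - m)) + (1 - l) * (m powr p + p * m powr (p - 1) * (y - m))
    < l * x powr p + (1 - l) * y powr p"
    using assms m by (intro add_strict_mono mult_strict_left_mono powr_tangent_less) auto
  moreover have "l * (m powr p + p * m powr (p - 1) * (x - m)) + (1 - l) * (m powr p + p * m powr (p - 1) * (y - m))
    = m powr p + p * m powr (p - 1) * (l * x + (1 - l) * y - m)" by (simp add: algebra_simps)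
  ultimately show ?thesis by (simp add: m_def)
qed

lemma powr_convex_le:
  fixes p l x y :: real
  assumes "p > 1" "0 < l" "l < 1" "x \<ge> 0" "y \<ge> 0"
  shows "(l * x + (1 - l) * y) powr p \<le> l * x powr p + (1 - l) * y powr p"
proof (cases "x = y")
  case True
  then show ?thesis by (simp add: algebra_simps flip: distrib_right)
next
  case False
  then show ?thesis using powr_convex_less[OF assms] by simp
qed

text \<open>Everything is homogeneous, so it suffices to treat \<open>x + y = 1\<close>. There the
  condition cuts out a compact set (empty if \<theta> > 1) on which the convexity defect is
  continuous and strictly positive.\<close>

lemma powr_convexity_gap:
  fixes p l \<theta> :: real
  assumes "p > 1" "0 < l" "l < 1" "\<theta> > 0"
  obtains c where "c > 0" "\<And>x y. x \<ge> 0 \<Longrightarrow> y \<ge> 0 \<Longrightarrow> \<theta> * (x + y) \<le> \<bar>x - y\<bar> \<Longrightarrow>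
    c * (x + y) powr p \<le> l * x powr p + (1 - l) * y powr p - (l * x + (1 - l) * y) powr p"
proof -
  define J where "J x y = l * x powr p + (1 - l) * y powr p - (l * x + (1 - l) * y) powr p" for x y
  define K where "K = {0..1} \<inter> {u::real. \<theta> \<le> \<bar>2 * u - 1\<bar>}"
  have K: "compact K" unfolding K_def
    by (intro compact_Int_closed compact_Icc closed_Collect_le continuous_intros)
  have cont: "continuous_on K (\<lambda>u. J u (1 - u))" unfolding J_def K_def
    using assms by (intro continuous_intros continuous_on_powr') (auto intro!: add_nonneg_nonneg)
  have pos: "J u (1 - u) > 0" if "u \<in> K" for u
    unfolding J_def using that assms powr_convex_less[OF assms(1-3), of u "1 - u"] by (auto simp: K_def)
  obtain c where c: "c > 0" "\<And>u. u \<in> K \<Longrightarrow> c \<le> J u (1 - u)"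
  proof (cases "K = {}")
    case True
    then show ?thesis using that[of 1] by auto
  next
    case False
    then obtain v where "v \<in> K" "\<forall>u\<in>K. J v (1 - v) \<le> J u (1 - u)"
      using continuous_attains_inf[OF K _ cont] by blast
    then show ?thesis using that[of "J v (1 - v)"] pos by auto
  qed
  have "c * (x + y) powr p \<le> J x y" if xy: "x \<ge> 0" "y \<ge> 0" "\<theta> * (x + y) \<le> \<bar>x - y\<bar>" for x y
  proof (cases "x + y = 0")
    case True
    then have "x = 0" "y = 0" using xy by auto
    then show ?thesis by (simp add: J_def)
  next
    case False
    define u where "u = x / (x + y)"
    have s: "x + y > 0" using False xy by linarith
    have x: "x = (x + y) * u" and y: "y = (x + y) * (1 - u)" using False by (simp_all add: u_def field_simps)
    have "u \<in> {0..1}" using xy s by (simp add: u_def)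
    moreover have "2 * u - 1 = (x - y) / (x + y)" using False by (simp add: u_def field_simps)
    then have "\<bar>2 * u - 1\<bar> = \<bar>x - y\<bar> / (x + y)" using s by simp
    then have "\<theta> \<le> \<bar>2 * u - 1\<bar>" using s xy(3) by (simp add: pos_le_divide_eq)
    ultimately have u: "u \<in> K" by (simp add: K_def)
    have "J x y = l * ((x + y) * u) powr p + (1 - l) * ((x + y) * (1 - u)) powr p - ((x + y) * (l * u + (1 - l) * (1 - u))) powr p"
      unfolding J_def using x y by (metis (no_types, lifting) distrib_left mult.left_commute)
    also have "\<dots> = (x + y) powr p * J u (1 - u)"
      unfolding J_def using s u assms by (subst (1 2 3) powr_mult) (auto simp: K_def algebra_simps)
    finally have "J x y = (x + y) powr p * J u (1 - u)" .
    then show ?thesis using c(2)[OF u] s by (simp add: mult.commute)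
  qed
  then show thesis using that[OF c(1)] unfolding J_def by blast
qed

lemma powr_superadditive:
  fixes p x y :: real
  assumes "p \<ge> 1" "x \<ge> 0" "y \<ge> 0"
  shows "x powr p + y powr p \<le> (x + y) powr p"
proof (cases "x + y = 0")
  case False
  have e: "t powr p = t * t powr (p - 1)" if "t \<ge> 0" for t :: real
    using powr_mult_base[OF that, of "p - 1"] by simp
  have "x * x powr (p - 1) + y * y powr (p - 1) \<le> x * (x + y) powr (p - 1) + y * (x + y) powr (p - 1)"
    using assms by (intro add_mono mult_left_mono powr_mono2) auto
  then show ?thesis using assms e[of x] e[of y] e[of "x + y"] by (simp add: distrib_right)
qed (use assms in \<open>auto simp: add_nonneg_eq_0_iff\<close>)

lemma powr_add_le:
  fixes p x y :: real
  assumes "p \<ge> 0" "x \<ge> 0" "y \<ge> 0"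
  shows "(x + y) powr p \<le> 2 powr p * (x powr p + y powr p)"
proof -
  have "(x + y) powr p \<le> (2 * max x y) powr p" using assms by (intro powr_mono2) auto
  also have "\<dots> = 2 powr p * max x y powr p" using assms by (simp add: powr_mult)
  also have "max x y powr p \<le> x powr p + y powr p" by (simp add: max_def)
  finally show ?thesis by simp
qed

section \<open>Minkowski's inequality and its stability for integrals\<close>

lemma nn_integral_powr_divide:
  assumes [measurable]: "f \<in> borel_measurable K" and f: "\<And>w. f w \<ge> 0" and "a > 0"
  shows "(\<integral>\<^sup>+w. ennreal ((f w / a) powr p) \<partial>K) = ennreal (1 / a powr p) * (\<integral>\<^sup>+w. ennreal (f w powr p) \<partial>K)"
  using assms by (subst nn_integral_cmult[symmetric])
    (auto intro!: nn_integral_cong simp: powr_divide simp flip: ennreal_mult)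

lemma nn_integral_powr_normalize:
  assumes "f \<in> borel_measurable K" and f: "\<And>w. f w \<ge> 0" and a: "a > 0"
    and "(\<integral>\<^sup>+w. ennreal (f w powr p) \<partial>K) \<le> ennreal (a powr p)"
  shows "(\<integral>\<^sup>+w. ennreal ((f w / a) powr p) \<partial>K) \<le> 1"
proof -
  have "(\<integral>\<^sup>+w. ennreal ((f w / a) powr p) \<partial>K) \<le> ennreal (1 / a powr p) * ennreal (a powr p)"
    unfolding nn_integral_powr_divide[OF assms(1-3)] by (intro mult_left_mono assms) simp
  also have "\<dots> = 1" using a by (simp flip: ennreal_mult)
  finally show ?thesis .
qed

lemma nn_integral_convex_comb:
  assumes [measurable]: "F \<in> borel_measurable K" "G \<in> borel_measurable K" and l: "0 < l" "l < 1"
    and F: "(\<integral>\<^sup>+w. ennreal (F w powr p) \<partial>K) \<le> 1" and G: "(\<integral>\<^sup>+w. ennreal (G w powr p) \<partial>K) \<le> 1"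
  shows "(\<integral>\<^sup>+w. ennreal (l * F w powr p + (1 - l) * G w powr p) \<partial>K) \<le> 1"
proof -
  have "(\<integral>\<^sup>+w. ennreal (l * F w powr p + (1 - l) * G w powr p) \<partial>K)
    = (\<integral>\<^sup>+w. ennreal l * ennreal (F w powr p) + ennreal (1 - l) * ennreal (G w powr p) \<partial>K)"
    using l by (intro nn_integral_cong) (simp add: ennreal_mult)
  also have "\<dots> = ennreal l * (\<integral>\<^sup>+w. ennreal (F w powr p) \<partial>K) + ennreal (1 - l) * (\<integral>\<^sup>+w. ennreal (G w powr p) \<partial>K)"
    by (simp add: nn_integral_add nn_integral_cmult)
  also have "\<dots> \<le> ennreal l * 1 + ennreal (1 - l) * 1"
    by (intro add_mono mult_left_mono F G) auto
  also have "\<dots> = 1" using l by (simp flip: ennreal_plus)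
  finally show ?thesis .
qed

text \<open>Convexity with the weights \<open>a / (a + b)\<close> and \<open>b / (a + b)\<close>,
  applied to the normalized functions. Working with positive upper bounds \<open>a\<close> and
  \<open>b\<close> in place of the norms avoids roots and vanishing norms.\<close>

lemma minkowski_powr:
  assumes "p > 1" "a > 0" "b > 0"
    and [measurable]: "f \<in> borel_measurable K" "g \<in> borel_measurable K"
    and f: "\<And>w. f w \<ge> 0" and g: "\<And>w. g w \<ge> 0"
    and fa: "(\<integral>\<^sup>+w. ennreal (f w powr p) \<partial>K) \<le> ennreal (a powr p)"
    and gb: "(\<integral>\<^sup>+w. ennreal (g w powr p) \<partial>K) \<le> ennreal (b powr p)"
  shows "(\<integral>\<^sup>+w. ennreal ((f w + g w) powr p) \<partial>K) \<le> ennreal ((a + b) powr p)"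
proof -
  define l where "l = a / (a + b)"
  have l: "0 < l" "l < 1" "1 - l = b / (a + b)" using assms(2,3) by (simp_all add: l_def field_simps)
  have "(f w + g w) / (a + b) = l * (f w / a) + (1 - l) * (g w / b)" for w
    unfolding l(3) unfolding l_def using assms(2,3) by (simp add: add_divide_distrib)
  then have "((f w + g w) / (a + b)) powr p \<le> l * (f w / a) powr p + (1 - l) * (g w / b) powr p" for w
    using powr_convex_le[OF assms(1) l(1,2), of "f w / a" "g w / b"] f[of w] g[of w] assms(2,3) by simp
  then have "(\<integral>\<^sup>+w. ennreal (((f w + g w) / (a + b)) powr p) \<partial>K)
    \<le> (\<integral>\<^sup>+w. ennreal (l * (f w / a) powr p + (1 - l) * (g w / b) powr p) \<partial>K)"
    by (intro nn_integral_mono ennreal_leI)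
  also have "\<dots> \<le> 1"
    by (intro nn_integral_convex_comb l nn_integral_powr_normalize assms) auto
  finally have *: "ennreal (1 / (a + b) powr p) * (\<integral>\<^sup>+w. ennreal ((f w + g w) powr p) \<partial>K) \<le> 1"
    using f g assms(2,3) by (subst (asm) nn_integral_powr_divide) auto
  have "(\<integral>\<^sup>+w. ennreal ((f w + g w) powr p) \<partial>K)
    = ennreal ((a + b) powr p) * (ennreal (1 / (a + b) powr p) * (\<integral>\<^sup>+w. ennreal ((f w + g w) powr p) \<partial>K))"
    using assms(2,3) by (simp add: mult.assoc[symmetric] flip: ennreal_mult)
  also have "\<dots> \<le> ennreal ((a + b) powr p) * 1" by (intro mult_left_mono *) simp
  finally show ?thesis by simp
qed

lemma ennreal_add_le_cancel:
  assumes "X + Y \<le> ennreal A" "ennreal (A - d) \<le> Y" "0 \<le> d" "d \<le> A"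
  shows "X \<le> ennreal d"
proof -
  have "X + ennreal (A - d) \<le> ennreal A"
    using add_left_mono[OF assms(2), of X] assms(1) by (rule order_trans)
  also have "ennreal A = ennreal d + ennreal (A - d)" using assms by (simp flip: ennreal_plus)
  finally have "X + ennreal (A - d) \<le> ennreal d + ennreal (A - d)" .
  then show ?thesis by (subst (asm) add.commute, subst (asm) (2) add.commute) (simp add: ennreal_add_left_cancel_le)
qed

text \<open>Where the normalized functions differ by a fixed proportion of their sum, the convexity gap controls
  the p-th power of the sum; elsewhere their difference is small already.\<close>

lemma minkowski_near_equality:
  fixes p a b \<kappa> :: real
  assumes p: "p > 1" and a: "a > 0" and b: "b > 0" and "\<kappa> > 0"
  obtains \<delta> where "\<delta> > 0" "\<And>(K :: 'w measure) f g. f \<in> borel_measurable K \<Longrightarrow> g \<in> borel_measurable K \<Longrightarrow>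
    (\<And>w. f w \<ge> 0) \<Longrightarrow> (\<And>w. g w \<ge> 0) \<Longrightarrow>
    (\<integral>\<^sup>+w. ennreal (f w powr p) \<partial>K) \<le> ennreal (a powr p) \<Longrightarrow>
    (\<integral>\<^sup>+w. ennreal (g w powr p) \<partial>K) \<le> ennreal (b powr p) \<Longrightarrow>
    ennreal ((a + b) powr p - \<delta>) \<le> (\<integral>\<^sup>+w. ennreal ((f w + g w) powr p) \<partial>K) \<Longrightarrow>
    (\<integral>\<^sup>+w. ennreal (\<bar>f w / a - g w / b\<bar> powr p) \<partial>K) \<le> ennreal \<kappa>"
proof -
  define l where "l = a / (a + b)"
  have l: "0 < l" "l < 1" "1 - l = b / (a + b)" using a b by (simp_all add: l_def field_simps)
  \<comment> \<open>Chosen so that \<open>\<theta> powr p\<close> times the bound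
    \<open>2 powr p\<close> for the integral of \<open>(F + G) powr p\<close> is \<kappa>/2.\<close>
  define \<theta> where "\<theta> = (\<kappa> / 2) powr (1 / p) / 2"
  have \<theta>: "\<theta> > 0" "\<theta> powr p * 2 powr p = \<kappa> / 2"
  proof -
    show "\<theta> > 0" using \<open>\<kappa> > 0\<close> by (simp add: \<theta>_def)
    then have "\<theta> powr p * 2 powr p = (\<theta> * 2) powr p" by (simp add: powr_mult)
    also have "\<theta> * 2 = (\<kappa> / 2) powr (1 / p)" by (simp add: \<theta>_def)
    finally show "\<theta> powr p * 2 powr p = \<kappa> / 2" using \<open>\<kappa> > 0\<close> p by (simp add: powr_powr)
  qed
  obtain c where c: "c > 0" "\<And>x y. x \<ge> 0 \<Longrightarrow> y \<ge> 0 \<Longrightarrow> \<theta> * (x + y) \<le> \<bar>x - y\<bar> \<Longrightarrow>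
      c * (x + y) powr p \<le> l * x powr p + (1 - l) * y powr p - (l * x + (1 - l) * y) powr p"
    using powr_convexity_gap[OF p l(1,2) \<theta>(1)] by blast
  \<comment> \<open>The convexity defect must integrate to at most \<open>c * \<kappa> / 2\<close>,
    since it is divided by \<open>c\<close> later; the factor \<open>(a + b) powr p\<close> undoes
    the normalization, and the minimum with 1 keeps \<open>(a + b) powr p - \<delta>\<close>
    nonnegative.\<close>
  define \<delta> where "\<delta> = min 1 (c * \<kappa> / 2) * (a + b) powr p"
  have ab: "(a + b) powr p > 0" using a b by simp
  show thesis
  proof
    show "\<delta> > 0" using c(1) \<open>\<kappa> > 0\<close> ab by (simp add: \<delta>_def)
    fix K :: "'w measure" and f g
    assume [measurable]: "f \<in> borel_measurable K" "g \<in> borel_measurable K"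
      and f: "\<And>w. f w \<ge> 0" and g: "\<And>w. g w \<ge> 0"
      and fa: "(\<integral>\<^sup>+w. ennreal (f w powr p) \<partial>K) \<le> ennreal (a powr p)"
      and gb: "(\<integral>\<^sup>+w. ennreal (g w powr p) \<partial>K) \<le> ennreal (b powr p)"
      and near: "ennreal ((a + b) powr p - \<delta>) \<le> (\<integral>\<^sup>+w. ennreal ((f w + g w) powr p) \<partial>K)"
    define F where "F w = f w / a" for w
    define G where "G w = g w / b" for w
    have [measurable]: "F \<in> borel_measurable K" "G \<in> borel_measurable K" unfolding F_def G_def by measurable
    have FG0: "F w \<ge> 0" "G w \<ge> 0" for w using f g a b by (simp_all add: F_def G_def)
    have F1: "(\<integral>\<^sup>+w. ennreal (F w powr p) \<partial>K) \<le> 1" unfolding F_def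
      by (intro nn_integral_powr_normalize fa f a) simp
    have G1: "(\<integral>\<^sup>+w. ennreal (G w powr p) \<partial>K) \<le> 1" unfolding G_def
      by (intro nn_integral_powr_normalize gb g b) simp
    define J where "J w = l * F w powr p + (1 - l) * G w powr p - (l * F w + (1 - l) * G w) powr p" for w
    have J0: "J w \<ge> 0" for w using powr_convex_le[OF p l(1,2) FG0, of w w] by (simp add: J_def)
    have [measurable]: "J \<in> borel_measurable K" unfolding J_def by measurable
    have comb: "l * F w + (1 - l) * G w = (f w + g w) / (a + b)" for w
      unfolding l(3) F_def G_def unfolding l_def using a b by (simp add: add_divide_distrib)
    have "(\<integral>\<^sup>+w. ennreal (J w) \<partial>K) + (\<integral>\<^sup>+w. ennreal (((f w + g w) / (a + b)) powr p) \<partial>K)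
      = (\<integral>\<^sup>+w. ennreal (l * F w powr p + (1 - l) * G w powr p) \<partial>K)"
      unfolding comb[symmetric] using J0
      by (subst nn_integral_add[symmetric]) (auto simp: J_def simp flip: ennreal_plus intro!: nn_integral_cong)
    also have "\<dots> \<le> ennreal 1" using nn_integral_convex_comb[OF _ _ l(1,2) F1 G1] by simp
    finally have J1: "(\<integral>\<^sup>+w. ennreal (J w) \<partial>K) + (\<integral>\<^sup>+w. ennreal (((f w + g w) / (a + b)) powr p) \<partial>K) \<le> ennreal 1" .
    have "ennreal (1 - min 1 (c * \<kappa> / 2)) = ennreal (1 / (a + b) powr p) * ennreal ((a + b) powr p - \<delta>)"
      using ab by (simp add: \<delta>_def field_simps flip: ennreal_mult'')
    also have "\<dots> \<le> (\<integral>\<^sup>+w. ennreal (((f w + g w) / (a + b)) powr p) \<partial>K)"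
      using f g a b by (subst nn_integral_powr_divide) (auto intro!: mult_left_mono near)
    finally have "(\<integral>\<^sup>+w. ennreal (J w) \<partial>K) \<le> ennreal (min 1 (c * \<kappa> / 2))"
      using c(1) \<open>\<kappa> > 0\<close> by (intro ennreal_add_le_cancel[OF J1]) auto
    then have J2: "(\<integral>\<^sup>+w. ennreal (J w) \<partial>K) \<le> ennreal (c * \<kappa> / 2)"
      by (rule order_trans) (simp add: ennreal_leI)
    have S: "(\<integral>\<^sup>+w. ennreal ((F w + G w) powr p) \<partial>K) \<le> ennreal (2 powr p)"
      using minkowski_powr[OF p, of 1 1 F K G] F1 G1 FG0 by simp
    have pt: "\<bar>F w - G w\<bar> powr p \<le> \<theta> powr p * (F w + G w) powr p + (1 / c) * J w" for w
    proof (cases "\<theta> * (F w + G w) \<le> \<bar>F w - G w\<bar>")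
      case True
      have "\<bar>F w - G w\<bar> powr p \<le> (F w + G w) powr p" using p FG0[of w] by (intro powr_mono2) auto
      also have "\<dots> \<le> (1 / c) * J w" using c(2)[OF FG0 True] c(1) by (simp add: J_def field_simps)
      finally show ?thesis using \<theta> by (simp add: add_increasing)
    next
      case False
      then have "\<bar>F w - G w\<bar> powr p \<le> (\<theta> * (F w + G w)) powr p" using p by (intro powr_mono2) auto
      also have "\<dots> = \<theta> powr p * (F w + G w) powr p" using \<theta> FG0[of w] by (simp add: powr_mult)
      finally show ?thesis using J0[of w] c(1) by (simp add: add_increasing2)
    qed
    have "(\<integral>\<^sup>+w. ennreal (\<bar>F w - G w\<bar> powr p) \<partial>K)
      \<le> (\<integral>\<^sup>+w. ennreal (\<theta> powr p) * ennreal ((F w + G w) powr p) + ennreal (1 / c) * ennreal (J w) \<partial>K)"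
      using pt J0 c(1) by (intro nn_integral_mono) (simp flip: ennreal_mult ennreal_plus)
    also have "\<dots> = ennreal (\<theta> powr p) * (\<integral>\<^sup>+w. ennreal ((F w + G w) powr p) \<partial>K) + ennreal (1 / c) * (\<integral>\<^sup>+w. ennreal (J w) \<partial>K)"
      by (simp add: nn_integral_add nn_integral_cmult)
    also have "\<dots> \<le> ennreal (\<theta> powr p) * ennreal (2 powr p) + ennreal (1 / c) * ennreal (c * \<kappa> / 2)"
      by (intro add_mono mult_left_mono S J2) auto
    also have "\<dots> = ennreal \<kappa>" using \<theta>(2) c(1) \<open>\<kappa> > 0\<close> by (simp flip: ennreal_mult ennreal_plus)
    finally show "(\<integral>\<^sup>+w. ennreal (\<bar>f w / a - g w / b\<bar> powr p) \<partial>K) \<le> ennreal \<kappa>"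
      by (simp add: F_def G_def)
  qed
qed

text \<open>Here \<open>e\<close> will be the defect in the triangle inequality. By superadditivity
  of the p-th power, its p-th power is paid for by the loss from \<open>f + g\<close> to
  \<open>f + g - e\<close>.\<close>

lemma minkowski_excess:
  assumes "p > 1" "a > 0" "b > 0" "0 \<le> \<delta>" "\<delta> \<le> (a + b) powr p"
    and [measurable]: "f \<in> borel_measurable K" "g \<in> borel_measurable K" "e \<in> borel_measurable K"
    and f: "\<And>w. f w \<ge> 0" and g: "\<And>w. g w \<ge> 0" and e: "\<And>w. e w \<ge> 0" "\<And>w. e w \<le> f w + g w"
    and fa: "(\<integral>\<^sup>+w. ennreal (f w powr p) \<partial>K) \<le> ennreal (a powr p)"
    and gb: "(\<integral>\<^sup>+w. ennreal (g w powr p) \<partial>K) \<le> ennreal (b powr p)"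
    and near: "ennreal ((a + b) powr p - \<delta>) \<le> (\<integral>\<^sup>+w. ennreal ((f w + g w - e w) powr p) \<partial>K)"
  shows "(\<integral>\<^sup>+w. ennreal (e w powr p) \<partial>K) \<le> ennreal \<delta>"
proof (rule ennreal_add_le_cancel[OF _ near assms(4,5)])
  have "(\<integral>\<^sup>+w. ennreal (e w powr p) \<partial>K) + (\<integral>\<^sup>+w. ennreal ((f w + g w - e w) powr p) \<partial>K)
    = (\<integral>\<^sup>+w. ennreal (e w powr p + (f w + g w - e w) powr p) \<partial>K)"
    by (subst nn_integral_add[symmetric]) auto
  also have "\<dots> \<le> (\<integral>\<^sup>+w. ennreal ((f w + g w) powr p) \<partial>K)"
  proof (intro nn_integral_mono ennreal_leI)
    fix w show "e w powr p + (f w + g w - e w) powr p \<le> (f w + g w) powr p"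
      using powr_superadditive[of p "e w" "f w + g w - e w"] assms(1) e[of w] by simp
  qed
  also have "\<dots> \<le> ennreal ((a + b) powr p)"
    by (rule minkowski_powr[OF assms(1-3)]) (use f g fa gb in auto)
  finally show "(\<integral>\<^sup>+w. ennreal (e w powr p) \<partial>K) + (\<integral>\<^sup>+w. ennreal ((f w + g w - e w) powr p) \<partial>K) \<le> ennreal ((a + b) powr p)" .
qed

section \<open>Wasserstein distance and Busemann functions\<close>

lemma measurable_fst_snd_borel [measurable]:
  "fst \<in> borel_measurable (borel :: ('b::second_countable_topology \<times> 'c::second_countable_topology) measure)"
  "snd \<in> borel_measurable (borel :: ('b::second_countable_topology \<times> 'c::second_countable_topology) measure)"
  by (auto intro!: borel_measurable_continuous_onI continuous_intros)

lemma couplings_iff: "\<pi> \<in> couplings \<mu> \<nu> \<longleftrightarrow> coupled \<pi> \<mu> \<nu>"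
  by (simp add: couplings_def coupled_def)

lemma Pp_prob: "\<mu> \<in> Pp p \<Longrightarrow> prob_space \<mu>" "\<mu> \<in> Pp p \<Longrightarrow> sets \<mu> = sets borel"
  by (simp_all add: Pp_def)

lemma nn_integral_dist_triangle:
  fixes X Y Z :: "'w \<Rightarrow> 'a::{metric_space, second_countable_topology}"
  assumes [measurable]: "X \<in> borel_measurable K" "Y \<in> borel_measurable K" "Z \<in> borel_measurable K" and p: "p \<ge> 0"
    and "(\<integral>\<^sup>+w. ennreal (dist (X w) (Y w) powr p) \<partial>K) < \<infinity>" "(\<integral>\<^sup>+w. ennreal (dist (Y w) (Z w) powr p) \<partial>K) < \<infinity>"
  shows "(\<integral>\<^sup>+w. ennreal (dist (X w) (Z w) powr p) \<partial>K) < \<infinity>"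
proof -
  have "(\<integral>\<^sup>+w. ennreal (dist (X w) (Z w) powr p) \<partial>K)
    \<le> (\<integral>\<^sup>+w. ennreal (2 powr p) * (ennreal (dist (X w) (Y w) powr p) + ennreal (dist (Y w) (Z w) powr p)) \<partial>K)"
  proof (rule nn_integral_mono)
    fix w
    have "dist (X w) (Z w) powr p \<le> (dist (X w) (Y w) + dist (Y w) (Z w)) powr p"
      using p by (intro powr_mono2 dist_triangle) auto
    also have "\<dots> \<le> 2 powr p * (dist (X w) (Y w) powr p + dist (Y w) (Z w) powr p)"
      using p by (intro powr_add_le) auto
    finally show "ennreal (dist (X w) (Z w) powr p)
      \<le> ennreal (2 powr p) * (ennreal (dist (X w) (Y w) powr p) + ennreal (dist (Y w) (Z w) powr p))"
      by (simp flip: ennreal_plus ennreal_mult)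
  qed
  also have "\<dots> = ennreal (2 powr p) * ((\<integral>\<^sup>+w. ennreal (dist (X w) (Y w) powr p) \<partial>K) + (\<integral>\<^sup>+w. ennreal (dist (Y w) (Z w) powr p) \<partial>K))"
    by (subst nn_integral_cmult) (simp_all add: nn_integral_add)
  also have "\<dots> < \<infinity>" using assms(5,6) by (simp add: ennreal_mult_less_top)
  finally show ?thesis .
qed

lemma Pp_moment:
  fixes \<mu> :: "'a::polish_space measure"
  assumes \<mu>: "\<mu> \<in> Pp p" and p: "p > 0"
  shows "(\<integral>\<^sup>+x. ennreal (dist x0 x powr p) \<partial>\<mu>) < \<infinity>"
proof -
  interpret prob_space \<mu> using \<mu> by (simp add: Pp_def)
  have [measurable_cong]: "sets \<mu> = sets borel" using \<mu> by (simp add: Pp_def)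
  obtain x1 where x1: "(\<integral>\<^sup>+x. ennreal (dist x1 x powr p) \<partial>\<mu>) < \<infinity>" using \<mu> by (auto simp: Pp_def)
  show ?thesis
    by (rule nn_integral_dist_triangle[where Y = "\<lambda>_. x1"]) (use x1 p in \<open>auto simp: emeasure_space_1\<close>)
qed

lemma coupled_joint_distr:
  fixes X :: "'w \<Rightarrow> 'b::second_countable_topology" and Y :: "'w \<Rightarrow> 'c::second_countable_topology"
  assumes "prob_space K" and [measurable]: "X \<in> borel_measurable K" "Y \<in> borel_measurable K"
  shows "coupled (distr K (borel \<Otimes>\<^sub>M borel) (\<lambda>w. (X w, Y w))) (distr K borel X) (distr K borel Y)"
  unfolding coupled_def by (auto simp: distr_distr comp_def intro!: prob_space.prob_space_distr[OF assms(1)])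

lemma Pp_of_joint:
  fixes X Y :: "'w \<Rightarrow> 'a::polish_space"
  assumes K: "prob_space K" and [measurable]: "X \<in> borel_measurable K" "Y \<in> borel_measurable K"
    and X: "distr K borel X \<in> Pp p" and p: "p > 0"
    and fin: "(\<integral>\<^sup>+w. ennreal (dist (X w) (Y w) powr p) \<partial>K) < \<infinity>"
  shows "distr K borel Y \<in> Pp p"
proof -
  fix x0
  have "(\<integral>\<^sup>+w. ennreal (dist x0 (X w) powr p) \<partial>K) < \<infinity>"
    using Pp_moment[OF X p, of x0] by (simp add: nn_integral_distr)
  from nn_integral_dist_triangle[OF _ assms(2,3) _ this fin] p
  have "(\<integral>\<^sup>+w. ennreal (dist x0 (Y w) powr p) \<partial>K) < \<infinity>" by simp
  then show ?thesis unfolding Pp_def using prob_space.prob_space_distr[OF K assms(3)]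
    by (auto simp: nn_integral_distr)
qed

lemma Wp_nonneg: "Wp p \<mu> \<nu> \<ge> 0"
  by (simp add: Wp_def)

text \<open>Stated for random variables on any probability space, so that any two coordinates of a
  glued plan can be used as they are.\<close>

lemma Wp_le_joint:
  fixes X Y :: "'w \<Rightarrow> 'a::polish_space"
  assumes K: "prob_space K" and [measurable]: "X \<in> borel_measurable K" "Y \<in> borel_measurable K"
    and p: "p > 0" and r: "r \<ge> 0" and le: "(\<integral>\<^sup>+w. ennreal (dist (X w) (Y w) powr p) \<partial>K) \<le> ennreal (r powr p)"
  shows "Wp p (distr K borel X) (distr K borel Y) \<le> r"
proof -
  let ?\<pi> = "distr K (borel \<Otimes>\<^sub>M borel) (\<lambda>w. (X w, Y w))"
  let ?C = "\<lambda>\<pi>::('a \<times> 'a) measure. enn2real (\<integral>\<^sup>+z. ennreal (dist (fst z) (snd z) powr p) \<partial>\<pi>)"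
  have "(INF \<pi>\<in>couplings (distr K borel X) (distr K borel Y). ?C \<pi>) \<le> ?C ?\<pi>"
    by (intro cINF_lower bdd_belowI[of _ 0]) (auto simp: couplings_iff coupled_joint_distr[OF K])
  also have "\<dots> \<le> r powr p"
    using le by (intro enn2real_leI) (simp_all add: nn_integral_distr)
  finally have "(INF \<pi>\<in>couplings (distr K borel X) (distr K borel Y). ?C \<pi>) \<le> r powr p" .
  moreover have "0 \<le> (INF \<pi>\<in>couplings (distr K borel X) (distr K borel Y). ?C \<pi>)"
    by (rule cINF_greatest) (use coupled_joint_distr[OF K assms(2,3)] in \<open>auto simp: couplings_iff\<close>)
  ultimately have "Wp p (distr K borel X) (distr K borel Y) \<le> (r powr p) powr (1 / p)"
    unfolding Wp_def using p by (intro powr_mono2) auto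
  then show ?thesis using p r by (simp add: powr_powr)
qed

lemma Wp_powr_le_joint:
  fixes X Y :: "'w \<Rightarrow> 'a::polish_space"
  assumes K: "prob_space K" and [measurable]: "X \<in> borel_measurable K" "Y \<in> borel_measurable K" and p: "p > 0"
  shows "ennreal (Wp p (distr K borel X) (distr K borel Y) powr p) \<le> (\<integral>\<^sup>+w. ennreal (dist (X w) (Y w) powr p) \<partial>K)"
proof (cases "(\<integral>\<^sup>+w. ennreal (dist (X w) (Y w) powr p) \<partial>K)")
  case (real c)
  have "Wp p (distr K borel X) (distr K borel Y) \<le> c powr (1 / p)"
    by (rule Wp_le_joint[OF assms]) (use real p in \<open>auto simp: powr_powr\<close>)
  then have "Wp p (distr K borel X) (distr K borel Y) powr p \<le> (c powr (1 / p)) powr p"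
    using p by (intro powr_mono2 Wp_nonneg) auto
  then show ?thesis using real p by (simp add: powr_powr ennreal_leI)
qed simp

text \<open>\<open>Wp\<close> is an infimum of \<open>enn2real\<close> values, and
  \<open>enn2real\<close> sends infinity to 0: a plan of infinite cost would count as free. Finite
  moments exclude such plans.\<close>

lemma coupled_cost_finite:
  fixes \<mu> \<nu> :: "'a::polish_space measure"
  assumes \<pi>: "coupled \<pi> \<mu> \<nu>" and "\<mu> \<in> Pp p" "\<nu> \<in> Pp p" and p: "p > 0"
  shows "(\<integral>\<^sup>+z. ennreal (dist (fst z) (snd z) powr p) \<partial>\<pi>) < \<infinity>"
proof -
  fix x0 :: 'a
  note [measurable] = coupled_measurable[OF \<pi>]
  have "(\<integral>\<^sup>+z. ennreal (dist x0 (fst z) powr p) \<partial>\<pi>) < \<infinity>" "(\<integral>\<^sup>+z. ennreal (dist x0 (snd z) powr p) \<partial>\<pi>) < \<infinity>"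
    using Pp_moment[OF assms(2) p, of x0] Pp_moment[OF assms(3) p, of x0] \<pi>
    unfolding coupled_def by (auto simp: nn_integral_distr)
  note fin = this
  show ?thesis
    by (rule nn_integral_dist_triangle[where Y = "\<lambda>_. x0"]) (use fin p in \<open>simp_all add: dist_commute\<close>)
qed

lemma optimal_coupling:
  fixes \<mu> \<nu> :: "'a::polish_space measure"
  assumes \<mu>: "\<mu> \<in> Pp p" and \<nu>: "\<nu> \<in> Pp p" and p: "p > 0"
  obtains \<pi> where "coupled \<pi> \<mu> \<nu>"
    "(\<integral>\<^sup>+z. ennreal (dist (fst z) (snd z) powr p) \<partial>\<pi>) = ennreal (Wp p \<mu> \<nu> powr p)"
proof -
  let ?C = "\<lambda>\<pi>::('a \<times> 'a) measure. \<integral>\<^sup>+z. ennreal (dist (fst z) (snd z) powr p) \<partial>\<pi>"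
  obtain \<pi> where \<pi>: "coupled \<pi> \<mu> \<nu>" "\<And>\<pi>'. coupled \<pi>' \<mu> \<nu> \<Longrightarrow> ?C \<pi> \<le> ?C \<pi>'"
    by (rule optimal_coupling_exists[OF Pp_prob(1)[OF \<mu>] Pp_prob(1)[OF \<nu>] Pp_prob(2)[OF \<mu>] Pp_prob(2)[OF \<nu>], of "\<lambda>x. x" "\<lambda>x. x" p])
       (use p in auto)
  have "enn2real (?C \<pi>) \<le> (INF \<pi>\<in>couplings \<mu> \<nu>. enn2real (?C \<pi>))"
    using \<pi> coupled_cost_finite[OF _ \<mu> \<nu> p]
    by (intro cINF_greatest) (auto simp: couplings_iff intro!: enn2real_mono)
  moreover have "(INF \<pi>\<in>couplings \<mu> \<nu>. enn2real (?C \<pi>)) \<le> enn2real (?C \<pi>)"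
    by (intro cINF_lower bdd_belowI[of _ 0]) (auto simp: couplings_iff \<pi>)
  ultimately have "Wp p \<mu> \<nu> = enn2real (?C \<pi>) powr (1 / p)" unfolding Wp_def by simp
  then have "Wp p \<mu> \<nu> powr p = enn2real (?C \<pi>)" using p by (simp add: powr_powr)
  then have "?C \<pi> = ennreal (Wp p \<mu> \<nu> powr p)"
    using coupled_cost_finite[OF \<pi>(1) \<mu> \<nu> p] by simp
  with \<pi>(1) that show thesis by blast
qed

lemma Wp_commute:
  fixes \<mu> \<nu> :: "'a::polish_space measure"
  assumes \<mu>: "\<mu> \<in> Pp p" and \<nu>: "\<nu> \<in> Pp p" and p: "p > 0"
  shows "Wp p \<mu> \<nu> = Wp p \<nu> \<mu>"
proof -
  have "Wp p \<nu> \<mu> \<le> Wp p \<mu> \<nu>" if \<mu>: "\<mu> \<in> Pp p" and \<nu>: "\<nu> \<in> Pp p" for \<mu> \<nu> :: "'a measure"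
  proof -
    obtain \<pi> where \<pi>: "coupled \<pi> \<mu> \<nu>"
      "(\<integral>\<^sup>+z. ennreal (dist (fst z) (snd z) powr p) \<partial>\<pi>) = ennreal (Wp p \<mu> \<nu> powr p)"
      using optimal_coupling[OF \<mu> \<nu> p] .
    have "Wp p (distr \<pi> borel snd) (distr \<pi> borel fst) \<le> Wp p \<mu> \<nu>"
      by (rule Wp_le_joint) (use \<pi> p coupled_measurable[OF \<pi>(1)] in \<open>auto simp: coupled_def dist_commute Wp_nonneg\<close>)
    then show ?thesis using \<pi>(1) by (simp add: coupled_def)
  qed
  from this[OF \<mu> \<nu>] this[OF \<nu> \<mu>] show ?thesis by simp
qed

lemma coupled_sets_borel:
  fixes \<pi> :: "('b::second_countable_topology \<times> 'c::second_countable_topology) measure"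
  assumes "coupled \<pi> M N"
  shows "sets \<pi> = sets borel"
  using assms unfolding coupled_def borel_prod by blast

lemma glue_couplings:
  fixes \<pi>1 :: "('b::polish_space \<times> 'a::polish_space) measure" and \<pi>2 :: "('a \<times> 'c::polish_space) measure"
  assumes "coupled \<pi>1 \<mu> \<nu>" "coupled \<pi>2 \<nu> \<rho>"
  obtains \<Theta> where "coupled \<Theta> \<pi>1 \<pi>2" "AE z in \<Theta>. snd (fst z) = fst (snd z)"
proof -
  have P: "prob_space \<pi>1" "prob_space \<pi>2" "distr \<pi>1 borel snd = distr \<pi>2 borel fst"
    using assms by (simp_all add: coupled_def)
  obtain \<Theta> where "coupled \<Theta> \<pi>1 \<pi>2" "AE z in \<Theta>. snd (fst z) = fst (snd z)"
    by (rule gluing[OF P(1) coupled_sets_borel[OF assms(1)] P(2) coupled_sets_borel[OF assms(2)] _ _ P(3)])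
       auto
  then show thesis using that by blast
qed

lemma Wp_triangle:
  fixes \<mu> \<nu> \<rho> :: "'a::polish_space measure"
  assumes \<mu>: "\<mu> \<in> Pp p" and \<nu>: "\<nu> \<in> Pp p" and \<rho>: "\<rho> \<in> Pp p" and p: "p > 1"
  shows "Wp p \<mu> \<rho> \<le> Wp p \<mu> \<nu> + Wp p \<nu> \<rho>"
proof -
  have p0: "p > 0" using p by simp
  obtain \<pi>1 where \<pi>1: "coupled \<pi>1 \<mu> \<nu>"
    "(\<integral>\<^sup>+z. ennreal (dist (fst z) (snd z) powr p) \<partial>\<pi>1) = ennreal (Wp p \<mu> \<nu> powr p)"
    using optimal_coupling[OF \<mu> \<nu> p0] .
  obtain \<pi>2 where \<pi>2: "coupled \<pi>2 \<nu> \<rho>"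
    "(\<integral>\<^sup>+z. ennreal (dist (fst z) (snd z) powr p) \<partial>\<pi>2) = ennreal (Wp p \<nu> \<rho> powr p)"
    using optimal_coupling[OF \<nu> \<rho> p0] .
  obtain \<Theta> where \<Theta>: "coupled \<Theta> \<pi>1 \<pi>2" "AE z in \<Theta>. snd (fst z) = fst (snd z)"
    using glue_couplings[OF \<pi>1(1) \<pi>2(1)] .
  note [measurable] = coupled_measurable[OF \<Theta>(1)]
  have P: "prob_space \<Theta>" and d: "\<pi>1 = distr \<Theta> borel fst" "\<pi>2 = distr \<Theta> borel snd"
    using \<Theta>(1) by (simp_all add: coupled_def)
  have \<mu>': "\<mu> = distr \<Theta> borel (\<lambda>z. fst (fst z))"
    using \<pi>1(1) unfolding coupled_def d by (auto simp: distr_distr comp_def)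
  have \<rho>': "\<rho> = distr \<Theta> borel (\<lambda>z. snd (snd z))"
    using \<pi>2(1) unfolding coupled_def d by (auto simp: distr_distr comp_def)
  have c1: "(\<integral>\<^sup>+z. ennreal (dist (fst (fst z)) (snd (fst z)) powr p) \<partial>\<Theta>) = ennreal (Wp p \<mu> \<nu> powr p)"
    using \<pi>1(2) unfolding d by (simp add: nn_integral_distr)
  have c2: "(\<integral>\<^sup>+z. ennreal (dist (fst (snd z)) (snd (snd z)) powr p) \<partial>\<Theta>) = ennreal (Wp p \<nu> \<rho> powr p)"
    using \<pi>2(2) unfolding d by (simp add: nn_integral_distr)
  \<comment> \<open>The slack makes both bounds positive, as \<open>minkowski_powr\<close> demands,
    even if a distance is 0.\<close>
  have "Wp p \<mu> \<rho> \<le> Wp p \<mu> \<nu> + Wp p \<nu> \<rho> + \<epsilon>" if "\<epsilon> > 0" for \<epsilon>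
  proof -
    have "(\<integral>\<^sup>+z. ennreal (dist (fst (fst z)) (snd (snd z)) powr p) \<partial>\<Theta>)
      \<le> (\<integral>\<^sup>+z. ennreal ((dist (fst (fst z)) (snd (fst z)) + dist (fst (snd z)) (snd (snd z))) powr p) \<partial>\<Theta>)"
    proof (rule nn_integral_mono_AE, use \<Theta>(2) in eventually_elim)
      case (elim z)
      show ?case using dist_triangle[of "fst (fst z)" "snd (snd z)" "snd (fst z)"] elim p
        by (intro ennreal_leI powr_mono2) auto
    qed
    also have "\<dots> \<le> ennreal ((Wp p \<mu> \<nu> + \<epsilon> / 2 + (Wp p \<nu> \<rho> + \<epsilon> / 2)) powr p)"
      by (rule minkowski_powr[OF p])
         (use c1 c2 that p Wp_nonneg[of p \<mu> \<nu>] Wp_nonneg[of p \<nu> \<rho>] in \<open>auto intro!: add_nonneg_pos ennreal_leI powr_mono2\<close>)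
    finally show ?thesis unfolding \<mu>' \<rho>'
      by (intro Wp_le_joint[OF P]) (use p that Wp_nonneg[of p \<mu> \<nu>] Wp_nonneg[of p \<nu> \<rho>] \<mu>' \<rho>' in \<open>auto simp: algebra_simps\<close>)
  qed
  then show ?thesis by (rule field_le_epsilon)
qed

section \<open>Rays, Busemann functions, and their behaviour along co-rays\<close>

lemma unit_rayD:
  assumes "unit_ray p \<mu>"
  shows "t \<ge> 0 \<Longrightarrow> \<mu> t \<in> Pp p" "s \<ge> 0 \<Longrightarrow> t \<ge> 0 \<Longrightarrow> Wp p (\<mu> s) (\<mu> t) = \<bar>s - t\<bar>"
  using assms by (auto simp: unit_ray_def)

lemma TgeodD:
  assumes "c \<in> Tgeod p \<mu> \<nu>"
  shows "c 0 = \<mu>" "c (Wp p \<mu> \<nu>) = \<nu>"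
    "0 \<le> t \<Longrightarrow> t \<le> Wp p \<mu> \<nu> \<Longrightarrow> c t \<in> Pp p"
    "0 \<le> s \<Longrightarrow> s \<le> Wp p \<mu> \<nu> \<Longrightarrow> 0 \<le> t \<Longrightarrow> t \<le> Wp p \<mu> \<nu> \<Longrightarrow> Wp p (c s) (c t) = \<bar>s - t\<bar>"
  using assms by (auto simp: Tgeod_def)

text \<open>\<open>Lim\<close> says something only once convergence is known. By the triangle
  inequality the function is nonincreasing in t and bounded below.\<close>

lemma busemann_tendsto:
  fixes \<mu> :: "real \<Rightarrow> 'a::polish_space measure"
  assumes \<mu>: "unit_ray p \<mu>" and \<nu>: "\<nu> \<in> Pp p" and p: "p > 1"
  shows "((\<lambda>t. Wp p \<nu> (\<mu> t) - t) \<longlongrightarrow> busemann p \<mu> \<nu>) at_top"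
proof -
  define h where "h t = Wp p \<nu> (\<mu> t) - t" for t
  note R = unit_rayD[OF \<mu>]
  have dec: "h t \<le> h s" if "0 \<le> s" "s \<le> t" for s t
    using Wp_triangle[OF \<nu> R(1)[of s] R(1)[of t] p] R(2)[of s t] that by (simp add: h_def)
  have lower: "h t \<ge> - Wp p (\<mu> 0) \<nu>" if "0 \<le> t" for t
    using Wp_triangle[OF R(1)[of 0] \<nu> R(1)[of t] p] R(2)[of 0 t] that by (simp add: h_def)
  define L where "L = (INF t\<in>{0..}. h t)"
  have bdd: "bdd_below (h ` {0..})" using lower by (intro bdd_belowI2[where m = "- Wp p (\<mu> 0) \<nu>"]) auto
  have "(h \<longlongrightarrow> L) at_top"
  proof (rule order_tendstoI)
    fix a assume "a < L"
    then have "a < h t" if "t \<ge> 0" for t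
      using cINF_lower[OF bdd, of t] that unfolding L_def by simp
    then show "\<forall>\<^sub>F t in at_top. a < h t" using eventually_ge_at_top[of 0] by (rule eventually_mono[rotated])
  next
    fix a assume "L < a"
    then obtain s where s: "s \<ge> 0" "h s < a" unfolding L_def using cINF_less_iff[OF _ bdd, of a] by auto
    show "\<forall>\<^sub>F t in at_top. h t < a" using eventually_ge_at_top[of s]
      by eventually_elim (use dec[OF s(1)] s in force)
  qed
  then show ?thesis using tendsto_Lim[OF _ \<open>(h \<longlongrightarrow> L) at_top\<close>] unfolding busemann_def h_def by simp
qed

lemma busemann_along_co_ray:
  fixes \<mu> \<nu> :: "real \<Rightarrow> 'a::polish_space measure"
  assumes p: "p > 1" and \<mu>: "unit_ray p \<mu>" and co: "co_ray p \<mu> \<nu>" and st: "s \<ge> 0" "t \<ge> 0"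
  shows "busemann p \<mu> (\<nu> t) - busemann p \<mu> (\<nu> s) = s - t"
proof -
  have \<nu>: "unit_ray p \<nu>" using co by (simp add: co_ray_def)
  obtain tn \<nu>0 c where tn: "filterlim tn at_top sequentially" and \<nu>0: "\<And>n. \<nu>0 n \<in> Pp p"
    "(\<lambda>n. Wp p (\<nu>0 n) (\<nu> 0)) \<longlonglongrightarrow> 0" and c: "\<And>n::nat. c n \<in> Tgeod p (\<nu>0 n) (\<mu> (tn n))"
    and conv: "\<And>t. t \<ge> 0 \<Longrightarrow> (\<lambda>n. Wp p (c n t) (\<nu> t)) \<longlonglongrightarrow> 0"
    using co unfolding co_ray_def by blast
  note Rm = unit_rayD[OF \<mu>] and Rn = unit_rayD[OF \<nu>]
  define L where "L n = Wp p (\<nu>0 n) (\<mu> (tn n))" for n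
  have p0: "p > 0" using p by simp
  have tn0: "\<forall>\<^sub>F n in sequentially. 0 \<le> tn n" using tn by (simp add: filterlim_at_top)
  \<comment> \<open>Beyond time \<open>L n\<close> nothing is known about \<open>c n\<close>.
    Divergence of \<open>L n\<close> brings every fixed time into the domain eventually.\<close>
  have "filterlim (\<lambda>n. - Wp p (\<mu> 0) (\<nu> 0) - Wp p (\<nu>0 n) (\<nu> 0) + tn n) at_top sequentially"
    by (rule filterlim_tendsto_add_at_top[OF _ tn]) (rule tendsto_intros \<nu>0)+
  moreover have "\<forall>\<^sub>F n in sequentially. - Wp p (\<mu> 0) (\<nu> 0) - Wp p (\<nu>0 n) (\<nu> 0) + tn n \<le> L n"
    using tn0
  proof eventually_elim
    case (elim n)
    have "Wp p (\<mu> 0) (\<mu> (tn n)) = tn n" using Rm(2)[of 0 "tn n"] elim by simp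
    moreover have "Wp p (\<mu> 0) (\<mu> (tn n)) \<le> Wp p (\<mu> 0) (\<nu> 0) + Wp p (\<nu> 0) (\<mu> (tn n))"
      by (intro Wp_triangle Rm(1) Rn(1) p elim order_refl)
    moreover have "Wp p (\<nu> 0) (\<mu> (tn n)) \<le> Wp p (\<nu> 0) (\<nu>0 n) + L n"
      unfolding L_def by (intro Wp_triangle Rm(1) Rn(1) \<nu>0(1) p elim order_refl)
    moreover have "Wp p (\<nu> 0) (\<nu>0 n) = Wp p (\<nu>0 n) (\<nu> 0)"
      by (intro Wp_commute Rn(1) \<nu>0(1) p0 order_refl)
    ultimately show ?case by linarith
  qed
  ultimately have L: "filterlim L at_top sequentially" by (rule filterlim_at_top_mono)
  \<comment> \<open>Distances are compared with \<open>L n\<close>, the length of the geodesic,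
    instead of \<open>tn n\<close>. The discrepancy does not depend on \<open>r\<close> and cancels
    in the difference of two Busemann values.\<close>
  have lim: "(\<lambda>n. Wp p (\<nu> r) (\<mu> (tn n)) - L n) \<longlonglongrightarrow> - r" if r: "r \<ge> 0" for r
  proof -
    have "\<forall>\<^sub>F n in sequentially. r \<le> L n" using L by (simp add: filterlim_at_top)
    with tn0 have "\<forall>\<^sub>F n in sequentially. norm (Wp p (\<nu> r) (\<mu> (tn n)) - L n - (- r)) \<le> Wp p (c n r) (\<nu> r)"
    proof eventually_elim
      case (elim n)
      note T = TgeodD[OF c[of n], folded L_def]
      have cr: "c n r \<in> Pp p" using T(3) elim r by simp
      have "Wp p (c n r) (c n (L n)) = \<bar>r - L n\<bar>" using T(4) elim r by simp
      then have "Wp p (c n r) (\<mu> (tn n)) = L n - r" using elim T(2) by simp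
      then show ?case
        using Wp_triangle[OF cr Rn(1)[OF r] Rm(1)[OF elim(1)] p] Wp_triangle[OF Rn(1)[OF r] cr Rm(1)[OF elim(1)] p]
          Wp_commute[OF Rn(1)[OF r] cr p0] unfolding real_norm_def by linarith
    qed
    from LIM_zero_cancel[OF Lim_null_comparison[OF this conv[OF r]]] show ?thesis .
  qed
  have bus: "(\<lambda>n. Wp p (\<nu> r) (\<mu> (tn n)) - tn n) \<longlonglongrightarrow> busemann p \<mu> (\<nu> r)" if "r \<ge> 0" for r
    using filterlim_compose[OF busemann_tendsto[OF \<mu> Rn(1)[OF that] p] tn] .
  have "(\<lambda>n. (Wp p (\<nu> t) (\<mu> (tn n)) - tn n) - (Wp p (\<nu> s) (\<mu> (tn n)) - tn n)) \<longlonglongrightarrow> busemann p \<mu> (\<nu> t) - busemann p \<mu> (\<nu> s)"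
    by (intro tendsto_diff bus st)
  moreover have "(\<lambda>n. (Wp p (\<nu> t) (\<mu> (tn n)) - L n) - (Wp p (\<nu> s) (\<mu> (tn n)) - L n)) \<longlonglongrightarrow> - t - (- s)"
    by (intro tendsto_diff lim st)
  ultimately have "busemann p \<mu> (\<nu> t) - busemann p \<mu> (\<nu> s) = - t - (- s)"
    by (intro LIMSEQ_unique[of "\<lambda>n. Wp p (\<nu> t) (\<mu> (tn n)) - Wp p (\<nu> s) (\<mu> (tn n))"]) simp_all
  then show ?thesis by simp
qed

section \<open>Proper geodesic spaces and measurable selection\<close>

text \<open>An almost shortest curve from \<open>x\<close> to \<open>y\<close> crosses the sphere of
  radius \<open>s\<close> about \<open>x\<close>; cutting it at the crossing bounds what remains to
  \<open>y\<close>.\<close>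

lemma length_space_almost_between:
  fixes x y :: "'a::metric_space"
  assumes "length_space TYPE('a)" and s: "0 \<le> s" "s \<le> dist x y" and "\<epsilon> > 0"
  obtains z where "dist x z = s" "dist z y < dist x y - s + \<epsilon>"
proof -
  have "Inf {curve_length \<gamma> 0 1 | \<gamma>. continuous_on {0..1} \<gamma> \<and> \<gamma> 0 = x \<and> \<gamma> 1 = y} = ereal (dist x y)"
    using assms(1) by (simp add: length_space_def)
  also have "\<dots> < ereal (dist x y + \<epsilon>)" using \<open>\<epsilon> > 0\<close> by simp
  finally obtain \<gamma> where \<gamma>: "continuous_on {0..1} \<gamma>" "\<gamma> 0 = x" "\<gamma> 1 = y" "curve_length \<gamma> 0 1 < ereal (dist x y + \<epsilon>)"
    unfolding Inf_less_iff by blast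
  have "continuous_on {0..1} (\<lambda>t. dist x (\<gamma> t))" by (intro continuous_intros \<gamma>(1))
  then obtain t where t: "0 \<le> t" "t \<le> 1" "dist x (\<gamma> t) = s"
    using IVT'[of "\<lambda>t. dist x (\<gamma> t)" 0 s 1] \<gamma>(2,3) s by auto
  define \<tau> where "\<tau> i = (if i = 0 then 0 else if i = 1 then t else 1)" for i :: nat
  have "ereal (\<Sum>i<2. dist (\<gamma> (\<tau> i)) (\<gamma> (\<tau> (Suc i)))) \<le> curve_length \<gamma> 0 1"
    unfolding curve_length_def
    by (intro Sup_upper CollectI exI[of _ "2::nat"] exI[of _ \<tau>]) (use t in \<open>auto simp: \<tau>_def\<close>)
  also have "(\<Sum>i<2. dist (\<gamma> (\<tau> i)) (\<gamma> (\<tau> (Suc i)))) = s + dist (\<gamma> t) y"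
    using \<gamma> t by (simp add: numeral_2_eq_2 \<tau>_def)
  finally have "ereal (s + dist (\<gamma> t) y) < ereal (dist x y + \<epsilon>)" using \<gamma>(4) by (rule le_less_trans)
  then show thesis using that[of "\<gamma> t"] t by simp
qed

text \<open>The Hopf-Rinow theorem in the form of Cohn-Vossen. The radii with compact balls are
  closed under a small increase (\<open>extend\<close>, by local compactness) and under limits from
  below (\<open>limit\<close>, by completeness and total boundedness), so they have no finite
  supremum. Both steps move a point of the larger ball near the smaller one by almost shortest
  curves.\<close>

lemma hopf_rinow_compact_cball:
  fixes x :: "'a::complete_space"
  assumes lc: "locally_compact_space (euclidean :: 'a topology)" and len: "length_space TYPE('a)"
  shows "compact (cball x r)"
proof -
  have smaller: "compact (cball x s)" if "compact (cball x r)" "s \<le> r" for r s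
  proof -
    have "cball x s = cball x r \<inter> cball x s" using that by auto
    then show ?thesis using compact_Int_closed[OF that(1) closed_cball, of x s] by simp
  qed
  have extend: "\<exists>\<delta>>0. compact (cball x (r + \<delta>))" if r: "compact (cball x r)" "r \<ge> 0" for r
  proof -
    have "\<forall>k::'a. \<exists>U K. open U \<and> compact K \<and> k \<in> U \<and> U \<subseteq> K"
      using lc by (simp add: locally_compact_space_def)
    then obtain U K :: "'a \<Rightarrow> 'a set" where UK: "\<And>k. open (U k)" "\<And>k. compact (K k)" "\<And>k. k \<in> U k" "\<And>k. U k \<subseteq> K k" by metis
    obtain C where C: "C \<subseteq> cball x r" "finite C" "cball x r \<subseteq> (\<Union>k\<in>C. U k)"
    proof (rule compactE_image[OF r(1), of "cball x r" U])
      show "cball x r \<subseteq> (\<Union>k\<in>cball x r. U k)" using UK(3) by blast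
    qed (use UK(1) in auto)
    have "open (\<Union>k\<in>C. U k)" using UK(1) by blast
    from compact_subset_open_imp_ball_epsilon_subset[OF r(1) this C(3)]
    obtain e where e: "e > 0" "(\<Union>z\<in>cball x r. ball z e) \<subseteq> (\<Union>k\<in>C. U k)"
      by blast
    have "cball x (r + e / 2) \<subseteq> (\<Union>k\<in>C. U k)"
    proof
      fix y assume y: "y \<in> cball x (r + e / 2)"
      show "y \<in> (\<Union>k\<in>C. U k)"
      proof (cases "dist x y \<le> r")
        case True
        then show ?thesis using C(3) by auto
      next
        case False
        then obtain z where "dist x z = r" "dist z y < dist x y - r + e / 2"
          using length_space_almost_between[OF len r(2), of x y "e/2"] e(1) by auto
        then show ?thesis using y by (intro subsetD[OF e(2)] UN_I[of z]) auto
      qed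
    qed
    then have "cball x (r + e / 2) = (\<Union>k\<in>C. K k) \<inter> cball x (r + e / 2)" using UK(4) by blast
    then have "compact (cball x (r + e / 2))"
      using compact_Int_closed[of "\<Union>k\<in>C. K k" "cball x (r + e / 2)"] compact_UN[of C K] C(2) UK(2) by simp
    then show ?thesis using e(1) by (intro exI[of _ "e/2"]) simp
  qed
  have limit: "compact (cball x R)" if R: "R > 0" "\<And>r. r < R \<Longrightarrow> compact (cball x r)" for R
  proof -
    have "\<exists>k. finite k \<and> cball x R \<subseteq> (\<Union>x\<in>k. ball x e)" if e: "e > 0" for e
    proof -
    define r where "r = max 0 (R - e / 4)"
    have r: "0 \<le> r" "r < R" "R - e / 4 \<le> r" using R(1) e by (auto simp: r_def)
    obtain k where k: "finite k" "cball x r \<subseteq> (\<Union>z\<in>k. ball z (e / 2))"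
      using R(2)[OF r(2)] e unfolding compact_eq_totally_bounded by (metis half_gt_zero)
    have "cball x R \<subseteq> (\<Union>z\<in>k. ball z e)"
    proof
      fix y assume y: "y \<in> cball x R"
      obtain z where z: "dist x z \<le> r" "dist z y < e / 2"
      proof (cases "dist x y \<le> r")
        case True
        then show ?thesis using that[of y] e by simp
      next
        case False
        then obtain z where "dist x z = r" "dist z y < dist x y - r + e / 4"
          using length_space_almost_between[OF len r(1), of x y "e/4"] e by auto
        then show ?thesis using that[of z] y r by simp
      qed
      then obtain c where "c \<in> k" "dist c z < e / 2" using k(2) by (auto simp: subset_iff)
      then show "y \<in> (\<Union>z\<in>k. ball z e)" using z(2) dist_triangle[of c y z] by (auto intro!: bexI[of _ c])
    qed
    then show ?thesis using k(1) by blast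
    qed
    then show ?thesis
      using compact_eq_totally_bounded[of "cball x R"] complete_eq_closed[of "cball x R"] by simp
  qed
  define S where "S = {r. r \<ge> 0 \<and> compact (cball x r)}"
  have "0 \<in> S" by (simp add: S_def)
  show ?thesis
  proof (rule ccontr)
    assume not: "\<not> compact (cball x r)"
    have bdd: "s \<le> r" if "s \<in> S" for s using smaller[of s r] that not by (force simp: S_def)
    define R where "R = Sup S"
    have bdd': "bdd_above S" using bdd by (rule bdd_aboveI)
    have below: "compact (cball x s)" if "s < R" for s
    proof -
      obtain s' where "s' \<in> S" "s < s'" using less_cSup_iff[OF _ bdd', of s] \<open>0 \<in> S\<close> \<open>s < R\<close> by (auto simp: R_def)
      then show ?thesis using smaller[of s' s] by (simp add: S_def)
    qed
    obtain \<delta>0 where "\<delta>0 > 0" "compact (cball x (0 + \<delta>0))" using extend[of 0] by auto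
    then have "\<delta>0 \<in> S" by (simp add: S_def)
    then have "R > 0" using cSup_upper[OF _ bdd', of \<delta>0] \<open>\<delta>0 > 0\<close> by (simp add: R_def)
    then obtain \<delta> where \<delta>: "\<delta> > 0" "compact (cball x (R + \<delta>))" using extend[OF limit[OF _ below]] by auto
    then have "R + \<delta> \<in> S" using \<open>R > 0\<close> by (simp add: S_def)
    then show False using cSup_upper[OF _ bdd', of "R + \<delta>"] \<delta>(1) by (simp add: R_def)
  qed
qed

text \<open>Among the points of the compact sphere of radius \<open>s\<close> about
  \<open>x\<close>, one closest to \<open>y\<close> does it, because almost-between points show that
  the minimum is small enough.\<close>

lemma exists_between:
  fixes x y :: "'a::metric_space"
  assumes proper: "\<And>(x::'a) r. compact (cball x r)" and len: "length_space TYPE('a)"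
    and s: "0 \<le> s" "s \<le> dist x y"
  obtains z where "dist x z = s" "dist z y = dist x y - s"
proof -
  have "{z. dist x z = s} = cball x s \<inter> {z. dist x z = s}" by auto
  moreover have "closed {z. dist x z = s}" by (intro closed_Collect_eq continuous_intros)
  ultimately have "compact {z. dist x z = s}" using compact_Int_closed[OF proper[of x s]] by metis
  moreover have "{z. dist x z = s} \<noteq> {}" using length_space_almost_between[OF len s, of 1] by auto
  moreover have "continuous_on {z. dist x z = s} (\<lambda>z. dist z y)" by (intro continuous_intros)
  ultimately have "\<exists>z\<in>{z. dist x z = s}. \<forall>z'\<in>{z. dist x z = s}. dist z y \<le> dist z' y"
    by (rule continuous_attains_inf)
  then obtain z where z: "dist x z = s" "\<And>z'. dist x z' = s \<Longrightarrow> dist z y \<le> dist z' y" by blast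
  have "dist z y \<le> dist x y - s + \<epsilon>" if "\<epsilon> > 0" for \<epsilon>
  proof -
    obtain z' where "dist x z' = s" "dist z' y < dist x y - s + \<epsilon>"
      using length_space_almost_between[OF len s \<open>\<epsilon> > 0\<close>] .
    then show ?thesis using z(2)[of z'] by simp
  qed
  then have "dist z y \<le> dist x y - s" by (rule field_le_epsilon)
  moreover have "dist x y \<le> s + dist z y" using dist_triangle[of x y z] z(1) by simp
  ultimately show thesis using that[of z] z(1) by simp
qed

text \<open>Properness of the second factor and the local bound on the fibres keep the projection
  closed. Sets defined by an existential quantifier over points are thereby Borel, without recourse
  to analytic sets.\<close>

lemma closed_projection_proper:
  fixes C :: "('b::metric_space \<times> 'a::metric_space) set"
  assumes proper: "\<And>(x::'a) r. compact (cball x r)" and C: "closed C"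
    and f: "continuous_on UNIV f" and g: "continuous_on UNIV (g :: 'b \<Rightarrow> real)"
    and bound: "\<And>z y. (z, y) \<in> C \<Longrightarrow> dist (f z) y \<le> g z"
  shows "closed {z. \<exists>y. (z, y) \<in> C}"
  unfolding closed_sequential_limits
proof (intro allI impI, elim conjE)
  fix u z assume u: "\<forall>n. u n \<in> {z. \<exists>y. (z, y) \<in> C}" and z: "u \<longlonglongrightarrow> z"
  then obtain y where y: "\<And>n. (u n, y n) \<in> C" by (auto simp: choice_iff)
  have fu: "(\<lambda>n. f (u n)) \<longlonglongrightarrow> f z" and gu: "(\<lambda>n. g (u n)) \<longlonglongrightarrow> g z"
    using z f g by (auto simp: continuous_on_eq_continuous_at intro: isCont_tendsto_compose)
  have "bounded (range (\<lambda>n. f (u n)))" "bounded (range (\<lambda>n. g (u n)))"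
    using fu gu by (auto intro: convergent_imp_bounded)
  then obtain A B where AB: "\<And>n. dist (f z) (f (u n)) \<le> A" "\<And>n. \<bar>g (u n)\<bar> \<le> B"
    by (auto simp: bounded_any_center[of _ "f z"] bounded_iff)
  have "y n \<in> cball (f z) (A + B)" for n
    using bound[OF y[of n]] AB(1)[of n] AB(2)[of n] dist_triangle[of "f z" "y n" "f (u n)"] by auto
  then obtain l r where l: "strict_mono (r :: nat \<Rightarrow> nat)" "(y \<circ> r) \<longlonglongrightarrow> l"
    using proper[of "f z" "A + B"] unfolding compact_def by metis
  have "(\<lambda>n. ((u \<circ> r) n, (y \<circ> r) n)) \<longlonglongrightarrow> (z, l)"
    by (intro tendsto_Pair LIMSEQ_subseq_LIMSEQ[OF z l(1)] l(2))
  from closed_sequentially[OF C _ this] have "(z, l) \<in> C" by (simp add: y)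
  then show "z \<in> {z. \<exists>y. (z, y) \<in> C}" by blast
qed

lemma geometric_steps_converge:
  fixes u :: "nat \<Rightarrow> 'a::complete_space"
  assumes "\<And>n. dist (u n) (u (Suc n)) \<le> C / 2 ^ n"
  shows "convergent u"
proof -
  have C: "C \<ge> 0" using order_trans[OF zero_le_dist assms[of 0]] by simp
  have step: "dist (u n) (u (n + k)) \<le> 2 * C / 2 ^ n * (1 - 1 / 2 ^ k)" for n k
  proof (induction k)
    case (Suc k)
    have "dist (u n) (u (n + Suc k)) \<le> dist (u n) (u (n + k)) + dist (u (n + k)) (u (Suc (n + k)))"
      by (simp add: dist_triangle)
    also have "\<dots> \<le> 2 * C / 2 ^ n * (1 - 1 / 2 ^ k) + C / 2 ^ (n + k)" by (intro add_mono Suc assms)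
    also have "\<dots> = 2 * C / 2 ^ n * (1 - 1 / 2 ^ Suc k)" by (simp add: field_simps power_add)
    finally show ?case .
  qed simp
  have "Cauchy u"
  proof (rule metric_CauchyI)
    fix e :: real assume e: "e > 0"
    have "(\<lambda>n. 2 * C * (1 / 2) ^ n) \<longlonglongrightarrow> 2 * C * 0" by (intro tendsto_intros LIMSEQ_power_zero) simp
    then have "\<forall>\<^sub>F n in sequentially. 2 * C * (1 / 2) ^ n < e / 2" using e by (intro order_tendstoD) auto
    then obtain N where N: "2 * C * (1 / 2) ^ N < e / 2" by (auto simp: eventually_sequentially)
    have "dist (u N) (u n) < e / 2" if "n \<ge> N" for n
    proof -
      have "dist (u N) (u n) \<le> 2 * C / 2 ^ N * (1 - 1 / 2 ^ (n - N))" using step[of N "n - N"] that by simp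
      also have "\<dots> \<le> 2 * C / 2 ^ N * 1" using C by (intro mult_left_mono) auto
      also have "\<dots> < e / 2" using N by (simp add: power_one_over field_simps)
      finally show ?thesis .
    qed
    then show "\<exists>M. \<forall>m\<ge>M. \<forall>n\<ge>M. dist (u m) (u n) < e"
      by (intro exI[of _ N] allI impI) (rule dist_triangle_half_r[of "u N"])
  qed
  then show ?thesis by (rule Cauchy_convergent)
qed

text \<open>The Kuratowski--Ryll-Nardzewski selection theorem: points of a countable dense set
  approximating the sets F w ever better are selected greedily.\<close>

lemma measurable_selection:
  fixes F :: "'w \<Rightarrow> 'a::{complete_space, second_countable_topology} set"
  assumes F: "\<And>w. closed (F w)" "\<And>w. F w \<noteq> {}"
    and hit: "\<And>q r. r > 0 \<Longrightarrow> {w \<in> space M. F w \<inter> ball q r \<noteq> {}} \<in> sets M"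
  obtains f where "f \<in> borel_measurable M" "\<And>w. f w \<in> F w"
proof -
  obtain q :: "nat \<Rightarrow> 'a" where q: "\<And>y r. r > 0 \<Longrightarrow> \<exists>j. dist y (q j) < r"
    using dense_sequence by blast
  \<comment> \<open>Invariant: the ball of radius \<open>1 / 2 ^ n\<close> about the n-th centre
    meets \<open>F w\<close>. A centre approximating a common point to within
    \<open>1 / 2 ^ Suc n\<close> lies within \<open>2 / 2 ^ n\<close> of the previous one, so the
    search never fails and the centres converge.\<close>
  define I where "I = rec_nat (\<lambda>w. LEAST j. F w \<inter> ball (q j) 1 \<noteq> {})
    (\<lambda>n i w. LEAST j. F w \<inter> ball (q j) (1 / 2 ^ Suc n) \<noteq> {} \<and> dist (q j) (q (i w)) < 2 / 2 ^ n)"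
  have I0: "I 0 w = (LEAST j. F w \<inter> ball (q j) 1 \<noteq> {})"
    and IS: "I (Suc n) w = (LEAST j. F w \<inter> ball (q j) (1 / 2 ^ Suc n) \<noteq> {} \<and> dist (q j) (q (I n w)) < 2 / 2 ^ n)" for n w
    by (simp_all add: I_def)
  have ex: "\<exists>j. F w \<inter> ball (q j) (1 / 2 ^ Suc n) \<noteq> {} \<and> dist (q j) (q i) < 2 / 2 ^ n"
    if ne: "F w \<inter> ball (q i) (1 / 2 ^ n) \<noteq> {}" for w n i
  proof -
    obtain m where m: "m \<in> F w" "dist (q i) m < 1 / 2 ^ n" using ne by auto
    obtain j where j: "dist m (q j) < 1 / 2 ^ Suc n" using q[of "1 / 2 ^ Suc n" m] by auto
    have "1 / 2 ^ Suc n \<le> (1 / 2 ^ n :: real)" by (simp add: field_simps)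
    then have "dist (q j) (q i) < 2 / 2 ^ n"
      using dist_triangle[of "q j" "q i" m] m(2) j by (simp add: dist_commute)
    moreover have "m \<in> F w \<inter> ball (q j) (1 / 2 ^ Suc n)" using m j by (simp add: dist_commute)
    ultimately show ?thesis by blast
  qed
  have inv: "F w \<inter> ball (q (I n w)) (1 / 2 ^ n) \<noteq> {}" for n w
  proof (induction n)
    case 0
    obtain m where m: "m \<in> F w" using F(2) by blast
    obtain j where "dist m (q j) < 1" using q[of 1 m] by auto
    then have "F w \<inter> ball (q j) 1 \<noteq> {}" using m by (auto simp: dist_commute)
    then show ?case unfolding I0 by (simp, rule LeastI)
  next
    case (Suc n)
    show ?case using LeastI_ex[OF ex[OF Suc]] unfolding IS by blast
  qed
  have step: "dist (q (I n w)) (q (I (Suc n) w)) \<le> 2 / 2 ^ n" for n w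
    using LeastI_ex[OF ex[OF inv]] unfolding IS[of n w] by (simp add: dist_commute less_imp_le)
  have hit': "Measurable.pred M (\<lambda>w. F w \<inter> ball x r \<noteq> {})" if "r > 0" for x r
    using hit[OF that] by (simp add: pred_def)
  have I_meas[measurable]: "I n \<in> measurable M (count_space UNIV)" for n
  proof (induction n)
    case 0
    have [measurable]: "Measurable.pred M (\<lambda>w. F w \<inter> ball (q j) 1 \<noteq> {})" for j by (rule hit') simp
    show ?case unfolding I0[abs_def] by measurable
  next
    case (Suc n)
    note [measurable] = Suc
    have [measurable]: "Measurable.pred M (\<lambda>w. F w \<inter> ball (q j) (1 / 2 ^ Suc n) \<noteq> {})" for j by (rule hit') simp
    have [measurable]: "Measurable.pred M (\<lambda>w. dist (q j) (q (I n w)) < 2 / 2 ^ n)" for j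
      by (rule measurable_compose[OF Suc]) simp
    show ?case unfolding IS[abs_def] by measurable
  qed
  define f where "f w = lim (\<lambda>n. q (I n w))" for w
  have lim: "(\<lambda>n. q (I n w)) \<longlonglongrightarrow> f w" for w
    unfolding f_def convergent_LIMSEQ_iff[symmetric] by (rule geometric_steps_converge[OF step])
  have "f \<in> borel_measurable M"
  proof (rule borel_measurable_LIMSEQ_metric[OF _ lim])
    show "(\<lambda>w. q (I n w)) \<in> borel_measurable M" for n
      by (rule measurable_compose[OF I_meas]) simp
  qed
  moreover have "f w \<in> F w" for w
  proof -
    have "\<exists>m. m \<in> F w \<and> dist m (q (I n w)) \<le> (1 / 2) ^ n" for n
      using inv[of w n] by (force simp: dist_commute power_one_over)
    then obtain m where m: "\<And>n. m n \<in> F w" "\<And>n. dist (m n) (q (I n w)) \<le> (1 / 2) ^ n" by metis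
    have "(\<lambda>n. dist (m n) (f w)) \<longlonglongrightarrow> 0"
    proof (rule tendsto_sandwich[where f = "\<lambda>_. 0"])
      show "(\<lambda>n. (1 / 2) ^ n + dist (q (I n w)) (f w)) \<longlonglongrightarrow> 0"
        using tendsto_add[OF LIMSEQ_power_zero[of "1/2::real"] tendsto_dist_iff[THEN iffD1, OF lim[of w]]] by simp
      show "\<forall>\<^sub>F n in sequentially. dist (m n) (f w) \<le> (1 / 2) ^ n + dist (q (I n w)) (f w)"
      proof (intro always_eventually allI)
        fix n show "dist (m n) (f w) \<le> (1 / 2) ^ n + dist (q (I n w)) (f w)"
          using m(2)[of n] dist_triangle[of "m n" "f w" "q (I n w)"] by linarith
      qed
    qed auto
    then have "m \<longlonglongrightarrow> f w" by (subst tendsto_dist_iff)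
    then show ?thesis using closed_sequentially[OF F(1)] m(1) by blast
  qed
  ultimately show thesis using that by blast
qed

lemma midpoint_selection:
  assumes proper: "\<And>(x::'a::polish_space) r. compact (cball x r)" and len: "length_space TYPE('a::polish_space)"
  obtains mid :: "'a::polish_space \<times> 'a \<Rightarrow> 'a" where "mid \<in> borel_measurable borel"
    "\<And>z. dist (fst z) (mid z) = dist (fst z) (snd z) / 2" "\<And>z. dist (mid z) (snd z) = dist (fst z) (snd z) / 2"
proof -
  define F where "F z = {m::'a. dist (fst z) m = dist (fst z) (snd z) / 2 \<and> dist m (snd z) = dist (fst z) (snd z) / 2}" for z
  have closed: "closed (F z)" for z unfolding F_def
    by (intro closed_Collect_conj closed_Collect_eq continuous_intros)
  have ne: "F z \<noteq> {}" for z
    using exists_between[OF proper len, of "dist (fst z) (snd z) / 2" "fst z" "snd z"] by (force simp: F_def)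
  have hit_closed: "closed {z. \<exists>m. m \<in> F z \<and> dist q m \<le> r}" for q r
  proof -
    have C: "closed {(z, m). m \<in> F z \<and> dist q m \<le> r}" unfolding F_def split_beta mem_Collect_eq
      by (intro closed_Collect_conj closed_Collect_eq closed_Collect_le continuous_intros) auto
    have "closed {z. \<exists>m. (z, m) \<in> {(z, m). m \<in> F z \<and> dist q m \<le> r}}"
      by (rule closed_projection_proper[OF proper C, of "\<lambda>_. q" "\<lambda>_. r"]) (auto intro: continuous_intros)
    then show ?thesis by simp
  qed
  have hit: "{z \<in> space borel. F z \<inter> ball q r \<noteq> {}} \<in> sets borel" if "r > 0" for q r
  proof -
    \<comment> \<open>The open ball is a countable union of closed balls, and only for closed ones
      is the projection known to be closed.\<close>
    have "F z \<inter> ball q r \<noteq> {} \<longleftrightarrow> (\<exists>n::nat. \<exists>m. m \<in> F z \<and> dist q m \<le> r - inverse (Suc n))" for z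
    proof
      assume "F z \<inter> ball q r \<noteq> {}"
      then obtain m where m: "m \<in> F z" "0 < r - dist q m" by auto
      then obtain n where "inverse (real (Suc n)) < r - dist q m" using reals_Archimedean by blast
      then show "\<exists>n::nat. \<exists>m. m \<in> F z \<and> dist q m \<le> r - inverse (Suc n)"
        using m by (intro exI[of _ n] exI[of _ m]) auto
    next
      assume "\<exists>n::nat. \<exists>m. m \<in> F z \<and> dist q m \<le> r - inverse (Suc n)"
      then obtain n :: nat and m where m: "m \<in> F z" "dist q m \<le> r - inverse (Suc n)" by blast
      have "inverse (real (Suc n)) > 0" by simp
      then have "dist q m < r" using m(2) by linarith
      then show "F z \<inter> ball q r \<noteq> {}" using m(1) by auto
    qed
    then have "{z \<in> space borel. F z \<inter> ball q r \<noteq> {}} = (\<Union>n::nat. {z. \<exists>m. m \<in> F z \<and> dist q m \<le> r - inverse (Suc n)})"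
      by auto
    also have "\<dots> \<in> sets borel" using hit_closed by (intro sets.countable_UN) auto
    finally show ?thesis .
  qed
  obtain mid where "mid \<in> borel_measurable borel" "\<And>z. mid z \<in> F z"
    using measurable_selection[of F borel, OF closed ne hit] by blast
  then show thesis using that[of mid] by (auto simp: F_def)
qed

text \<open>The point with parameter k / 2^n on a curve joining the components of \<open>z\<close>,
  meant for k up to 2^n: even indices come from the coarser level, odd ones are midpoints of its
  neighbours.\<close>

primrec dyadic :: "('a \<times> 'a \<Rightarrow> 'a) \<Rightarrow> nat \<Rightarrow> nat \<Rightarrow> 'a \<times> 'a \<Rightarrow> 'a" where
  "dyadic mid 0 k z = (if k = 0 then fst z else snd z)"
| "dyadic mid (Suc n) k z = (if even k then dyadic mid n (k div 2) z
     else mid (dyadic mid n (k div 2) z, dyadic mid n (Suc (k div 2)) z))"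

lemma dyadic_start: "dyadic mid n 0 z = fst z"
  by (induction n) auto

lemma dyadic_end: "dyadic mid n (2 ^ n) z = snd z"
  by (induction n) auto

lemma dyadic_step:
  fixes mid :: "'a::metric_space \<times> 'a \<Rightarrow> 'a"
  assumes mid: "\<And>z. dist (fst z) (mid z) = dist (fst z) (snd z) / 2" "\<And>z. dist (mid z) (snd z) = dist (fst z) (snd z) / 2"
  shows "k < 2 ^ n \<Longrightarrow> dist (dyadic mid n k z) (dyadic mid n (Suc k) z) = dist (fst z) (snd z) / 2 ^ n"
proof (induction n arbitrary: k)
  case (Suc n)
  have "k div 2 < 2 ^ n" using Suc.prems by auto
  note IH = Suc.IH[OF this]
  show ?case
  proof (cases "even k")
    case True
    then have "Suc k div 2 = k div 2" by auto
    then show ?thesis using True IH mid(1)[of "(dyadic mid n (k div 2) z, dyadic mid n (Suc (k div 2)) z)"] by simp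
  next
    case False
    then have "Suc k div 2 = Suc (k div 2)" by auto
    then show ?thesis using False IH mid(2)[of "(dyadic mid n (k div 2) z, dyadic mid n (Suc (k div 2)) z)"] by simp
  qed
qed simp

text \<open>Adding up steps bounds every distance from above. As the bounds over a whole subdivision
  add up to the distance of the endpoints, none of them can be strict.\<close>

lemma dyadic_dist:
  fixes mid :: "'a::metric_space \<times> 'a \<Rightarrow> 'a"
  assumes mid: "\<And>z. dist (fst z) (mid z) = dist (fst z) (snd z) / 2" "\<And>z. dist (mid z) (snd z) = dist (fst z) (snd z) / 2"
    and ij: "i \<le> 2 ^ n" "j \<le> 2 ^ n"
  shows "dist (dyadic mid n i z) (dyadic mid n j z) = \<bar>real i - real j\<bar> / 2 ^ n * dist (fst z) (snd z)"
proof -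
  let ?d = "dist (fst z) (snd z)"
  have upper: "dist (dyadic mid n i z) (dyadic mid n (i + m) z) \<le> real m / 2 ^ n * ?d" if "i + m \<le> 2 ^ n" for i m
    using that
  proof (induction m)
    case (Suc m)
    have "dist (dyadic mid n i z) (dyadic mid n (i + Suc m) z)
      \<le> dist (dyadic mid n i z) (dyadic mid n (i + m) z) + dist (dyadic mid n (i + m) z) (dyadic mid n (Suc (i + m)) z)"
      by (simp add: dist_triangle)
    also have "\<dots> \<le> real m / 2 ^ n * ?d + ?d / 2 ^ n"
      using Suc dyadic_step[OF mid, of "i + m" n z] by (intro add_mono) auto
    finally show ?case by (simp add: field_simps)
  qed simp
  have exact: "dist (dyadic mid n i z) (dyadic mid n j z) = (real j - real i) / 2 ^ n * ?d" if "i \<le> j" "j \<le> 2 ^ n" for i j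
  proof -
    have "?d \<le> dist (dyadic mid n 0 z) (dyadic mid n i z) + dist (dyadic mid n i z) (dyadic mid n j z)
      + dist (dyadic mid n j z) (dyadic mid n (2 ^ n) z)"
      using dist_triangle[of "fst z" "snd z" "dyadic mid n i z"] dist_triangle[of "dyadic mid n i z" "snd z" "dyadic mid n j z"]
      by (simp add: dyadic_start dyadic_end)
    moreover have "dist (dyadic mid n 0 z) (dyadic mid n i z) \<le> real i / 2 ^ n * ?d" using upper[of 0 i] that by simp
    moreover have "dist (dyadic mid n j z) (dyadic mid n (2 ^ n) z) \<le> (2 ^ n - real j) / 2 ^ n * ?d"
      using upper[of j "2 ^ n - j"] that by (simp add: of_nat_diff)
    moreover have "dist (dyadic mid n i z) (dyadic mid n j z) \<le> (real j - real i) / 2 ^ n * ?d"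
      using upper[of i "j - i"] that by (simp add: of_nat_diff)
    moreover have "real i / 2 ^ n * ?d + (real j - real i) / 2 ^ n * ?d + (2 ^ n - real j) / 2 ^ n * ?d = ?d"
      by (simp add: field_simps)
    ultimately show ?thesis by linarith
  qed
  show ?thesis
  proof (cases "i \<le> j")
    case True
    then show ?thesis using exact[OF True ij(2)] by simp
  next
    case False
    then show ?thesis using exact[of j i] ij by (simp add: dist_commute)
  qed
qed

lemma dyadic_floor_tendsto: "(\<lambda>n. real (nat \<lfloor>t * 2 ^ n\<rfloor>) / 2 ^ n) \<longlonglongrightarrow> t" if "t \<ge> 0" for t :: real
proof (rule tendsto_sandwich)
  show "(\<lambda>n. t - (1 / 2) ^ n) \<longlonglongrightarrow> t"
    using tendsto_diff[OF tendsto_const LIMSEQ_power_zero[of "1/2::real"], of t] by simp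
  have fl: "real (nat \<lfloor>t * 2 ^ n\<rfloor>) = of_int \<lfloor>t * 2 ^ n\<rfloor>" for n using that by simp
  show "\<forall>\<^sub>F n in sequentially. t - (1 / 2) ^ n \<le> real (nat \<lfloor>t * 2 ^ n\<rfloor>) / 2 ^ n"
  proof (intro always_eventually allI)
    fix n
    have "(t * 2 ^ n - 1) / 2 ^ n \<le> of_int \<lfloor>t * 2 ^ n\<rfloor> / 2 ^ n"
      using real_of_int_floor_gt_diff_one[of "t * 2 ^ n"] by (intro divide_right_mono) auto
    then show "t - (1 / 2) ^ n \<le> real (nat \<lfloor>t * 2 ^ n\<rfloor>) / 2 ^ n" unfolding fl
      by (simp add: diff_divide_distrib power_one_over)
  qed
  show "\<forall>\<^sub>F n in sequentially. real (nat \<lfloor>t * 2 ^ n\<rfloor>) / 2 ^ n \<le> t"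
  proof (intro always_eventually allI)
    fix n
    have "of_int \<lfloor>t * 2 ^ n\<rfloor> / 2 ^ n \<le> t * 2 ^ n / 2 ^ n" by (intro divide_right_mono of_int_floor_le) simp
    then show "real (nat \<lfloor>t * 2 ^ n\<rfloor>) / 2 ^ n \<le> t" unfolding fl by simp
  qed
qed simp

text \<open>For fixed \<open>t\<close> the geodesic point is a pointwise limit of dyadic points,
  hence Borel in the pair of endpoints. Only midpoints have to be selected, not elements of a space
  of curves.\<close>

lemma geodesic_selection:
  assumes proper: "\<And>(x::'a::polish_space) r. compact (cball x r)" and len: "length_space TYPE('a::polish_space)"
  obtains G :: "real \<Rightarrow> 'a::polish_space \<times> 'a \<Rightarrow> 'a" where
    "\<forall>t\<in>{0..1}. G t \<in> borel_measurable borel" "G 0 = fst" "G 1 = snd"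
    "\<forall>s\<in>{0..1}. \<forall>t\<in>{0..1}. \<forall>z. dist (G s z) (G t z) = \<bar>s - t\<bar> * dist (fst z) (snd z)"
proof -
  obtain mid :: "'a \<times> 'a \<Rightarrow> 'a" where mid: "mid \<in> borel_measurable borel"
    "\<And>z. dist (fst z) (mid z) = dist (fst z) (snd z) / 2" "\<And>z. dist (mid z) (snd z) = dist (fst z) (snd z) / 2"
    using midpoint_selection[OF proper len] by blast
  define D where "D = dyadic mid"
  note dist_D = dyadic_dist[OF mid(2,3), folded D_def]
  define k where "k t n = nat \<lfloor>t * 2 ^ n\<rfloor>" for t :: real and n
  have k_le: "k t n \<le> 2 ^ n" if "t \<in> {0..1}" for t n
  proof -
    have "\<lfloor>t * 2 ^ n\<rfloor> \<le> \<lfloor>(2::real) ^ n\<rfloor>" using that by (intro floor_mono) simp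
    then show ?thesis using that by (simp add: k_def nat_le_iff)
  qed
  \<comment> \<open>Refining the grid moves the rounded parameter by at most one step of the finer
    grid, which gives the geometric decay needed for convergence.\<close>
  have k_Suc: "k t (Suc n) = 2 * k t n \<or> k t (Suc n) = Suc (2 * k t n)" if "t \<in> {0..1}" for t n
  proof -
    have "t * 2 ^ n \<ge> 0" using that by simp
    moreover have "\<lfloor>2 * r\<rfloor> = 2 * \<lfloor>r\<rfloor> \<or> \<lfloor>2 * r\<rfloor> = 2 * \<lfloor>r\<rfloor> + 1" for r :: real by linarith
    from this[of "t * 2 ^ n"] have "\<lfloor>t * 2 ^ Suc n\<rfloor> = 2 * \<lfloor>t * 2 ^ n\<rfloor> \<or> \<lfloor>t * 2 ^ Suc n\<rfloor> = 2 * \<lfloor>t * 2 ^ n\<rfloor> + 1"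
      by (simp add: mult.left_commute mult.commute)
    moreover have "\<lfloor>t * 2 ^ n\<rfloor> \<ge> 0" using that by simp
    moreover have "nat j = 2 * nat i \<or> nat j = Suc (2 * nat i)" if "j = 2 * i \<or> j = 2 * i + 1" "i \<ge> 0" for i j :: int
      using that by arith
    ultimately show ?thesis unfolding k_def by blast
  qed
  have conv: "convergent (\<lambda>n. D n (k t n) z)" if t: "t \<in> {0..1}" for t z
  proof (rule geometric_steps_converge)
    fix n
    have "D n (k t n) z = D (Suc n) (2 * k t n) z" by (simp add: D_def)
    moreover have "2 * k t n \<le> 2 ^ Suc n" using k_le[OF t, of n] by simp
    ultimately have "dist (D n (k t n) z) (D (Suc n) (k t (Suc n)) z)
      = \<bar>real (2 * k t n) - real (k t (Suc n))\<bar> / 2 ^ Suc n * dist (fst z) (snd z)"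
      using dist_D[of "2 * k t n" "Suc n" "k t (Suc n)" z] k_le[OF t, of "Suc n"] by simp
    also have "\<dots> \<le> 2 / 2 ^ Suc n * dist (fst z) (snd z)"
      using k_Suc[OF t, of n] by (intro mult_right_mono divide_right_mono) auto
    finally show "dist (D n (k t n) z) (D (Suc n) (k t (Suc n)) z) \<le> dist (fst z) (snd z) / 2 ^ n" by simp
  qed
  define G where "G t z = lim (\<lambda>n. D n (k t n) z)" for t z
  have lim: "(\<lambda>n. D n (k t n) z) \<longlonglongrightarrow> G t z" if "t \<in> {0..1}" for t z
    unfolding G_def convergent_LIMSEQ_iff[symmetric] by (rule conv[OF that])
  have D_meas: "D n j \<in> borel_measurable borel" for n j
  proof (induction n arbitrary: j)
    case 0
    then show ?case
      by (cases "j = 0") (auto simp: D_def intro!: borel_measurable_continuous_onI continuous_intros)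
  next
    case (Suc n)
    have D1: "D (Suc n) j = D n (j div 2)" if "even j" using that by (auto simp: D_def)
    have D2: "D (Suc n) j = (\<lambda>z. mid (D n (j div 2) z, D n (Suc (j div 2)) z))" if "odd j" using that by (auto simp: D_def)
    have "(\<lambda>z. (D n (j div 2) z, D n (Suc (j div 2)) z)) \<in> measurable borel (borel \<Otimes>\<^sub>M borel)"
      using Suc by (intro measurable_Pair)
    then have "(\<lambda>z. mid (D n (j div 2) z, D n (Suc (j div 2)) z)) \<in> borel_measurable borel"
      unfolding borel_prod by (rule measurable_compose[OF _ mid(1)])
    then show ?case using D1 D2 Suc by (cases "even j") simp_all
  qed
  show thesis
  proof (rule that[of G]; (intro ballI allI)?)
    show "G t \<in> borel_measurable borel" if "t \<in> {0..1}" for t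
      by (rule borel_measurable_LIMSEQ_metric[OF D_meas lim[OF that]])
    show "G 0 = fst" by (simp add: fun_eq_iff G_def k_def D_def dyadic_start)
    have "k 1 n = 2 ^ n" for n
    proof -
      have "\<lfloor>(2::real) ^ n\<rfloor> = 2 ^ n" by (metis floor_of_int of_int_numeral of_int_power)
      then show ?thesis by (simp add: k_def nat_power_eq)
    qed
    then show "G 1 = snd" by (simp add: fun_eq_iff G_def D_def dyadic_end)
    fix s t :: real and z :: "'a \<times> 'a" assume st: "s \<in> {0..1}" "t \<in> {0..1::real}"
    have "(\<lambda>n. \<bar>real (k s n) / 2 ^ n - real (k t n) / 2 ^ n\<bar> * dist (fst z) (snd z)) \<longlonglongrightarrow> \<bar>s - t\<bar> * dist (fst z) (snd z)"
      unfolding k_def using st by (intro tendsto_intros dyadic_floor_tendsto) auto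
    moreover have "dist (D n (k s n) z) (D n (k t n) z) = \<bar>real (k s n) / 2 ^ n - real (k t n) / 2 ^ n\<bar> * dist (fst z) (snd z)" for n
      unfolding dist_D[OF k_le[OF st(1)] k_le[OF st(2)]] by (simp flip: diff_divide_distrib)
    ultimately have "(\<lambda>n. dist (D n (k s n) z) (D n (k t n) z)) \<longlonglongrightarrow> \<bar>s - t\<bar> * dist (fst z) (snd z)" by simp
    moreover have "(\<lambda>n. dist (D n (k s n) z) (D n (k t n) z)) \<longlonglongrightarrow> dist (G s z) (G t z)"
      by (intro tendsto_dist lim st)
    ultimately show "dist (G s z) (G t z) = \<bar>s - t\<bar> * dist (fst z) (snd z)" by (rule LIMSEQ_unique[rotated])
  qed
qed

section \<open>Unique extension of geodesics\<close>

lemma geodesic_concat: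
  fixes x w u :: "'a::metric_space" and \<alpha> \<beta> :: "real \<Rightarrow> 'a"
  assumes a: "a > 0" and b: "b > 0" and xu: "dist x u = a + b"
    and \<alpha>: "\<And>s t. s \<in> {0..a} \<Longrightarrow> t \<in> {0..a} \<Longrightarrow> dist (\<alpha> s) (\<alpha> t) = \<bar>s - t\<bar>" "\<alpha> 0 = x" "\<alpha> a = w"
    and \<beta>: "\<And>s t. s \<in> {0..b} \<Longrightarrow> t \<in> {0..b} \<Longrightarrow> dist (\<beta> s) (\<beta> t) = \<bar>s - t\<bar>" "\<beta> 0 = w" "\<beta> b = u"
  shows "geodesic_on (\<lambda>t. if t \<le> a then \<alpha> t else \<beta> (t - a)) 0 (a + b)"
proof -
  define \<zeta> where "\<zeta> t = (if t \<le> a then \<alpha> t else \<beta> (t - a))" for t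
  have ends: "\<zeta> 0 = x" "\<zeta> (a + b) = u" using a b \<alpha> \<beta> by (simp_all add: \<zeta>_def)
  have upper: "dist (\<zeta> s) (\<zeta> t) \<le> t - s" if st: "0 \<le> s" "s \<le> t" "t \<le> a + b" for s t
  proof -
    consider "t \<le> a" | "s \<le> a" "a < t" | "a < s" by linarith
    then show ?thesis
    proof cases
      case 2
      have "dist (\<alpha> s) (\<beta> (t - a)) \<le> dist (\<alpha> s) (\<alpha> a) + dist (\<beta> 0) (\<beta> (t - a))"
        using dist_triangle[of "\<alpha> s" "\<beta> (t - a)" w] \<alpha>(3) \<beta>(2) by simp
      then show ?thesis using 2 st \<alpha>(1)[of s a] \<beta>(1)[of 0 "t - a"] b by (simp add: \<zeta>_def)
    qed (use st \<alpha>(1)[of s t] \<beta>(1)[of "s - a" "t - a"] in \<open>auto simp: \<zeta>_def\<close>)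
  qed
  have exact: "dist (\<zeta> s) (\<zeta> t) = t - s" if st: "0 \<le> s" "s \<le> t" "t \<le> a + b" for s t
  proof (rule antisym[OF upper[OF st]])
    have "a + b \<le> dist (\<zeta> 0) (\<zeta> s) + dist (\<zeta> s) (\<zeta> t) + dist (\<zeta> t) (\<zeta> (a + b))"
      using dist_triangle[of x u "\<zeta> s"] dist_triangle[of "\<zeta> s" u "\<zeta> t"] xu by (simp add: ends)
    then show "t - s \<le> dist (\<zeta> s) (\<zeta> t)" using upper[of 0 s] upper[of t "a + b"] st by linarith
  qed
  have "dist (\<zeta> s) (\<zeta> t) = \<bar>t - s\<bar> / (a + b - 0) * dist (\<zeta> 0) (\<zeta> (a + b))" if "s \<in> {0..a + b}" "t \<in> {0..a + b}" for s t
  proof -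
    have "dist (\<zeta> s) (\<zeta> t) = \<bar>t - s\<bar>"
    proof (cases "s \<le> t")
      case True
      then show ?thesis using exact[of s t] that by simp
    next
      case False
      then show ?thesis using exact[of t s] that by (simp add: dist_commute)
    qed
    then show ?thesis using a b xu ends by simp
  qed
  moreover have "(\<lambda>t. if t \<le> a then \<alpha> t else \<beta> (t - a)) = \<zeta>" by (simp add: fun_eq_iff \<zeta>_def)
  moreover have "0 < a + b" using a b by simp
  ultimately show ?thesis unfolding geodesic_on_def by blast
qed

text \<open>Prolonging one and the same geodesic from \<open>x\<close> to \<open>w\<close> towards
  \<open>u\<close> and towards \<open>y\<close> gives two geodesics that agree on the initial
  interval of length \<open>a\<close>, hence also at their ends.\<close>

lemma geodesic_extension_unique:
  fixes x w u y :: "'a::polish_space"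
  assumes proper: "\<And>(x::'a) r. compact (cball x r)" and len: "length_space TYPE('a)" and nb: "non_branching TYPE('a)"
    and a: "dist x w = a" "a > 0" and u: "dist w u = b" "dist x u = a + b" and y: "dist w y = b" "dist x y = a + b"
  shows "u = y"
proof (cases "b = 0")
  case True
  then show ?thesis using u(1) y(1) by simp
next
  case False
  then have b: "b > 0" using u(1) zero_le_dist[of w u] by linarith
  obtain G :: "real \<Rightarrow> 'a \<times> 'a \<Rightarrow> 'a" where "\<forall>t\<in>{0..1}. G t \<in> borel_measurable borel"
    and G: "G 0 = fst" "G 1 = snd"
    "\<forall>s\<in>{0..1}. \<forall>t\<in>{0..1}. \<forall>z. dist (G s z) (G t z) = \<bar>s - t\<bar> * dist (fst z) (snd z)"
    by (rule geodesic_selection[OF proper len])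
  have iso: "dist (G (s / c) (v, v')) (G (t / c) (v, v')) = \<bar>s - t\<bar>"
    if "s \<in> {0..c}" "t \<in> {0..c}" "dist v v' = c" "c > 0" for s t c v v'
    using that by (subst G(3)[rule_format]) (auto simp flip: diff_divide_distrib)
  define \<zeta> where "\<zeta> v t = (if t \<le> a then G (t / a) (x, w) else G ((t - a) / b) (w, v))" for v t
  have geo: "geodesic_on (\<zeta> v) 0 (a + b)" if "dist w v = b" "dist x v = a + b" for v
    unfolding \<zeta>_def
    by (rule geodesic_concat[where \<alpha> = "\<lambda>t. G (t / a) (x, w)" and \<beta> = "\<lambda>t. G (t / b) (w, v)", OF a(2) b that(2) iso[OF _ _ a] _ _ iso[OF _ _ that(1) b]])
       (use a b in \<open>auto simp: G\<close>)
  have eq: "\<forall>t\<in>{0..a + b}. \<zeta> u t = \<zeta> y t"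
    using nb[unfolded non_branching_def, rule_format, of "\<zeta> u" 0 "a + b" "\<zeta> y" 0 a] geo[OF u] geo[OF y] a b
    by (auto simp: \<zeta>_def)
  have "\<zeta> v (a + b) = v" for v using a b by (simp add: \<zeta>_def G)
  then show ?thesis using bspec[OF eq, of "a + b"] a b by simp
qed

section \<open>Geodesics in Wasserstein space\<close>

text \<open>An optimal plan is pushed forward along the selected geodesics. This bounds the
  distances from above; the total length makes the bounds exact.\<close>

lemma Tgeod_exists:
  fixes \<alpha> \<beta> :: "'a::polish_space measure"
  assumes proper: "\<And>(x::'a) r. compact (cball x r)" and len: "length_space TYPE('a)" and p: "p > 1"
    and \<alpha>: "\<alpha> \<in> Pp p" and \<beta>: "\<beta> \<in> Pp p" and pos: "Wp p \<alpha> \<beta> > 0"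
  obtains c where "c \<in> Tgeod p \<alpha> \<beta>"
proof -
  have p0: "p > 0" using p by simp
  define L where "L = Wp p \<alpha> \<beta>"
  have L: "L > 0" using pos by (simp add: L_def)
  obtain \<pi> where \<pi>: "coupled \<pi> \<alpha> \<beta>"
    "(\<integral>\<^sup>+z. ennreal (dist (fst z) (snd z) powr p) \<partial>\<pi>) = ennreal (L powr p)"
    using optimal_coupling[OF \<alpha> \<beta> p0] unfolding L_def .
  have P: "prob_space \<pi>" and ends: "distr \<pi> borel fst = \<alpha>" "distr \<pi> borel snd = \<beta>"
    using \<pi>(1) by (simp_all add: coupled_def)
  note [measurable] = coupled_measurable[OF \<pi>(1)]
  obtain G :: "real \<Rightarrow> 'a \<times> 'a \<Rightarrow> 'a" where G_meas: "\<forall>t\<in>{0..1}. G t \<in> borel_measurable borel"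
    and G01: "G 0 = fst" "G 1 = snd"
    and G: "\<forall>s\<in>{0..1}. \<forall>t\<in>{0..1}. \<forall>z. dist (G s z) (G t z) = \<bar>s - t\<bar> * dist (fst z) (snd z)"
    by (rule geodesic_selection[OF proper len])
  have m: "G (t / L) \<in> borel_measurable \<pi>" if "0 \<le> t" "t \<le> L" for t
    unfolding measurable_cong_sets[OF coupled_sets_borel[OF \<pi>(1)] refl]
    using bspec[OF G_meas, of "t / L"] that L by simp
  define c where "c t = distr \<pi> borel (G (t / L))" for t
  have c_ends: "c 0 = \<alpha>" "c L = \<beta>" using L by (simp_all add: c_def ends G01)
  have cost: "(\<integral>\<^sup>+z. ennreal (dist (G (s / L) z) (G (t / L) z) powr p) \<partial>\<pi>) = ennreal (\<bar>s - t\<bar> powr p)"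
    if "0 \<le> s" "s \<le> L" "0 \<le> t" "t \<le> L" for s t
  proof -
    have "dist (G (s / L) z) (G (t / L) z) = \<bar>s - t\<bar> / L * dist (fst z) (snd z)" for z
      using that L by (subst G[rule_format]) (auto simp flip: diff_divide_distrib)
    then have "(\<integral>\<^sup>+z. ennreal (dist (G (s / L) z) (G (t / L) z) powr p) \<partial>\<pi>)
      = (\<integral>\<^sup>+z. ennreal ((\<bar>s - t\<bar> / L) powr p) * ennreal (dist (fst z) (snd z) powr p) \<partial>\<pi>)"
      using L by (simp only: powr_mult) (simp add: ennreal_mult)
    also have "\<dots> = ennreal ((\<bar>s - t\<bar> / L) powr p) * ennreal (L powr p)"
      by (subst nn_integral_cmult) (simp_all add: \<pi>(2))
    also have "\<dots> = ennreal (\<bar>s - t\<bar> powr p)"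
      using L by (simp add: powr_divide flip: ennreal_mult)
    finally show ?thesis .
  qed
  have Pp: "c t \<in> Pp p" if t: "0 \<le> t" "t \<le> L" for t
  proof -
    have "c 0 \<in> Pp p" using \<alpha> c_ends by simp
    then show ?thesis unfolding c_def
      by (rule Pp_of_joint[OF P m m, rotated 4]) (use t L p cost[of 0 t] in auto)
  qed
  have upper: "Wp p (c s) (c t) \<le> \<bar>s - t\<bar>" if "0 \<le> s" "s \<le> L" "0 \<le> t" "t \<le> L" for s t
    unfolding c_def by (rule Wp_le_joint[OF P m m p0]) (use that cost in auto)
  have exact: "Wp p (c s) (c t) = t - s" if st: "0 \<le> s" "s \<le> t" "t \<le> L" for s t
  proof -
    have "Wp p (c 0) (c L) = L" unfolding c_ends by (simp add: L_def)
    moreover have "Wp p (c 0) (c L) \<le> Wp p (c 0) (c s) + Wp p (c s) (c L)"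
      by (rule Wp_triangle) (use Pp st L p in auto)
    moreover have "Wp p (c s) (c L) \<le> Wp p (c s) (c t) + Wp p (c t) (c L)"
      by (rule Wp_triangle) (use Pp st L p in auto)
    ultimately show ?thesis using upper[of 0 s] upper[of t L] upper[of s t] st by linarith
  qed
  have "Wp p (c s) (c t) = \<bar>s - t\<bar>" if "0 \<le> s" "s \<le> L" "0 \<le> t" "t \<le> L" for s t
  proof (cases "s \<le> t")
    case True
    then show ?thesis using exact[of s t] that by simp
  next
    case False
    then show ?thesis using exact[of t s] that Wp_commute[OF Pp Pp p0, of s t] by simp
  qed
  then have "c \<in> Tgeod p \<alpha> \<beta>" unfolding Tgeod_def L_def[symmetric] using Pp c_ends by auto
  then show thesis using that by blast
qed

text \<open>The middle point occurs twice, as \<open>W\<close> and \<open>W'\<close>, because gluing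
  yields two copies that agree only almost everywhere. The two conclusions control the dividing
  ratio and the defect in the triangle inequality. The \<delta> is independent of the probability
  space and of the random points on it.\<close>

lemma near_geodesic:
  fixes p a b \<kappa> :: real
  assumes p: "p > 1" and a: "a > 0" and b: "b > 0" and \<kappa>: "\<kappa> > 0"
  obtains \<delta> where "\<delta> > 0" "\<And>(K :: 'w measure) (X :: 'w \<Rightarrow> 'a::polish_space) W W' Y. prob_space K \<Longrightarrow>
    X \<in> borel_measurable K \<Longrightarrow> W \<in> borel_measurable K \<Longrightarrow> W' \<in> borel_measurable K \<Longrightarrow> Y \<in> borel_measurable K \<Longrightarrow>
    AE w in K. W w = W' w \<Longrightarrow>
    (\<integral>\<^sup>+w. ennreal (dist (X w) (W w) powr p) \<partial>K) \<le> ennreal (a powr p) \<Longrightarrow>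
    (\<integral>\<^sup>+w. ennreal (dist (W' w) (Y w) powr p) \<partial>K) \<le> ennreal (b powr p) \<Longrightarrow>
    (a + b) powr p - \<delta> \<le> Wp p (distr K borel X) (distr K borel Y) powr p \<Longrightarrow>
    (\<integral>\<^sup>+w. ennreal (\<bar>dist (X w) (W w) / a - dist (W' w) (Y w) / b\<bar> powr p) \<partial>K) \<le> ennreal \<kappa> \<and>
    (\<integral>\<^sup>+w. ennreal (max 0 (dist (X w) (W w) + dist (W' w) (Y w) - dist (X w) (Y w)) powr p) \<partial>K) \<le> ennreal \<kappa>"
proof (rule minkowski_near_equality[OF p a b \<kappa>, where ?'w = 'w])
  fix \<delta>1 assume \<delta>1: "\<delta>1 > 0" and close: "\<And>(K :: 'w measure) f g. f \<in> borel_measurable K \<Longrightarrow> g \<in> borel_measurable K \<Longrightarrow>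
    (\<And>w. f w \<ge> 0) \<Longrightarrow> (\<And>w. g w \<ge> 0) \<Longrightarrow>
    (\<integral>\<^sup>+w. ennreal (f w powr p) \<partial>K) \<le> ennreal (a powr p) \<Longrightarrow>
    (\<integral>\<^sup>+w. ennreal (g w powr p) \<partial>K) \<le> ennreal (b powr p) \<Longrightarrow>
    ennreal ((a + b) powr p - \<delta>1) \<le> (\<integral>\<^sup>+w. ennreal ((f w + g w) powr p) \<partial>K) \<Longrightarrow>
    (\<integral>\<^sup>+w. ennreal (\<bar>f w / a - g w / b\<bar> powr p) \<partial>K) \<le> ennreal \<kappa>"
  \<comment> \<open>\<delta>1 serves the ratio, \<kappa> the triangle defect, and the last entry
    keeps the subtraction in \<open>minkowski_excess\<close> nonnegative.\<close>
  define \<delta> where "\<delta> = min (min \<delta>1 \<kappa>) ((a + b) powr p)"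
  have ab: "(a + b) powr p > 0" using a b by simp
  have \<delta>: "\<delta> > 0" "\<delta> \<le> \<delta>1" "\<delta> \<le> \<kappa>" "\<delta> \<le> (a + b) powr p" using \<delta>1 \<kappa> ab by (auto simp: \<delta>_def)
  show thesis
  proof (rule that[OF \<delta>(1)])
    fix K :: "'w measure" and X W W' Y :: "'w \<Rightarrow> 'a"
    assume K: "prob_space K"
      and [measurable]: "X \<in> borel_measurable K" "W \<in> borel_measurable K" "W' \<in> borel_measurable K" "Y \<in> borel_measurable K"
      and W: "AE w in K. W w = W' w"
      and fa: "(\<integral>\<^sup>+w. ennreal (dist (X w) (W w) powr p) \<partial>K) \<le> ennreal (a powr p)"
      and gb: "(\<integral>\<^sup>+w. ennreal (dist (W' w) (Y w) powr p) \<partial>K) \<le> ennreal (b powr p)"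
      and near: "(a + b) powr p - \<delta> \<le> Wp p (distr K borel X) (distr K borel Y) powr p"
    define e where "e w = max 0 (dist (X w) (W w) + dist (W' w) (Y w) - dist (X w) (Y w))" for w
    have [measurable]: "e \<in> borel_measurable K" unfolding e_def by measurable
    have lower: "ennreal ((a + b) powr p - \<delta>) \<le> (\<integral>\<^sup>+w. ennreal (dist (X w) (Y w) powr p) \<partial>K)"
      using order_trans[OF ennreal_leI[OF near] Wp_powr_le_joint[OF K]] p by simp
    have XY: "AE w in K. dist (X w) (Y w) = dist (X w) (W w) + dist (W' w) (Y w) - e w"
      using W by eventually_elim (use dist_triangle[of "X _" "Y _" "W' _"] in \<open>auto simp: e_def max_def\<close>)
    have "(\<integral>\<^sup>+w. ennreal (dist (X w) (Y w) powr p) \<partial>K) \<le> (\<integral>\<^sup>+w. ennreal ((dist (X w) (W w) + dist (W' w) (Y w)) powr p) \<partial>K)"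
    proof (rule nn_integral_mono_AE, use W in eventually_elim)
      case (elim w)
      show ?case using elim p dist_triangle[of "X w" "Y w" "W' w"] by (intro ennreal_leI powr_mono2) auto
    qed
    with lower \<delta>(2) have "ennreal ((a + b) powr p - \<delta>1) \<le> (\<integral>\<^sup>+w. ennreal ((dist (X w) (W w) + dist (W' w) (Y w)) powr p) \<partial>K)"
      by (meson diff_left_mono ennreal_leI order_trans)
    then have 1: "(\<integral>\<^sup>+w. ennreal (\<bar>dist (X w) (W w) / a - dist (W' w) (Y w) / b\<bar> powr p) \<partial>K) \<le> ennreal \<kappa>"
      by (intro close fa gb) auto
    have "(\<integral>\<^sup>+w. ennreal (dist (X w) (Y w) powr p) \<partial>K) = (\<integral>\<^sup>+w. ennreal ((dist (X w) (W w) + dist (W' w) (Y w) - e w) powr p) \<partial>K)"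
      by (rule nn_integral_cong_AE) (use XY in eventually_elim, simp)
    with lower have "(\<integral>\<^sup>+w. ennreal (e w powr p) \<partial>K) \<le> ennreal \<delta>"
      by (intro minkowski_excess[OF p a b _ \<delta>(4) _ _ _ _ _ _ _ fa gb]) (use \<delta>(1) in \<open>auto simp: e_def\<close>)
    also have "\<dots> \<le> ennreal \<kappa>" using \<delta>(3) by (rule ennreal_leI)
    finally show "(\<integral>\<^sup>+w. ennreal (\<bar>dist (X w) (W w) / a - dist (W' w) (Y w) / b\<bar> powr p) \<partial>K) \<le> ennreal \<kappa> \<and>
      (\<integral>\<^sup>+w. ennreal (max 0 (dist (X w) (W w) + dist (W' w) (Y w) - dist (X w) (Y w)) powr p) \<partial>K) \<le> ennreal \<kappa>"
      using 1 by (simp add: e_def)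
  qed
qed

lemma nn_integral_le_all_pos_imp_AE_zero:
  assumes [measurable]: "f \<in> borel_measurable K" and f: "\<And>w. f w \<ge> 0"
    and le: "\<And>\<kappa>. \<kappa> > 0 \<Longrightarrow> (\<integral>\<^sup>+w. ennreal (f w powr p) \<partial>K) \<le> ennreal \<kappa>"
  shows "AE w in K. f w = 0"
proof -
  have "(\<integral>\<^sup>+w. ennreal (f w powr p) \<partial>K) \<le> 0"
    by (rule ennreal_le_epsilon) (use le in simp)
  then have "(\<integral>\<^sup>+w. ennreal (f w powr p) \<partial>K) = 0" by simp
  then have "AE w in K. ennreal (f w powr p) = 0" by (subst (asm) nn_integral_0_iff_AE) auto
  then show ?thesis by eventually_elim (simp add: ennreal_eq_0_iff)
qed

text \<open>Counterexamples with tolerances tending to 0 stay in a compact ball about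
  \<open>w\<close>. A limit of them extends the geodesic exactly but differs from \<open>u\<close>.
  The tolerance obtained depends on \<open>x\<close>, \<open>w\<close> and \<open>u\<close>, which
  forces exceptional sets in the integrated version.\<close>

lemma geodesic_extension_stable:
  fixes x w u :: "'a::polish_space"
  assumes proper: "\<And>(x::'a) r. compact (cball x r)" and len: "length_space TYPE('a)" and nb: "non_branching TYPE('a)"
    and u: "dist w u = m * dist x w" "dist x u = dist x w + dist w u" and \<eta>: "\<eta> > 0"
  shows "\<exists>k::nat. \<forall>y. \<bar>dist w y - m * dist x w\<bar> \<le> inverse (Suc k) \<longrightarrow>
    dist x w + dist w y - dist x y \<le> inverse (Suc k) \<longrightarrow> dist y u < \<eta>"
proof (rule ccontr)
  assume "\<not> ?thesis"
  then have "\<exists>y. \<bar>dist w y - m * dist x w\<bar> \<le> inverse (Suc k) \<and>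
    dist x w + dist w y - dist x y \<le> inverse (Suc k) \<and> \<eta> \<le> dist y u" for k :: nat
    by (meson not_le)
  then obtain y where y: "\<And>k::nat. \<bar>dist w (y k) - m * dist x w\<bar> \<le> inverse (Suc k)"
    "\<And>k::nat. dist x w + dist w (y k) - dist x (y k) \<le> inverse (Suc k)" "\<And>k. \<eta> \<le> dist (y k) u" by metis
  have "y k \<in> cball w (m * dist x w + 1)" for k
    using y(1)[of k] le_imp_inverse_le[of 1 "real (Suc k)"] by (simp add: abs_le_iff)
  then obtain l r where l: "strict_mono (r :: nat \<Rightarrow> nat)" "(y \<circ> r) \<longlonglongrightarrow> l"
    using proper[of w "m * dist x w + 1"] unfolding compact_def by metis
  have inv0: "(\<lambda>k. inverse (real (Suc (r k)))) \<longlonglongrightarrow> 0"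
    using LIMSEQ_subseq_LIMSEQ[OF LIMSEQ_inverse_real_of_nat l(1)] by (simp add: comp_def)
  have l': "(\<lambda>k. y (r k)) \<longlonglongrightarrow> l" using l(2) by (simp add: comp_def)
  have "\<bar>dist w l - m * dist x w\<bar> \<le> 0"
    by (rule LIMSEQ_le[where X = "\<lambda>k. \<bar>dist w (y (r k)) - m * dist x w\<bar>", OF _ inv0])
       (use y(1) in \<open>auto intro!: tendsto_intros l'\<close>)
  then have d1: "dist w l = m * dist x w" by simp
  have "dist x w + dist w l - dist x l \<le> 0"
    by (rule LIMSEQ_le[where X = "\<lambda>k. dist x w + dist w (y (r k)) - dist x (y (r k))", OF _ inv0])
       (use y(2) in \<open>auto intro!: tendsto_intros l'\<close>)
  then have d2: "dist x l = dist x w + dist w l" using dist_triangle[of x l w] by simp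
  have d3: "\<eta> \<le> dist l u"
    by (rule LIMSEQ_le_const[where X = "\<lambda>k. dist (y (r k)) u"]) (use y(3) in \<open>auto intro!: tendsto_intros l'\<close>)
  \<comment> \<open>For \<open>x = w\<close> there is no initial piece and non-branching gives
    nothing, but then the prescribed distance \<open>m * dist x w\<close> is 0 and both points equal
    \<open>w\<close>.\<close>
  have "u = l"
  proof (cases "dist x w = 0")
    case True
    then show ?thesis using u(1) d1 by simp
  next
    case False
    then have "dist x w > 0" by simp
    from geodesic_extension_unique[OF proper len nb refl this refl u(2)] show ?thesis using d1 d2 u(1) by simp
  qed
  then show False using d3 \<eta> by simp
qed

section \<open>Almost extending geodesics\<close>

text \<open>Three optimal plans are glued at \<open>\<beta>\<close>. Near-equality in Minkowski's inequality forces the points to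
  lie almost on geodesics, so outside a set of small mass non-branching and compactness of balls bring
  the \<open>\<gamma>\<close>-point close to the \<open>\<omega>\<close>-point, while on that set the p-th moments are controlled by those of the
  fixed plan between \<open>\<alpha>\<close> and \<open>\<beta>\<close>.\<close>

lemma Wp_extension_stable:
  fixes \<alpha> \<beta> \<omega> :: "'a::polish_space measure"
  assumes proper: "\<And>(x::'a) r. compact (cball x r)" and len: "length_space TYPE('a)" and nb: "non_branching TYPE('a)"
    and p: "p > 1" and \<alpha>: "\<alpha> \<in> Pp p" and \<beta>: "\<beta> \<in> Pp p" and \<omega>: "\<omega> \<in> Pp p"
    and a: "Wp p \<alpha> \<beta> = a" "a > 0" and b: "Wp p \<beta> \<omega> = b" "b > 0" and ab: "Wp p \<alpha> \<omega> = a + b" and \<eta>: "\<eta> > 0"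
  shows "\<exists>\<delta>>0. \<forall>\<gamma>\<in>Pp p. Wp p \<beta> \<gamma> = b \<longrightarrow> (a + b) powr p - \<delta> \<le> Wp p \<alpha> \<gamma> powr p \<longrightarrow> Wp p \<gamma> \<omega> \<le> \<eta>"
proof -
  have p0: "p > 0" using p by simp
  obtain \<pi>1 where \<pi>1: "coupled \<pi>1 \<alpha> \<beta>"
    "(\<integral>\<^sup>+z. ennreal (dist (fst z) (snd z) powr p) \<partial>\<pi>1) = ennreal (a powr p)"
    using optimal_coupling[OF \<alpha> \<beta> p0] unfolding a .
  obtain \<pi>2 where \<pi>2: "coupled \<pi>2 \<beta> \<omega>"
    "(\<integral>\<^sup>+z. ennreal (dist (fst z) (snd z) powr p) \<partial>\<pi>2) = ennreal (b powr p)"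
    using optimal_coupling[OF \<beta> \<omega> p0] unfolding b .
  obtain \<Lambda> where \<Lambda>: "coupled \<Lambda> \<pi>1 \<pi>2" "AE z in \<Lambda>. snd (fst z) = fst (snd z)"
    using glue_couplings[OF \<pi>1(1) \<pi>2(1)] .
  note sets_\<Lambda> = coupled_sets_borel[OF \<Lambda>(1)]
  note [measurable_cong] = sets_\<Lambda>
  have P\<Lambda>: "prob_space \<Lambda>" and d: "\<pi>1 = distr \<Lambda> borel fst" "\<pi>2 = distr \<Lambda> borel snd"
    using \<Lambda>(1) by (simp_all add: coupled_def)
  have marg: "distr \<Lambda> borel (\<lambda>z. fst (fst z)) = \<alpha>" "distr \<Lambda> borel (\<lambda>z. snd (fst z)) = \<beta>"
      "distr \<Lambda> borel (\<lambda>z. snd (snd z)) = \<omega>"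
    using \<pi>1(1) \<pi>2(1) unfolding coupled_def d by (auto simp: distr_distr comp_def)
  have c1: "(\<integral>\<^sup>+z. ennreal (dist (fst (fst z)) (snd (fst z)) powr p) \<partial>\<Lambda>) = ennreal (a powr p)"
    using \<pi>1(2) unfolding d by (simp add: nn_integral_distr)
  have c2: "(\<integral>\<^sup>+z. ennreal (dist (fst (snd z)) (snd (snd z)) powr p) \<partial>\<Lambda>) = ennreal (b powr p)"
    using \<pi>2(2) unfolding d by (simp add: nn_integral_distr)
  \<comment> \<open>For the fixed plan the distances add up exactly, so every \<kappa> is allowed,
    and the geodesic relations hold almost everywhere without error.\<close>
  have both: "(\<integral>\<^sup>+z. ennreal (\<bar>dist (fst (fst z)) (snd (fst z)) / a - dist (fst (snd z)) (snd (snd z)) / b\<bar> powr p) \<partial>\<Lambda>) \<le> ennreal \<kappa> \<and>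
    (\<integral>\<^sup>+z. ennreal (max 0 (dist (fst (fst z)) (snd (fst z)) + dist (fst (snd z)) (snd (snd z)) - dist (fst (fst z)) (snd (snd z))) powr p) \<partial>\<Lambda>) \<le> ennreal \<kappa>"
    if \<kappa>: "\<kappa> > 0" for \<kappa>
  proof (rule near_geodesic[OF p a(2) b(2) \<kappa>, where ?'w = "('a \<times> 'a) \<times> ('a \<times> 'a)" and ?'a = 'a], goal_cases)
    case (1 \<delta>)
    show ?case by (rule 1(2)[OF P\<Lambda>]) (use \<Lambda>(2) c1 c2 marg ab 1(1) in auto)
  qed
  define m where "m = b / a"
  have m: "m > 0" using a b by (simp add: m_def)
  have "AE z in \<Lambda>. \<bar>dist (fst (fst z)) (snd (fst z)) / a - dist (fst (snd z)) (snd (snd z)) / b\<bar> = 0"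
    by (rule nn_integral_le_all_pos_imp_AE_zero[where p = p]) (use both in auto)
  moreover have "AE z in \<Lambda>. max 0 (dist (fst (fst z)) (snd (fst z)) + dist (fst (snd z)) (snd (snd z)) - dist (fst (fst z)) (snd (snd z))) = 0"
    by (rule nn_integral_le_all_pos_imp_AE_zero[where p = p]) (use both in auto)
  ultimately have exact: "AE z in \<Lambda>. dist (snd (fst z)) (snd (snd z)) = m * dist (fst (fst z)) (snd (fst z)) \<and>
      dist (fst (fst z)) (snd (snd z)) = dist (fst (fst z)) (snd (fst z)) + dist (snd (fst z)) (snd (snd z))"
    using \<Lambda>(2)
  proof eventually_elim
    case (elim z)
    have "dist (fst (snd z)) (snd (snd z)) = m * dist (fst (fst z)) (snd (fst z))"
      using elim(1) a b by (simp add: m_def field_simps)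
    moreover have "dist (fst (fst z)) (snd (fst z)) + dist (fst (snd z)) (snd (snd z)) \<le> dist (fst (fst z)) (snd (snd z))"
      using elim(2) by (simp add: max_def split: if_splits)
    ultimately show ?case using elim(3) dist_triangle[of "fst (fst z)" "snd (snd z)" "snd (fst z)"] by simp
  qed
  \<comment> \<open>The target \<open>\<eta> powr p\<close> is split into thirds: for pairs that are
    already close, for the exceptional set, and for the errors \<open>r\<close> and
    \<open>e\<close>.\<close>
  define \<eta>1 where "\<eta>1 = (\<eta> powr p / 3) powr (1 / p)"
  have \<eta>1: "\<eta>1 > 0" "\<eta>1 powr p = \<eta> powr p / 3" using \<eta> p by (simp_all add: \<eta>1_def powr_powr)
  \<comment> \<open>Configurations where tolerance 1/(k+1) is too coarse: some almost extension
    stays at distance \<eta>1 from the third point. By stability almost every configuration leaves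
    these sets eventually.\<close>
  define B where "B k = {z::('a \<times> 'a) \<times> ('a \<times> 'a). \<exists>y. \<bar>dist (snd (fst z)) y - m * dist (fst (fst z)) (snd (fst z))\<bar> \<le> inverse (real (Suc k)) \<and>
     dist (fst (fst z)) (snd (fst z)) + dist (snd (fst z)) y - dist (fst (fst z)) y \<le> inverse (real (Suc k)) \<and> \<eta>1 \<le> dist y (snd (snd z))}" for k
  have B_closed: "closed (B k)" for k
  proof -
    let ?C = "{(z, y::'a). \<bar>dist (snd (fst z)) y - m * dist (fst (fst z)) (snd (fst z))\<bar> \<le> inverse (real (Suc k)) \<and>
      dist (fst (fst z)) (snd (fst z)) + dist (snd (fst z)) y - dist (fst (fst z)) y \<le> inverse (real (Suc k)) \<and> \<eta>1 \<le> dist y (snd (snd (z::('a \<times> 'a) \<times> ('a \<times> 'a))))}"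
    have "closed ?C" unfolding split_beta mem_Collect_eq
      by (intro closed_Collect_conj closed_Collect_le continuous_intros)
    moreover have "dist (snd (fst z)) y \<le> m * dist (fst (fst z)) (snd (fst z)) + inverse (real (Suc k))" if "(z, y) \<in> ?C" for z y
      using that by (auto simp: abs_le_iff)
    ultimately have "closed {z. \<exists>y. (z, y) \<in> ?C}"
      by (intro closed_projection_proper[OF proper, of ?C "\<lambda>z. snd (fst z)"
            "\<lambda>z. m * dist (fst (fst z)) (snd (fst z)) + inverse (real (Suc k))"] continuous_intros) auto
    then show ?thesis by (simp add: B_def)
  qed
  \<comment> \<open>Long first segments are exceptional too, so that off \<open>S k\<close> the
    distance from \<open>x\<close> to \<open>w\<close> is at most \<open>k\<close>,
    uniformly.\<close>
  define S where "S k = B k \<union> {z. real k < dist (fst (fst z)) (snd (fst z))}" for k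
  have [measurable]: "S k \<in> sets borel" for k
  proof -
    have "open {z :: ('a \<times> 'a) \<times> ('a \<times> 'a). real k < dist (fst (fst z)) (snd (fst z))}"
      by (intro open_Collect_less continuous_intros)
    then show ?thesis unfolding S_def using B_closed by (intro sets.Un) auto
  qed
  have S_lim: "AE z in \<Lambda>. (\<lambda>k. ennreal (dist (fst (fst z)) (snd (fst z)) powr p) * indicator (S k) z) \<longlonglongrightarrow> 0"
    using exact
  proof eventually_elim
    case (elim z)
    obtain k0 :: nat where k0: "\<And>y. \<bar>dist (snd (fst z)) y - m * dist (fst (fst z)) (snd (fst z))\<bar> \<le> inverse (Suc k0) \<Longrightarrow>
        dist (fst (fst z)) (snd (fst z)) + dist (snd (fst z)) y - dist (fst (fst z)) y \<le> inverse (Suc k0) \<Longrightarrow> dist y (snd (snd z)) < \<eta>1"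
      using geodesic_extension_stable[OF proper len nb conjunct1[OF elim] conjunct2[OF elim] \<eta>1(1)] by blast
    obtain k1 :: nat where k1: "dist (fst (fst z)) (snd (fst z)) \<le> real k1" using real_arch_simple by blast
    have "z \<notin> S k" if k: "k \<ge> max k0 k1" for k
    proof -
      have inv: "inverse (real (Suc k)) \<le> inverse (real (Suc k0))" using k by (intro le_imp_inverse_le) auto
      have "z \<notin> B k"
      proof
        assume "z \<in> B k"
        then obtain y where y: "\<bar>dist (snd (fst z)) y - m * dist (fst (fst z)) (snd (fst z))\<bar> \<le> inverse (real (Suc k))"
          "dist (fst (fst z)) (snd (fst z)) + dist (snd (fst z)) y - dist (fst (fst z)) y \<le> inverse (real (Suc k))"
          "\<eta>1 \<le> dist y (snd (snd z))" unfolding B_def by blast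
        from k0[OF order_trans[OF y(1) inv] order_trans[OF y(2) inv]] y(3) show False by simp
      qed
      then show ?thesis using k k1 by (simp add: S_def)
    qed
    then have "\<forall>\<^sub>F k in sequentially. ennreal (dist (fst (fst z)) (snd (fst z)) powr p) * indicator (S k) z = 0"
      by (auto simp: eventually_sequentially intro!: exI[of _ "max k0 k1"])
    then show ?case by (rule tendsto_eventually)
  qed
  have "(\<lambda>k. \<integral>\<^sup>+z. ennreal (dist (fst (fst z)) (snd (fst z)) powr p) * indicator (S k) z \<partial>\<Lambda>) \<longlonglongrightarrow> (\<integral>\<^sup>+z. 0 \<partial>\<Lambda>)"
    by (rule nn_integral_dominated_convergence[where w = "\<lambda>z. ennreal (dist (fst (fst z)) (snd (fst z)) powr p)"])
       (use S_lim c1 in \<open>auto simp: indicator_def\<close>)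
  then have S_int: "(\<lambda>k. \<integral>\<^sup>+z. ennreal (dist (fst (fst z)) (snd (fst z)) powr p) * indicator (S k) z \<partial>\<Lambda>) \<longlonglongrightarrow> 0" by simp
  \<comment> \<open>The factor of \<open>dist x w powr p\<close> when
    \<open>2 * m * dist x w + b * r\<close>, a bound for the distance to the third point, is raised
    to the power \<open>p\<close> by \<open>powr_add_le\<close>.\<close>
  define A where "A = 2 powr p * (2 * m) powr p"
  have A: "A > 0" using m by (simp add: A_def)
  have "0 < ennreal (\<eta> powr p / (3 * A))" using \<eta> A by simp
  from order_tendstoD(2)[OF S_int this] obtain k where
    k: "(\<integral>\<^sup>+z. ennreal (dist (fst (fst z)) (snd (fst z)) powr p) * indicator (S k) z \<partial>\<Lambda>) \<le> ennreal (\<eta> powr p / (3 * A))"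
    by (meson eventually_sequentially less_imp_le order_refl)
  \<comment> \<open>The first summand covers far points off \<open>S k\<close>, where some tolerance
    is violated; the second covers the contribution of \<open>b * r\<close> everywhere.\<close>
  define C where "C = A * real k powr p * real (Suc k) powr p * (b powr p + 1) + 2 powr p * b powr p"
  have C: "C > 0" unfolding C_def using A b by (intro add_nonneg_pos mult_nonneg_nonneg) auto
  \<comment> \<open>Two error integrals, each at most \<kappa> and weighted by \<open>C\<close>,
    together give a third of \<open>\<eta> powr p\<close>.\<close>
  define \<kappa> where "\<kappa> = \<eta> powr p / (6 * C)"
  have \<kappa>: "\<kappa> > 0" using \<eta> C by (simp add: \<kappa>_def)
  \<comment> \<open>Three cases: \<open>y\<close> is close to \<open>u\<close>; or the configuration
    is in \<open>S k\<close> and the crude bound is charged to the indicator; or it is charged to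
    the errors. The point \<open>w'\<close>, the second copy of \<open>w\<close> in the plan, is
    arbitrary here because \<open>S k\<close> ignores it.\<close>
  have pointwise: "dist y u powr p \<le> \<eta>1 powr p + A * (dist x w powr p * indicator (S k) ((x, w), (w', u))) + C * (r powr p + e powr p)"
    if u: "dist w u = m * dist x w" and r: "r = \<bar>dist x w / a - dist w y / b\<bar>"
      and e: "e = max 0 (dist x w + dist w y - dist x y)" for x w w' u y :: 'a and r e :: real
  proof (cases "dist y u < \<eta>1")
    case True
    then have "dist y u powr p \<le> \<eta>1 powr p" using p by (intro powr_mono2) auto
    then show ?thesis using A C by (simp add: add_increasing2)
  next
    case False
    have br: "b * r = \<bar>dist w y - m * dist x w\<bar>"
    proof -
      have "b * r = \<bar>b * (dist x w / a - dist w y / b)\<bar>" unfolding r using b by (simp add: abs_mult)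
      also have "b * (dist x w / a - dist w y / b) = m * dist x w - dist w y" using b by (simp add: m_def field_simps)
      finally show ?thesis by (simp add: abs_minus_commute)
    qed
    have re: "r \<ge> 0" "e \<ge> 0" using r e by auto
    have "dist y u \<le> 2 * m * dist x w + b * r"
      using dist_triangle[of y u w] u br by (simp add: dist_commute)
    then have "dist y u powr p \<le> (2 * m * dist x w + b * r) powr p" using p by (intro powr_mono2) auto
    also have "\<dots> \<le> 2 powr p * ((2 * m * dist x w) powr p + (b * r) powr p)"
      using m b re p by (intro powr_add_le) auto
    also have "\<dots> = A * dist x w powr p + 2 powr p * b powr p * r powr p"
      using m b re by (simp add: A_def powr_mult algebra_simps)
    finally have bound: "dist y u powr p \<le> A * dist x w powr p + 2 powr p * b powr p * r powr p" .
    have er: "2 powr p * b powr p * r powr p \<le> C * (r powr p + e powr p)"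
    proof -
      have "2 powr p * b powr p * r powr p \<le> C * r powr p"
        unfolding C_def using A by (intro mult_right_mono) auto
      also have "\<dots> \<le> C * (r powr p + e powr p)" using C by simp
      finally show ?thesis .
    qed
    show ?thesis
    proof (cases "((x, w), (w', u)) \<in> S k")
      case True
      have "0 \<le> \<eta>1 powr p" by simp
      then show ?thesis unfolding indicator_simps(1)[OF True] using bound er by linarith
    next
      case not_S: False
      then have xk: "dist x w \<le> real k" by (simp add: S_def)
      \<comment> \<open>As in Chebyshev's inequality: one error exceeds 1/(k+1), so 1 is at most a
        multiple of its p-th power, and the bounded quantity \<open>A * real k powr p\<close> may be
        multiplied by it.\<close>
      have "inverse (real (Suc k)) < b * r \<or> inverse (real (Suc k)) < e"
      proof (rule ccontr)
        assume "\<not> ?thesis"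
        then have "((x, w), (w', u)) \<in> B k" unfolding B_def using br e False by (auto intro!: exI[of _ y])
        then show False using not_S by (simp add: S_def)
      qed
      then have "1 \<le> real (Suc k) powr p * ((b * r) powr p + e powr p)"
      proof
        assume "inverse (real (Suc k)) < b * r"
        then have "1 \<le> real (Suc k) * (b * r)" by (simp add: field_simps)
        then have "1 powr p \<le> (real (Suc k) * (b * r)) powr p" using p by (intro powr_mono2) auto
        also have "\<dots> = real (Suc k) powr p * (b * r) powr p" using b re by (simp add: powr_mult)
        also have "\<dots> \<le> real (Suc k) powr p * ((b * r) powr p + e powr p)" by (intro mult_left_mono) auto
        finally show ?thesis by simp
      next
        assume "inverse (real (Suc k)) < e"
        then have "1 \<le> real (Suc k) * e" by (simp add: field_simps)
        then have "1 powr p \<le> (real (Suc k) * e) powr p" using p by (intro powr_mono2) auto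
        also have "\<dots> = real (Suc k) powr p * e powr p" using re by (simp add: powr_mult)
        also have "\<dots> \<le> real (Suc k) powr p * ((b * r) powr p + e powr p)" by (intro mult_left_mono) auto
        finally show ?thesis by simp
      qed
      also have "\<dots> \<le> real (Suc k) powr p * ((b powr p + 1) * (r powr p + e powr p))"
        using b re by (intro mult_left_mono) (auto simp: powr_mult distrib_left distrib_right)
      finally have one: "1 \<le> real (Suc k) powr p * ((b powr p + 1) * (r powr p + e powr p))" .
      have "A * dist x w powr p \<le> A * real k powr p" using xk A p by (intro mult_left_mono powr_mono2) auto
      also have "\<dots> = A * real k powr p * 1" by simp
      also have "\<dots> \<le> A * real k powr p * (real (Suc k) powr p * ((b powr p + 1) * (r powr p + e powr p)))"
        using A by (intro mult_left_mono one) auto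
      finally have "dist y u powr p \<le> A * real k powr p * (real (Suc k) powr p * ((b powr p + 1) * (r powr p + e powr p)))
        + 2 powr p * b powr p * r powr p" using bound by simp
      also have "2 powr p * b powr p * r powr p \<le> 2 powr p * b powr p * (r powr p + e powr p)"
        by (intro mult_left_mono) auto
      finally have "dist y u powr p \<le> C * (r powr p + e powr p)" by (simp add: C_def algebra_simps)
      then show ?thesis using not_S by (simp add: add_increasing)
    qed
  qed
  \<comment> \<open>The values of \<open>k\<close>, \<open>C\<close> and \<kappa>, and hence
    \<delta>, are settled before \<gamma> appears, which makes \<delta> uniform in \<gamma>.\<close>
  show ?thesis
  proof (rule near_geodesic[OF p a(2) b(2) \<kappa>, where ?'w = "(('a \<times> 'a) \<times> ('a \<times> 'a)) \<times> ('a \<times> 'a)" and ?'a = 'a], goal_cases)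
    case (1 \<delta>)
    show ?case
    proof (intro exI[of _ \<delta>] conjI ballI impI 1(1))
      fix \<gamma> assume \<gamma>: "\<gamma> \<in> Pp p" and b\<gamma>: "Wp p \<beta> \<gamma> = b" and near: "(a + b) powr p - \<delta> \<le> Wp p \<alpha> \<gamma> powr p"
      obtain \<pi>3 where \<pi>3: "coupled \<pi>3 \<beta> \<gamma>"
        "(\<integral>\<^sup>+z. ennreal (dist (fst z) (snd z) powr p) \<partial>\<pi>3) = ennreal (b powr p)"
        using optimal_coupling[OF \<beta> \<gamma> p0] unfolding b\<gamma> .
      have P3: "prob_space \<pi>3" "distr \<pi>3 borel fst = \<beta>" "distr \<pi>3 borel snd = \<gamma>"
        using \<pi>3(1) by (simp_all add: coupled_def)
      \<comment> \<open>The plan to \<gamma> is glued onto the fixed plan \<Lambda>, so its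
        exceptional set keeps the mass and moment computed for \<Lambda>.\<close>
      obtain \<Theta> where \<Theta>: "coupled \<Theta> \<Lambda> \<pi>3" "AE z in \<Theta>. snd (fst (fst z)) = fst (snd z)"
        by (rule gluing[OF P\<Lambda> sets_\<Lambda> P3(1) coupled_sets_borel[OF \<pi>3(1)], of "\<lambda>z. snd (fst z)" fst])
           (use marg P3 in auto)
      note [measurable_cong] = coupled_sets_borel[OF \<Theta>(1)]
      have P: "prob_space \<Theta>" and d': "\<Lambda> = distr \<Theta> borel fst" "\<pi>3 = distr \<Theta> borel snd"
        using \<Theta>(1) by (simp_all add: coupled_def)
      interpret prob_space \<Theta> by fact
      define X where "X z = fst (fst (fst z))" for z :: "(('a \<times> 'a) \<times> ('a \<times> 'a)) \<times> ('a \<times> 'a)"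
      define W where "W z = snd (fst (fst z))" for z :: "(('a \<times> 'a) \<times> ('a \<times> 'a)) \<times> ('a \<times> 'a)"
      define U where "U z = snd (snd (fst z))" for z :: "(('a \<times> 'a) \<times> ('a \<times> 'a)) \<times> ('a \<times> 'a)"
      define W' where "W' z = fst (snd z)" for z :: "(('a \<times> 'a) \<times> ('a \<times> 'a)) \<times> ('a \<times> 'a)"
      define Y where "Y z = snd (snd z)" for z :: "(('a \<times> 'a) \<times> ('a \<times> 'a)) \<times> ('a \<times> 'a)"
      have meas[measurable]: "X \<in> borel_measurable \<Theta>" "W \<in> borel_measurable \<Theta>" "U \<in> borel_measurable \<Theta>"
        "W' \<in> borel_measurable \<Theta>" "Y \<in> borel_measurable \<Theta>"
        unfolding X_def W_def U_def W'_def Y_def by measurable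
      have dX: "distr \<Theta> borel X = \<alpha>" and dU: "distr \<Theta> borel U = \<omega>" and dY: "distr \<Theta> borel Y = \<gamma>"
        using marg P3 unfolding d' X_def U_def Y_def by (auto simp: distr_distr comp_def)
      have WW': "AE z in \<Theta>. W z = W' z" using \<Theta>(2) by (simp add: W_def W'_def)
      have XW: "(\<integral>\<^sup>+z. ennreal (dist (X z) (W z) powr p) \<partial>\<Theta>) = ennreal (a powr p)"
        using c1 unfolding d' X_def W_def by (simp add: nn_integral_distr)
      have WY: "(\<integral>\<^sup>+z. ennreal (dist (W' z) (Y z) powr p) \<partial>\<Theta>) = ennreal (b powr p)"
        using \<pi>3(2) unfolding d' W'_def Y_def by (simp add: nn_integral_distr)
      define r where "r z = \<bar>dist (X z) (W z) / a - dist (W' z) (Y z) / b\<bar>" for z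
      define e where "e z = max 0 (dist (X z) (W z) + dist (W' z) (Y z) - dist (X z) (Y z))" for z
      have [measurable]: "r \<in> borel_measurable \<Theta>" "e \<in> borel_measurable \<Theta>" unfolding r_def e_def by measurable
      have re: "(\<integral>\<^sup>+z. ennreal (r z powr p) \<partial>\<Theta>) \<le> ennreal \<kappa>" "(\<integral>\<^sup>+z. ennreal (e z powr p) \<partial>\<Theta>) \<le> ennreal \<kappa>"
        using 1(2)[OF P meas(1,2,4,5) WW'] XW WY near unfolding dX dY r_def e_def by auto
      have "AE z in distr \<Theta> borel fst. dist (snd (fst z)) (snd (snd z)) = m * dist (fst (fst z)) (snd (fst z))"
        using exact unfolding d'(1) by eventually_elim blast
      then have exact': "AE z in \<Theta>. dist (W z) (U z) = m * dist (X z) (W z)"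
        unfolding W_def U_def X_def by (subst (asm) AE_distr_iff) auto
      have S_\<Theta>: "(\<integral>\<^sup>+z. ennreal (dist (X z) (W z) powr p) * indicator (S k) (fst z) \<partial>\<Theta>) \<le> ennreal (\<eta> powr p / (3 * A))"
        using k unfolding d' X_def W_def by (simp add: nn_integral_distr)
      have "(\<integral>\<^sup>+z. ennreal (dist (Y z) (U z) powr p) \<partial>\<Theta>)
        \<le> (\<integral>\<^sup>+z. ennreal (\<eta>1 powr p) + ennreal A * (ennreal (dist (X z) (W z) powr p) * indicator (S k) (fst z))
            + ennreal C * (ennreal (r z powr p) + ennreal (e z powr p)) \<partial>\<Theta>)"
      proof (rule nn_integral_mono_AE, use exact' WW' in eventually_elim)
        case (elim z)
        have "fst z = ((X z, W z), (fst (snd (fst z)), U z))" by (simp add: X_def W_def U_def)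
        then have "dist (Y z) (U z) powr p \<le> \<eta>1 powr p + A * (dist (X z) (W z) powr p * indicator (S k) (fst z)) + C * (r z powr p + e z powr p)"
          using pointwise[OF elim(1), of "r z" "Y z" "e z" "fst (snd (fst z))"] elim(2) by (simp add: r_def e_def)
        then have "ennreal (dist (Y z) (U z) powr p) \<le> ennreal (\<eta>1 powr p + A * (dist (X z) (W z) powr p * indicator (S k) (fst z)) + C * (r z powr p + e z powr p))"
          by (rule ennreal_leI)
        also have "\<dots> = ennreal (\<eta>1 powr p) + ennreal A * (ennreal (dist (X z) (W z) powr p) * indicator (S k) (fst z))
            + ennreal C * (ennreal (r z powr p) + ennreal (e z powr p))"
          using A C by (simp add: ennreal_mult indicator_def)
        finally show ?case .
      qed
      also have "\<dots> = ennreal (\<eta>1 powr p) + ennreal A * (\<integral>\<^sup>+z. ennreal (dist (X z) (W z) powr p) * indicator (S k) (fst z) \<partial>\<Theta>)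
          + ennreal C * ((\<integral>\<^sup>+z. ennreal (r z powr p) \<partial>\<Theta>) + (\<integral>\<^sup>+z. ennreal (e z powr p) \<partial>\<Theta>))"
        by (simp add: nn_integral_add nn_integral_cmult emeasure_space_1)
      also have "\<dots> \<le> ennreal (\<eta>1 powr p) + ennreal A * ennreal (\<eta> powr p / (3 * A)) + ennreal C * (ennreal \<kappa> + ennreal \<kappa>)"
        by (intro add_mono mult_left_mono S_\<Theta> re order_refl) auto
      also have "\<dots> = ennreal (\<eta>1 powr p + A * (\<eta> powr p / (3 * A)) + C * (\<kappa> + \<kappa>))"
        using A C \<kappa> by (simp flip: ennreal_mult ennreal_plus)
      also have "\<eta>1 powr p + A * (\<eta> powr p / (3 * A)) + C * (\<kappa> + \<kappa>) = \<eta> powr p"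
        using A C by (simp add: \<eta>1(2) \<kappa>_def field_simps)
      finally show "Wp p \<gamma> \<omega> \<le> \<eta>"
        unfolding dY[symmetric] dU[symmetric] by (intro Wp_le_joint[OF P]) (use p0 \<eta> in auto)
    qed
  qed
qed

section \<open>Co-rays\<close>

text \<open>The threshold for \<open>t\<close> given by the stability estimate depends on
  \<open>s\<close>, so only finitely many times are treated at once; a fine grid will make up for
  that. Below the threshold nothing is claimed, beyond it the estimate holds for every geodesic to
  \<open>\<mu> t\<close>.\<close>

lemma Wp_geodesics_approximate_ray:
  fixes \<mu> \<nu> :: "real \<Rightarrow> 'a::polish_space measure"
  assumes proper: "\<And>(x::'a) r. compact (cball x r)" and len: "length_space TYPE('a)" and nb: "non_branching TYPE('a)"
    and p: "p > 1" and \<mu>: "unit_ray p \<mu>" and \<nu>: "unit_ray p \<nu>"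
    and bus: "\<And>s t. s \<ge> 0 \<Longrightarrow> t \<ge> 0 \<Longrightarrow> busemann p \<mu> (\<nu> t) - busemann p \<mu> (\<nu> s) = s - t"
    and \<epsilon>: "\<epsilon> > 0" and S: "finite S" "\<And>s. s \<in> S \<Longrightarrow> s > 0"
  shows "\<exists>t\<ge>T. \<exists>c\<in>Tgeod p (\<nu> \<epsilon>) (\<mu> t). \<forall>s\<in>S. s \<le> Wp p (\<nu> \<epsilon>) (\<mu> t) \<and> Wp p (c s) (\<nu> (\<epsilon> + s)) \<le> \<epsilon>"
proof -
  note Rm = unit_rayD[OF \<mu>] and Rn = unit_rayD[OF \<nu>]
  define L where "L t = Wp p (\<nu> \<epsilon>) (\<mu> t)" for t
  have \<nu>0: "\<nu> 0 \<in> Pp p" and \<nu>\<epsilon>: "\<nu> \<epsilon> \<in> Pp p" using Rn(1) \<epsilon> by auto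
  have b0: "((\<lambda>t. Wp p (\<nu> 0) (\<mu> t) - t) \<longlongrightarrow> busemann p \<mu> (\<nu> 0)) at_top"
    by (rule busemann_tendsto[OF \<mu> \<nu>0 p])
  have b\<epsilon>: "((\<lambda>t. L t - t) \<longlongrightarrow> busemann p \<mu> (\<nu> \<epsilon>)) at_top"
    unfolding L_def by (rule busemann_tendsto[OF \<mu> \<nu>\<epsilon> p])
  have gap: "((\<lambda>t. Wp p (\<nu> 0) (\<mu> t) - L t) \<longlongrightarrow> \<epsilon>) at_top"
    using tendsto_diff[OF b0 b\<epsilon>] bus[of \<epsilon> 0] \<epsilon> by simp
  have "filterlim (\<lambda>t. (L t - t) + t) at_top at_top"
    by (rule filterlim_tendsto_add_at_top[OF b\<epsilon> filterlim_ident])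
  then have L_top: "filterlim L at_top at_top" by simp
  have ev: "\<forall>\<^sub>F t in at_top. s \<le> L t \<and> (\<forall>c\<in>Tgeod p (\<nu> \<epsilon>) (\<mu> t). Wp p (c s) (\<nu> (\<epsilon> + s)) \<le> \<epsilon>)"
    if s: "s > 0" for s
  proof -
    have "Wp p (\<nu> 0) (\<nu> \<epsilon>) = \<epsilon>" "Wp p (\<nu> \<epsilon>) (\<nu> (\<epsilon> + s)) = s" "Wp p (\<nu> 0) (\<nu> (\<epsilon> + s)) = \<epsilon> + s" "\<nu> (\<epsilon> + s) \<in> Pp p"
      using Rn \<epsilon> s by simp_all
    from Wp_extension_stable[OF proper len nb p \<nu>0 \<nu>\<epsilon> this(4) this(1) \<epsilon> this(2) s this(3) \<epsilon>]
    obtain \<delta> where \<delta>: "\<delta> > 0" "\<And>\<gamma>. \<gamma> \<in> Pp p \<Longrightarrow> Wp p (\<nu> \<epsilon>) \<gamma> = s \<Longrightarrow>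
        (\<epsilon> + s) powr p - \<delta> \<le> Wp p (\<nu> 0) \<gamma> powr p \<Longrightarrow> Wp p \<gamma> (\<nu> (\<epsilon> + s)) \<le> \<epsilon>" by blast
    \<comment> \<open>By the triangle inequality \<open>g t\<close> bounds the distance from
      \<open>\<nu> 0\<close> to \<open>c s\<close> from below, as \<open>c s\<close> has distance
      \<open>L t - s\<close> to \<open>\<mu> t\<close>. The Busemann drop over \<epsilon> makes it
      tend to \<epsilon> + s.\<close>
    define g where "g t = Wp p (\<nu> 0) (\<mu> t) - L t + s" for t
    have g: "(g \<longlongrightarrow> \<epsilon> + s) at_top" unfolding g_def by (intro tendsto_add gap tendsto_const)
    then have gp: "((\<lambda>t. g t powr p) \<longlongrightarrow> (\<epsilon> + s) powr p) at_top"
      using \<epsilon> s by (intro tendsto_powr tendsto_const) auto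
    have "\<forall>\<^sub>F t in at_top. 0 < g t" by (rule order_tendstoD(1)[OF g]) (use \<epsilon> s in simp)
    moreover have "\<forall>\<^sub>F t in at_top. (\<epsilon> + s) powr p - \<delta> < g t powr p"
      by (rule order_tendstoD(1)[OF gp]) (use \<delta>(1) in simp)
    moreover have "\<forall>\<^sub>F t in at_top. s \<le> L t" using L_top by (simp add: filterlim_at_top)
    ultimately show ?thesis using eventually_ge_at_top[of 0]
    proof eventually_elim
      case (elim t)
      have "Wp p (c s) (\<nu> (\<epsilon> + s)) \<le> \<epsilon>" if c: "c \<in> Tgeod p (\<nu> \<epsilon>) (\<mu> t)" for c
      proof (rule \<delta>(2))
        note T = TgeodD[OF c, folded L_def]
        show cs: "c s \<in> Pp p" using T(3) elim s by simp
        have "Wp p (c 0) (c s) = s" using T(4)[of 0 s] elim s by simp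
        then show "Wp p (\<nu> \<epsilon>) (c s) = s" unfolding T(1) .
        have "Wp p (c s) (c (L t)) = L t - s" using T(4)[of s "L t"] elim s by simp
        then have "Wp p (c s) (\<mu> t) = L t - s" unfolding T(2) .
        then have "g t \<le> Wp p (\<nu> 0) (c s)"
          using Wp_triangle[OF \<nu>0 cs Rm(1)[of t] p] elim by (simp add: g_def)
        then have "g t powr p \<le> Wp p (\<nu> 0) (c s) powr p" using elim p by (intro powr_mono2) auto
        then show "(\<epsilon> + s) powr p - \<delta> \<le> Wp p (\<nu> 0) (c s) powr p" using elim by simp
      qed
      then show ?case using elim by blast
    qed
  qed
  have "\<forall>\<^sub>F t in at_top. \<forall>s\<in>S. s \<le> L t \<and> (\<forall>c\<in>Tgeod p (\<nu> \<epsilon>) (\<mu> t). Wp p (c s) (\<nu> (\<epsilon> + s)) \<le> \<epsilon>)"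
    using S ev by (intro eventually_ball_finite) auto
  moreover have "\<forall>\<^sub>F t in at_top. 0 < L t" using L_top by (simp add: filterlim_at_top_dense)
  ultimately have "\<forall>\<^sub>F t in at_top. T \<le> t \<and> 0 \<le> t \<and> 0 < L t \<and>
      (\<forall>s\<in>S. s \<le> L t \<and> (\<forall>c\<in>Tgeod p (\<nu> \<epsilon>) (\<mu> t). Wp p (c s) (\<nu> (\<epsilon> + s)) \<le> \<epsilon>))"
    using eventually_ge_at_top[of T] eventually_ge_at_top[of 0] by eventually_elim blast
  then obtain t where t: "T \<le> t" "0 \<le> t" "0 < L t"
    "\<And>s c. s \<in> S \<Longrightarrow> s \<le> L t" "\<And>s c. s \<in> S \<Longrightarrow> c \<in> Tgeod p (\<nu> \<epsilon>) (\<mu> t) \<Longrightarrow> Wp p (c s) (\<nu> (\<epsilon> + s)) \<le> \<epsilon>"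
    using eventually_happens'[OF trivial_limit_at_top_linorder] by blast
  obtain c where "c \<in> Tgeod p (\<nu> \<epsilon>) (\<mu> t)"
    using Tgeod_exists[OF proper len p \<nu>\<epsilon> Rm(1)[OF t(2)]] t(3) unfolding L_def by blast
  then show ?thesis using t unfolding L_def by blast
qed

text \<open>The approximating geodesics start at \<open>\<nu> (\<epsilon> n)\<close> rather than \<open>\<nu> 0\<close>: only then is their initial
  piece preceded by a piece of the ray \<open>\<nu>\<close>, which is what pins them down.\<close>

lemma co_ray_if_busemann:
  fixes \<mu> \<nu> :: "real \<Rightarrow> 'a::polish_space measure"
  assumes proper: "\<And>(x::'a) r. compact (cball x r)" and len: "length_space TYPE('a)" and nb: "non_branching TYPE('a)"
    and p: "p > 1" and \<mu>: "unit_ray p \<mu>" and \<nu>: "unit_ray p \<nu>"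
    and bus: "\<And>s t. s \<ge> 0 \<Longrightarrow> t \<ge> 0 \<Longrightarrow> busemann p \<mu> (\<nu> t) - busemann p \<mu> (\<nu> s) = s - t"
  shows "co_ray p \<mu> \<nu>"
proof -
  note Rm = unit_rayD[OF \<mu>] and Rn = unit_rayD[OF \<nu>]
  define \<epsilon> where "\<epsilon> n = inverse (real (Suc n))" for n
  have \<epsilon>: "\<epsilon> n > 0" for n by (simp add: \<epsilon>_def)
  have \<epsilon>0: "\<epsilon> \<longlonglongrightarrow> 0" unfolding \<epsilon>_def by (rule LIMSEQ_inverse_real_of_nat)
  \<comment> \<open>A grid of mesh \<open>\<epsilon> n\<close> = 1/(n+1) reaching up to n + 1: every
    time up to n can be rounded up within it. It omits 0, as the stability estimate needs positive
    times.\<close>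
  define S where "S n = (\<lambda>j. real j * \<epsilon> n) ` {1..Suc n * Suc n}" for n
  have "\<exists>t\<ge>real n. \<exists>c\<in>Tgeod p (\<nu> (\<epsilon> n)) (\<mu> t). \<forall>s\<in>S n. s \<le> Wp p (\<nu> (\<epsilon> n)) (\<mu> t) \<and> Wp p (c s) (\<nu> (\<epsilon> n + s)) \<le> \<epsilon> n" for n
    using \<epsilon>[of n] by (intro Wp_geodesics_approximate_ray[OF proper len nb p \<mu> \<nu> bus]) (auto simp: S_def)
  then obtain t c where t: "\<And>n. t n \<ge> real n" and c: "\<And>n. c n \<in> Tgeod p (\<nu> (\<epsilon> n)) (\<mu> (t n))"
    and S: "\<And>n s. s \<in> S n \<Longrightarrow> s \<le> Wp p (\<nu> (\<epsilon> n)) (\<mu> (t n)) \<and> Wp p (c n s) (\<nu> (\<epsilon> n + s)) \<le> \<epsilon> n" by metis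
  have "filterlim t at_top sequentially"
    by (rule filterlim_at_top_mono[OF filterlim_real_sequentially]) (use t in auto)
  moreover have "\<forall>n. \<nu> (\<epsilon> n) \<in> Pp p" using Rn(1) \<epsilon> less_imp_le by blast
  moreover have "(\<lambda>n. Wp p (\<nu> (\<epsilon> n)) (\<nu> 0)) \<longlonglongrightarrow> 0"
  proof -
    have "Wp p (\<nu> (\<epsilon> n)) (\<nu> 0) = \<epsilon> n" for n using Rn(2)[of "\<epsilon> n" 0] \<epsilon>[of n] by simp
    then show ?thesis using \<epsilon>0 by simp
  qed
  moreover have "(\<lambda>n. Wp p (c n r) (\<nu> r)) \<longlonglongrightarrow> 0" if r: "r \<ge> 0" for r
  proof (rule tendsto_sandwich[where f = "\<lambda>_. 0" and h = "\<lambda>n. 4 * \<epsilon> n"])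
    show "(\<lambda>n. 4 * \<epsilon> n) \<longlonglongrightarrow> 0" using tendsto_mult_right_zero[OF \<epsilon>0] by simp
    show "\<forall>\<^sub>F n in sequentially. 0 \<le> Wp p (c n r) (\<nu> r)" by (simp add: Wp_nonneg)
    obtain N :: nat where N: "r \<le> real N" using real_arch_simple by blast
    show "\<forall>\<^sub>F n in sequentially. Wp p (c n r) (\<nu> r) \<le> 4 * \<epsilon> n"
      using eventually_ge_at_top[of N]
    proof eventually_elim
      case (elim n)
      \<comment> \<open>Rounding up makes \<open>s\<close> at least \<open>r\<close>, so that
        \<open>s\<close>, and with it \<open>r\<close>, lies in the domain of the geodesic. The four
        \<epsilon> are one for the way from \<open>r\<close> to \<open>s\<close> along
        \<open>c n\<close>, one for the approximation at \<open>s\<close>, and two for the way back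
        along \<nu> from \<open>\<epsilon> n + s\<close> to \<open>r\<close>.\<close>
      define j where "j = Suc (nat \<lfloor>r * Suc n\<rfloor>)"
      define s where "s = real j * \<epsilon> n"
      have j: "r * Suc n \<le> real j" "real j \<le> r * Suc n + 1"
        using r by (auto simp: j_def) linarith+
      have s1: "r \<le> s"
      proof -
        have "r = (r * Suc n) * \<epsilon> n" by (simp add: \<epsilon>_def)
        also have "\<dots> \<le> s" unfolding s_def using j(1) \<epsilon>[of n] by (intro mult_right_mono) auto
        finally show ?thesis .
      qed
      have s2: "s \<le> r + \<epsilon> n"
      proof -
        have "s \<le> (r * Suc n + 1) * \<epsilon> n" unfolding s_def using j(2) \<epsilon>[of n] by (intro mult_right_mono) auto
        also have "\<dots> = r + \<epsilon> n" by (simp add: \<epsilon>_def field_simps)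
        finally show ?thesis .
      qed
      have "r * Suc n \<le> real n * Suc n" using N elim by (intro mult_right_mono) auto
      then have "real j \<le> real n * real (Suc n) + 1" using j(2) by linarith
      then have "real j \<le> real (n * Suc n + 1)" by (simp only: of_nat_add of_nat_mult of_nat_1)
      then have "j \<le> n * Suc n + 1" by (simp only: of_nat_le_iff)
      then have "j \<in> {1..Suc n * Suc n}" by (auto simp: j_def)
      then have "s \<in> S n" by (auto simp: s_def S_def)
      note sS = S[OF this]
      note T = TgeodD[OF c[of n]]
      have P: "c n r \<in> Pp p" "c n s \<in> Pp p" "\<nu> r \<in> Pp p" "\<nu> (\<epsilon> n + s) \<in> Pp p"
        using T(3) sS s1 r Rn(1) \<epsilon>[of n] by auto
      have "Wp p (c n r) (c n s) = s - r" using T(4)[of r s] sS s1 r by simp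
      moreover have "Wp p (\<nu> (\<epsilon> n + s)) (\<nu> r) = \<epsilon> n + s - r" using Rn(2)[of "\<epsilon> n + s" r] s1 r \<epsilon>[of n] by simp
      ultimately show "Wp p (c n r) (\<nu> r) \<le> 4 * \<epsilon> n"
        using Wp_triangle[OF P(1,2,3) p] Wp_triangle[OF P(2,4,3) p] sS s2 by linarith
    qed
  qed auto
  ultimately show ?thesis unfolding co_ray_def using \<nu> c
    by (intro conjI exI[of _ t] exI[of _ "\<lambda>n. \<nu> (\<epsilon> n)"] exI[of _ c]) auto
qed

theorem theorem1p3:
  fixes p :: real
    and \<mu> \<nu> :: "real \<Rightarrow> 'a::polish_space measure"
  assumes "locally_compact_space (euclidean :: 'a topology)"
    and "\<not> compact (UNIV :: 'a set)"
    and "length_space TYPE('a)"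
    and "non_branching TYPE('a)"
    and "p > 1"
    and "unit_ray p \<mu>"
    and "unit_ray p \<nu>"
  shows "co_ray p \<mu> \<nu> \<longleftrightarrow>
         (\<forall>s\<ge>0. \<forall>t\<ge>0. busemann p \<mu> (\<nu> t) - busemann p \<mu> (\<nu> s) = s - t)"
proof
  assume "co_ray p \<mu> \<nu>"
  then show "\<forall>s\<ge>0. \<forall>t\<ge>0. busemann p \<mu> (\<nu> t) - busemann p \<mu> (\<nu> s) = s - t"
    using busemann_along_co_ray[OF assms(5,6)] by blast
next
  assume "\<forall>s\<ge>0. \<forall>t\<ge>0. busemann p \<mu> (\<nu> t) - busemann p \<mu> (\<nu> s) = s - t"
  then show "co_ray p \<mu> \<nu>"
    by (intro co_ray_if_busemann[OF hopf_rinow_compact_cball[OF assms(1,3)] assms(3-7)]) blast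
qed

end
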